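(* Let $k$ be a field of characteristic zero. Then every automorphism of the free Poisson algebra $P\langle x_1,x_2\rangle$ in two variables over $k$ is tame.
   Context: A Poisson algebra over a field $k$ is a $k$-vector space $B$ with two bilinear operations $x\cdot y$ and $\{x,y\}$ such that $B$ is a commutative associative algebra under $\cdot$, a Lie algebra under $\{\,,\,\}$, and $\{x,y\cdot z\}=\{x,y\}\cdot z+y\cdot\{x,z\}$ for all $x,y,z$. The free Poisson algebra $P\langle x_1,\dots,x_n\rangle$ is the symmetric algebra $S(g)$ of the free Lie algebra $g$ on $x_1,\dots,x_n$, i.e. the polynomial algebra on a linear basis $e_1,e_2,\dots$ of $g$, with Poisson bracket determined by $\{e_i,e_j\}=[e_i,e_j]$ and the Leibniz identity; it is free as a Poisson algebra on $x_1,\dots,x_n$. Automorphisms are automorphisms of Poisson $k$-algebras. An automorphism of $P\langle x_1,\dots,x_n\rangle$ is elementary if for some $i$ it sends $x_i\mapsto \alpha x_i+h$ with $0\neq\alpha\in k$, $h\in P\langle x_j : j\neq i\rangle$, and fixes $x_j$ for $j\ne i$; it is tame if it is a composition of elementary automorphisms. (For $n=2$, $P\langle x_j\rangle=k[x_j]$.) *)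

theory Defs
  imports Complex_Main "HOL-Library.Poly_Mapping" "HOL-Library.Numeral_Type"
begin

section \<open>Lie algebras and Poisson algebras\<close>

locale lie_algebra = vector_space scale
  for scale :: "'k::field \<Rightarrow> 'g::ab_group_add \<Rightarrow> 'g" +
  fixes br :: "'g \<Rightarrow> 'g \<Rightarrow> 'g"
  assumes br_add_left: "br (x + y) z = br x z + br y z"
    and br_add_right: "br x (y + z) = br x y + br x z"
    and br_scale_left: "br (scale c x) y = scale c (br x y)"
    and br_scale_right: "br x (scale c y) = scale c (br x y)"
    and br_self: "br x x = 0"
    and br_jacobi: "br x (br y z) + br y (br z x) + br z (br x y) = 0"
begin

lemma br_skew: "br y x = - br x y"
proof -
  have "br (x + y) (x + y) = 0" by (rule br_self)
  then have "br x y + br y x = 0"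
    unfolding br_add_left br_add_right by (simp add: br_self add.commute)
  then show ?thesis by (simp add: add_eq_0_iff)
qed

lemma br_zero_left [simp]: "br 0 x = 0"
  using br_add_left[of 0 0 x] by simp

lemma br_zero_right [simp]: "br x 0 = 0"
  using br_add_right[of x 0 0] by simp

end

text \<open>
  The underlying commutative associative algebra is unital: its multiplication is that of the
  class \<^class>\<open>comm_ring_1\<close>.
\<close>

locale poisson_algebra = lie_algebra scale br
  for scale :: "'k::field \<Rightarrow> 'b::comm_ring_1 \<Rightarrow> 'b" and br :: "'b \<Rightarrow> 'b \<Rightarrow> 'b" +
  assumes scale_mult_left: "scale c x * y = scale c (x * y)"
    and br_leibniz: "br x (y * z) = br x y * z + y * br x z"
begin

definition automorphism :: "('b \<Rightarrow> 'b) \<Rightarrow> bool" where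
  "automorphism \<phi> \<longleftrightarrow> bij \<phi> \<and>
     (\<forall>x y. \<phi> (x + y) = \<phi> x + \<phi> y) \<and>
     (\<forall>c x. \<phi> (scale c x) = scale c (\<phi> x)) \<and>
     \<phi> 1 = 1 \<and>
     (\<forall>x y. \<phi> (x * y) = \<phi> x * \<phi> y) \<and>
     (\<forall>x y. \<phi> (br x y) = br (\<phi> x) (\<phi> y))"

inductive_set subalgebra_generated :: "'b set \<Rightarrow> 'b set" for S :: "'b set" where
  base: "x \<in> S \<Longrightarrow> x \<in> subalgebra_generated S"
| one: "1 \<in> subalgebra_generated S"
| add: "x \<in> subalgebra_generated S \<Longrightarrow> y \<in> subalgebra_generated S
        \<Longrightarrow> x + y \<in> subalgebra_generated S"
| scale: "x \<in> subalgebra_generated S \<Longrightarrow> scale c x \<in> subalgebra_generated S"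
| mult: "x \<in> subalgebra_generated S \<Longrightarrow> y \<in> subalgebra_generated S
        \<Longrightarrow> x * y \<in> subalgebra_generated S"
| br: "x \<in> subalgebra_generated S \<Longrightarrow> y \<in> subalgebra_generated S
        \<Longrightarrow> br x y \<in> subalgebra_generated S"

end


section \<open>The free Lie algebra\<close>

text \<open>
  The free Lie algebra over \<open>'k\<close> on the set of generators \<open>'x\<close> is the algebra of all formal
  Lie expressions modulo the least congruence that contains the axioms of Lie \<open>'k\<close>-algebras.
\<close>

datatype ('k, 'x) lie_term =
    TGen 'x
  | TZero
  | TAdd "('k, 'x) lie_term" "('k, 'x) lie_term"
  | TScale 'k "('k, 'x) lie_term"
  | TBr "('k, 'x) lie_term" "('k, 'x) lie_term"

inductive lie_eq :: "('k::field, 'x) lie_term \<Rightarrow> ('k, 'x) lie_term \<Rightarrow> bool" where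
  refl: "lie_eq s s"
| sym: "lie_eq s t \<Longrightarrow> lie_eq t s"
| trans: "lie_eq s t \<Longrightarrow> lie_eq t u \<Longrightarrow> lie_eq s u"
| add_cong: "lie_eq s s' \<Longrightarrow> lie_eq t t' \<Longrightarrow> lie_eq (TAdd s t) (TAdd s' t')"
| scale_cong: "lie_eq s s' \<Longrightarrow> lie_eq (TScale c s) (TScale c s')"
| br_cong: "lie_eq s s' \<Longrightarrow> lie_eq t t' \<Longrightarrow> lie_eq (TBr s t) (TBr s' t')"
| add_assoc: "lie_eq (TAdd (TAdd s t) u) (TAdd s (TAdd t u))"
| add_comm: "lie_eq (TAdd s t) (TAdd t s)"
| add_zero: "lie_eq (TAdd TZero s) s"
| scale_add: "lie_eq (TScale c (TAdd s t)) (TAdd (TScale c s) (TScale c t))"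
| add_scale: "lie_eq (TScale (c + d) s) (TAdd (TScale c s) (TScale d s))"
| scale_scale: "lie_eq (TScale c (TScale d s)) (TScale (c * d) s)"
| scale_one: "lie_eq (TScale 1 s) s"
| scale_zero: "lie_eq (TScale 0 s) TZero"
| br_add_left: "lie_eq (TBr (TAdd s t) u) (TAdd (TBr s u) (TBr t u))"
| br_add_right: "lie_eq (TBr s (TAdd t u)) (TAdd (TBr s t) (TBr s u))"
| br_scale_left: "lie_eq (TBr (TScale c s) t) (TScale c (TBr s t))"
| br_scale_right: "lie_eq (TBr s (TScale c t)) (TScale c (TBr s t))"
| br_self: "lie_eq (TBr s s) TZero"
| br_jacobi: "lie_eq (TAdd (TAdd (TBr s (TBr t u)) (TBr t (TBr u s))) (TBr u (TBr s t))) TZero"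

quotient_type (overloaded) ('k, 'x) free_lie = "('k::field, 'x) lie_term" / lie_eq
proof (rule equivpI)
  show "reflp (lie_eq :: ('k, 'x) lie_term \<Rightarrow> _)" by (rule reflpI) (rule lie_eq.refl)
  show "symp (lie_eq :: ('k, 'x) lie_term \<Rightarrow> _)" by (rule sympI) (rule lie_eq.sym)
  show "transp (lie_eq :: ('k, 'x) lie_term \<Rightarrow> _)" by (rule transpI) (rule lie_eq.trans)
qed

instantiation free_lie :: (field, type) ab_group_add
begin

lift_definition zero_free_lie :: "('a, 'b) free_lie" is TZero .

lift_definition plus_free_lie :: "('a, 'b) free_lie \<Rightarrow> ('a, 'b) free_lie \<Rightarrow> ('a, 'b) free_lie"
  is TAdd by (rule lie_eq.add_cong)

lift_definition uminus_free_lie :: "('a, 'b) free_lie \<Rightarrow> ('a, 'b) free_lie"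
  is "TScale (- 1)" by (rule lie_eq.scale_cong)

definition minus_free_lie :: "('a, 'b) free_lie \<Rightarrow> ('a, 'b) free_lie \<Rightarrow> ('a, 'b) free_lie"
  where "minus_free_lie x y = x + - y"

instance
proof
  fix a b c :: "('a, 'b) free_lie"
  show "a + b + c = a + (b + c)" by transfer (rule lie_eq.add_assoc)
  show "a + b = b + a" by transfer (rule lie_eq.add_comm)
  show "0 + a = a" by transfer (rule lie_eq.add_zero)
  show "a - b = a + - b" by (rule minus_free_lie_def)
  show "- a + a = 0"
  proof transfer
    fix s :: "('a, 'b) lie_term"
    have 1: "lie_eq (TAdd (TScale (- 1) s) s) (TAdd (TScale (- 1) s) (TScale 1 s))"
      by (intro lie_eq.add_cong lie_eq.refl lie_eq.sym[OF lie_eq.scale_one])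
    have 2: "lie_eq (TAdd (TScale (- 1) s) (TScale 1 s)) (TScale (- 1 + 1) s)"
      by (rule lie_eq.sym[OF lie_eq.add_scale])
    have 3: "lie_eq (TScale (- 1 + 1) s) TZero"
      using lie_eq.scale_zero[of s] by simp
    show "lie_eq (TAdd (TScale (- 1) s) s) TZero"
      using 1 2 3 by (blast intro: lie_eq.trans)
  qed
qed

end

lift_definition lie_gen :: "'x \<Rightarrow> ('k::field, 'x) free_lie" is TGen .

lift_definition lie_scale :: "'k::field \<Rightarrow> ('k, 'x) free_lie \<Rightarrow> ('k, 'x) free_lie"
  is TScale by (rule lie_eq.scale_cong)

lift_definition lie_br :: "('k::field, 'x) free_lie \<Rightarrow> ('k, 'x) free_lie \<Rightarrow> ('k, 'x) free_lie"
  is TBr by (rule lie_eq.br_cong)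

global_interpretation free_lie: lie_algebra "lie_scale :: 'k::field \<Rightarrow> _" "lie_br :: _ \<Rightarrow> _ \<Rightarrow> ('k, 'x) free_lie"
proof
  fix a b :: 'k and x y z :: "('k, 'x) free_lie"
  show "lie_scale a (x + y) = lie_scale a x + lie_scale a y"
    by transfer (rule lie_eq.scale_add)
  show "lie_scale (a + b) x = lie_scale a x + lie_scale b x"
    by transfer (rule lie_eq.add_scale)
  show "lie_scale a (lie_scale b x) = lie_scale (a * b) x"
    by transfer (rule lie_eq.scale_scale)
  show "lie_scale 1 x = x" by transfer (rule lie_eq.scale_one)
  show "lie_br (x + y) z = lie_br x z + lie_br y z" by transfer (rule lie_eq.br_add_left)
  show "lie_br x (y + z) = lie_br x y + lie_br x z" by transfer (rule lie_eq.br_add_right)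
  show "lie_br (lie_scale a x) y = lie_scale a (lie_br x y)"
    by transfer (rule lie_eq.br_scale_left)
  show "lie_br x (lie_scale a y) = lie_scale a (lie_br x y)"
    by transfer (rule lie_eq.br_scale_right)
  show "lie_br x x = 0" by transfer (rule lie_eq.br_self)
  show "lie_br x (lie_br y z) + lie_br y (lie_br z x) + lie_br z (lie_br x y) = 0"
    by transfer (rule lie_eq.br_jacobi)
qed

text \<open>
  A linear basis of the free Lie algebra, chosen among the iterated brackets of generators.
  The choice only matters up to isomorphism.
\<close>

inductive_set lie_monomials :: "('k::field, 'x) free_lie set" where
  gen: "lie_gen x \<in> lie_monomials"
| br: "u \<in> lie_monomials \<Longrightarrow> v \<in> lie_monomials \<Longrightarrow> lie_br u v \<in> lie_monomials"

definition lie_basis_set :: "('k::field, 'x) free_lie set" where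
  "lie_basis_set = (SOME B. B \<subseteq> lie_monomials \<and> free_lie.independent B \<and> free_lie.span B = UNIV)"

lemma abs_free_lie_add: "abs_free_lie (TAdd s t) = abs_free_lie s + abs_free_lie t"
  by (simp add: plus_free_lie.abs_eq)

lemma span_lie_monomials: "free_lie.span lie_monomials = (UNIV :: ('k::field, 'x) free_lie set)"
proof -
  let ?S = "free_lie.span lie_monomials :: ('k, 'x) free_lie set"
  have br1: "lie_br u v \<in> ?S" if "u \<in> lie_monomials" "v \<in> ?S" for u v
    using that(2)
  proof (induction rule: free_lie.span_induct_alt)
    case base
    show ?case by (simp add: free_lie.span_zero)
  next
    case (step c x y)
    then show ?case using that(1)
      by (simp add: free_lie.br_add_right free_lie.br_scale_right free_lie.span_add
          free_lie.span_scale free_lie.span_base lie_monomials.br)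
  qed
  have br2: "lie_br u v \<in> ?S" if "u \<in> ?S" "v \<in> ?S" for u v
    using that(1)
  proof (induction rule: free_lie.span_induct_alt)
    case base
    show ?case by (simp add: free_lie.span_zero)
  next
    case (step c x y)
    then show ?case using that(2) br1
      by (simp add: free_lie.br_add_left free_lie.br_scale_left free_lie.span_add
          free_lie.span_scale)
  qed
  have "abs_free_lie t \<in> ?S" for t :: "('k, 'x) lie_term"
  proof (induction t)
    case (TGen x)
    then show ?case
      by (metis free_lie.span_base lie_gen.abs_eq lie_monomials.gen)
  next
    case TZero
    then show ?case by (metis free_lie.span_zero zero_free_lie_def)
  next
    case (TAdd s t)
    then show ?case by (simp add: abs_free_lie_add free_lie.span_add)
  next
    case (TScale c s)
    then show ?case by (metis free_lie.span_scale lie_scale.abs_eq)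
  next
    case (TBr s t)
    then show ?case by (metis br2 lie_br.abs_eq)
  qed
  then have "x \<in> ?S" for x by (metis Quotient_abs_rep[OF Quotient_free_lie])
  then show ?thesis by blast
qed

lemma lie_basis_set:
  "(lie_basis_set :: ('k::field, 'x) free_lie set) \<subseteq> lie_monomials"
  "free_lie.independent (lie_basis_set :: ('k, 'x) free_lie set)"
  "free_lie.span (lie_basis_set :: ('k, 'x) free_lie set) = UNIV"
proof -
  obtain B :: "('k, 'x) free_lie set" where
    B: "B \<subseteq> lie_monomials" "free_lie.independent B" "lie_monomials \<subseteq> free_lie.span B"
    using free_lie.maximal_independent_subset by blast
  have "free_lie.span B = UNIV"
    using free_lie.span_mono[OF B(3)] unfolding span_lie_monomials by (simp add: free_lie.span_span top.extremum_unique)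
  with B have "\<exists>B :: ('k, 'x) free_lie set.
      B \<subseteq> lie_monomials \<and> free_lie.independent B \<and> free_lie.span B = UNIV"
    by blast
  from someI_ex[OF this]
  show "(lie_basis_set :: ('k, 'x) free_lie set) \<subseteq> lie_monomials"
    "free_lie.independent (lie_basis_set :: ('k, 'x) free_lie set)"
    "free_lie.span (lie_basis_set :: ('k, 'x) free_lie set) = UNIV"
    unfolding lie_basis_set_def by auto
qed

text \<open>The sum of the coefficients of the generators is a well-defined linear functional.\<close>

primrec term_aug :: "('k::field, 'x) lie_term \<Rightarrow> 'k" where
  "term_aug (TGen x) = 1"
| "term_aug TZero = 0"
| "term_aug (TAdd s t) = term_aug s + term_aug t"
| "term_aug (TScale c s) = c * term_aug s"
| "term_aug (TBr s t) = 0"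

lemma term_aug_cong: "lie_eq s t \<Longrightarrow> term_aug s = term_aug t"
  by (induction rule: lie_eq.induct) (simp_all add: algebra_simps)

lemma lie_gen_nonzero: "lie_gen x \<noteq> (0 :: ('k::field, 'x) free_lie)"
proof transfer
  fix x :: 'x
  show "\<not> lie_eq (TGen x) (TZero :: ('k, 'x) lie_term)"
    using term_aug_cong[of "TGen x" "TZero :: ('k, 'x) lie_term"] by auto
qed

typedef (overloaded) ('k, 'x) lie_basis = "lie_basis_set :: ('k::field, 'x) free_lie set"
proof -
  have "(lie_basis_set :: ('k, 'x) free_lie set) \<noteq> {}"
  proof
    assume "(lie_basis_set :: ('k, 'x) free_lie set) = {}"
    then have "(UNIV :: ('k, 'x) free_lie set) = {0}"
      using lie_basis_set(3)[where ?'k = 'k and ?'x = 'x] by simp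
    then have "(lie_gen undefined :: ('k, 'x) free_lie) \<in> {0}" by (metis UNIV_I)
    then show False by (simp add: lie_gen_nonzero)
  qed
  then show "\<exists>x. x \<in> (lie_basis_set :: ('k, 'x) free_lie set)" by blast
qed


section \<open>The free Poisson algebra\<close>

text \<open>
  The symmetric algebra of the free Lie algebra: polynomials over \<open>'k\<close> in the elements of the
  basis, i.e. finitely supported functions from monomials (exponent vectors of finite support)
  to \<open>'k\<close>, with convolution as multiplication.
\<close>

type_synonym ('k, 'x) free_poisson = "(('k, 'x) lie_basis \<Rightarrow>\<^sub>0 nat) \<Rightarrow>\<^sub>0 'k"

definition fp_scale :: "'k::field \<Rightarrow> ('k, 'x) free_poisson \<Rightarrow> ('k, 'x) free_poisson" where
  "fp_scale c f = Poly_Mapping.map ((*) c) f"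

definition fp_basis_var :: "('k::field, 'x) lie_basis \<Rightarrow> ('k, 'x) free_poisson" where
  "fp_basis_var e = Poly_Mapping.single (Poly_Mapping.single e 1) 1"

definition fp_of_lie :: "('k::field, 'x) free_lie \<Rightarrow> ('k, 'x) free_poisson" where
  "fp_of_lie u = (\<Sum>e | free_lie.representation lie_basis_set u (Rep_lie_basis e) \<noteq> 0.
     fp_scale (free_lie.representation lie_basis_set u (Rep_lie_basis e)) (fp_basis_var e))"

definition fp_gen :: "'x \<Rightarrow> ('k::field, 'x) free_poisson" where
  "fp_gen x = fp_of_lie (lie_gen x)"

definition fp_pderiv :: "('k::field, 'x) lie_basis \<Rightarrow> ('k, 'x) free_poisson \<Rightarrow> ('k, 'x) free_poisson"
  where "fp_pderiv e f = (\<Sum>m\<in>Poly_Mapping.keys f.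
     Poly_Mapping.single (m - Poly_Mapping.single e 1)
       (Poly_Mapping.lookup f m * of_nat (Poly_Mapping.lookup m e)))"

definition fp_vars :: "('k::field, 'x) free_poisson \<Rightarrow> ('k, 'x) lie_basis set" where
  "fp_vars f = (\<Union>m\<in>Poly_Mapping.keys f. Poly_Mapping.keys m)"

text \<open>
  The Leibniz identity and the values on pairs of basis elements force the bracket to be
  \<open>{f, g} = \<Sum> \<partial>f/\<partial>d \<cdot> \<partial>g/\<partial>e \<cdot> [d, e]\<close>, where \<open>d\<close> and \<open>e\<close> run over the basis.
\<close>

definition fp_br :: "('k::field, 'x) free_poisson \<Rightarrow> ('k, 'x) free_poisson \<Rightarrow> ('k, 'x) free_poisson"
  where "fp_br f g = (\<Sum>d\<in>fp_vars f. \<Sum>e\<in>fp_vars g.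
     fp_pderiv d f * fp_pderiv e g * fp_of_lie (lie_br (Rep_lie_basis d) (Rep_lie_basis e)))"


subsection \<open>It is a Poisson algebra\<close>

lemma fp_scale_conv_mult: "fp_scale c f = Poly_Mapping.single 0 c * f"
  unfolding fp_scale_def by (rule mult_map_scale_conv_mult)

lemma fp_vector_space: "vector_space (fp_scale :: 'k::field \<Rightarrow> ('k, 'x) free_poisson \<Rightarrow> _)"
proof
  fix a b :: 'k and f g :: "('k, 'x) free_poisson"
  show "fp_scale a (f + g) = fp_scale a f + fp_scale a g"
    by (simp add: fp_scale_conv_mult distrib_left)
  show "fp_scale (a + b) f = fp_scale a f + fp_scale b f"
    by (simp add: fp_scale_conv_mult single_add distrib_right)
  show "fp_scale a (fp_scale b f) = fp_scale (a * b) f"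
    by (simp add: fp_scale_conv_mult mult.assoc[symmetric] mult_single)
  show "fp_scale 1 f = f"
    by (simp add: fp_scale_conv_mult)
qed

lemma fp_scale_mult_left: "fp_scale c f * g = fp_scale c (f * g)"
  by (simp add: fp_scale_conv_mult mult.assoc)

lemma fp_scale_mult_right: "f * fp_scale c g = fp_scale c (f * g)"
  by (simp add: fp_scale_conv_mult mult.left_commute)

lemma fp_sum_monomials:
  "(\<Sum>m\<in>Poly_Mapping.keys f. Poly_Mapping.single m (Poly_Mapping.lookup f m)) = f"
  by (rule poly_mapping_eqI)
    (auto simp: lookup_sum lookup_single when_def in_keys_iff)

lemma fp_induct [case_names const var add mult]:
  fixes f :: "('k::field, 'x) free_poisson"
  assumes const: "\<And>c. P (Poly_Mapping.single 0 c)"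
    and var: "\<And>e. P (fp_basis_var e)"
    and add: "\<And>f g. P f \<Longrightarrow> P g \<Longrightarrow> P (f + g)"
    and mult: "\<And>f g. P f \<Longrightarrow> P g \<Longrightarrow> P (f * g)"
  shows "P f"
proof -
  have pow: "P (Poly_Mapping.single (Poly_Mapping.single e n) 1)" for e n
  proof (induction n)
    case 0
    show ?case using const[of 1] by simp
  next
    case (Suc n)
    have "Poly_Mapping.single (Poly_Mapping.single e (Suc n)) (1 :: 'k) =
        fp_basis_var e * Poly_Mapping.single (Poly_Mapping.single e n) 1"
      by (simp add: fp_basis_var_def mult_single single_add[symmetric])
    then show ?case using mult[OF var Suc.IH] by simp
  qed
  have mon: "P (Poly_Mapping.single m 1)" for m
  proof (induction m rule: update_induct)
    case const
    show ?case using assms(1)[of 1] by simp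
  next
    case (update m e n)
    have "Poly_Mapping.update e n m = m + Poly_Mapping.single e n"
      using update(1)
      by (intro poly_mapping_eqI)
        (auto simp: lookup_update lookup_add lookup_single when_def in_keys_iff)
    then have "Poly_Mapping.single (Poly_Mapping.update e n m) (1 :: 'k) =
        Poly_Mapping.single m 1 * Poly_Mapping.single (Poly_Mapping.single e n) 1"
      by (simp add: mult_single)
    then show ?case using mult[OF update(3) pow] by simp
  qed
  have mon': "P (Poly_Mapping.single m c)" for m c
    using mult[OF const[of c] mon[of m]] by (simp add: mult_single)
  have "P (\<Sum>m\<in>A. Poly_Mapping.single m (Poly_Mapping.lookup f m))" if "finite A" for A
    using that
  proof (induction A)
    case empty
    show ?case using const[of 0] by simp
  next
    case (insert m A)
    then show ?case by (simp add: add mon')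
  qed
  from this[OF finite_keys, of f] show ?thesis by (simp add: fp_sum_monomials)
qed

lemma fp_pderiv_superset:
  assumes "finite A" "Poly_Mapping.keys f \<subseteq> A"
  shows "fp_pderiv e f = (\<Sum>m\<in>A. Poly_Mapping.single (m - Poly_Mapping.single e 1)
       (Poly_Mapping.lookup f m * of_nat (Poly_Mapping.lookup m e)))"
  unfolding fp_pderiv_def using assms
  by (intro sum.mono_neutral_left) (auto simp: in_keys_iff)

lemma fp_pderiv_single:
  "fp_pderiv e (Poly_Mapping.single m c) =
     Poly_Mapping.single (m - Poly_Mapping.single e 1) (c * of_nat (Poly_Mapping.lookup m e))"
  by (subst fp_pderiv_superset[of "{m}"]) auto

lemma fp_pderiv_const [simp]: "fp_pderiv e (Poly_Mapping.single 0 c) = 0"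
  by (simp add: fp_pderiv_single)

lemma fp_pderiv_var: "fp_pderiv e (fp_basis_var d) = (if d = e then 1 else 0)"
  by (simp add: fp_basis_var_def fp_pderiv_single lookup_single when_def)

lemma fp_pderiv_add: "fp_pderiv e (f + g) = fp_pderiv e f + fp_pderiv e g"
proof -
  let ?A = "Poly_Mapping.keys f \<union> Poly_Mapping.keys g"
  have "Poly_Mapping.keys (f + g) \<subseteq> ?A" by (rule keys_add)
  then show ?thesis
    by (simp add: fp_pderiv_superset[of ?A] lookup_add distrib_right single_add sum.distrib)
qed

lemma fp_pderiv_zero [simp]: "fp_pderiv e 0 = 0"
  by (simp add: fp_pderiv_def)

lemma fp_pderiv_sum: "fp_pderiv e (sum f A) = (\<Sum>i\<in>A. fp_pderiv e (f i))"
  by (induction A rule: infinite_finite_induct) (simp_all add: fp_pderiv_add)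

lemma fp_pderiv_mult: "fp_pderiv e (f * g) = fp_pderiv e f * g + f * fp_pderiv e g"
proof -
  have shift: "Poly_Mapping.single (m + n - Poly_Mapping.single e 1) (c * of_nat (Poly_Mapping.lookup m e)) =
      Poly_Mapping.single (m - Poly_Mapping.single e 1 + n) (c * of_nat (Poly_Mapping.lookup m e))"
    for m n :: "('a, 'b) lie_basis \<Rightarrow>\<^sub>0 nat" and c :: 'a
  proof (cases "Poly_Mapping.lookup m e = 0")
    case False
    then have "m + n - Poly_Mapping.single e 1 = m - Poly_Mapping.single e 1 + n"
      by (intro poly_mapping_eqI) (auto simp: lookup_minus lookup_add lookup_single when_def)
    then show ?thesis by simp
  qed simp
  have mon: "fp_pderiv e (Poly_Mapping.single m c * Poly_Mapping.single n d) =
      fp_pderiv e (Poly_Mapping.single m c) * Poly_Mapping.single n d +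
      Poly_Mapping.single m c * fp_pderiv e (Poly_Mapping.single n d)" for m n c d
    using shift[of m n "c * d"] shift[of n m "c * d"]
    by (simp add: mult_single fp_pderiv_single lookup_add distrib_left single_add ac_simps)
  let ?f = "\<lambda>m. Poly_Mapping.single m (Poly_Mapping.lookup f m)"
  let ?g = "\<lambda>m. Poly_Mapping.single m (Poly_Mapping.lookup g m)"
  have "fp_pderiv e (sum ?f (Poly_Mapping.keys f) * sum ?g (Poly_Mapping.keys g)) =
      fp_pderiv e (sum ?f (Poly_Mapping.keys f)) * sum ?g (Poly_Mapping.keys g) +
      sum ?f (Poly_Mapping.keys f) * fp_pderiv e (sum ?g (Poly_Mapping.keys g))"
    by (simp only: sum_product fp_pderiv_sum mon sum.distrib)
  then show ?thesis by (simp only: fp_sum_monomials)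
qed

lemma finite_fp_vars [simp]: "finite (fp_vars f)"
  by (simp add: fp_vars_def)

lemma fp_pderiv_not_in_vars: "e \<notin> fp_vars f \<Longrightarrow> fp_pderiv e f = 0"
  unfolding fp_pderiv_def fp_vars_def by (intro sum.neutral) (auto simp: in_keys_iff)

lemma fp_br_superset:
  assumes "finite A" "fp_vars f \<subseteq> A" "finite B" "fp_vars g \<subseteq> B"
  shows "fp_br f g = (\<Sum>d\<in>A. \<Sum>e\<in>B.
     fp_pderiv d f * fp_pderiv e g * fp_of_lie (lie_br (Rep_lie_basis d) (Rep_lie_basis e)))"
proof -
  have "fp_br f g = (\<Sum>d\<in>fp_vars f. \<Sum>e\<in>B.
     fp_pderiv d f * fp_pderiv e g * fp_of_lie (lie_br (Rep_lie_basis d) (Rep_lie_basis e)))"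
    unfolding fp_br_def using assms
    by (intro sum.cong sum.mono_neutral_left) (auto simp: fp_pderiv_not_in_vars)
  also have "\<dots> = (\<Sum>d\<in>A. \<Sum>e\<in>B.
     fp_pderiv d f * fp_pderiv e g * fp_of_lie (lie_br (Rep_lie_basis d) (Rep_lie_basis e)))"
    using assms by (intro sum.mono_neutral_left) (auto simp: fp_pderiv_not_in_vars)
  finally show ?thesis .
qed

lemma fp_of_lie_superset:
  assumes "finite A" "{e. free_lie.representation lie_basis_set u (Rep_lie_basis e) \<noteq> 0} \<subseteq> A"
  shows "fp_of_lie u = (\<Sum>e\<in>A.
     fp_scale (free_lie.representation lie_basis_set u (Rep_lie_basis e)) (fp_basis_var e))"
  unfolding fp_of_lie_def using assms
  by (intro sum.mono_neutral_left) (auto simp: fp_scale_conv_mult)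

lemma finite_lie_representation:
  "finite {e. free_lie.representation lie_basis_set u (Rep_lie_basis e) \<noteq> 0}"
proof -
  have "inj Rep_lie_basis" by (auto intro: injI simp: Rep_lie_basis_inject)
  then have "finite (Rep_lie_basis -` {b. free_lie.representation lie_basis_set u b \<noteq> 0})"
    by (intro finite_vimageI free_lie.finite_representation)
  then show ?thesis by (simp add: vimage_def)
qed

lemma fp_of_lie_add: "fp_of_lie (u + v) = fp_of_lie u + fp_of_lie v"
proof -
  let ?S = "\<lambda>u. {e. free_lie.representation lie_basis_set u (Rep_lie_basis e) \<noteq> 0}"
  let ?A = "?S u \<union> ?S v \<union> ?S (u + v)"
  have fin: "finite ?A" by (simp add: finite_lie_representation)
  have rep: "free_lie.representation lie_basis_set (u + v) b =
      free_lie.representation lie_basis_set u b + free_lie.representation lie_basis_set v b" for b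
    by (simp add: free_lie.representation_add lie_basis_set)
  have "fp_of_lie (u + v) = (\<Sum>e\<in>?A.
     fp_scale (free_lie.representation lie_basis_set (u + v) (Rep_lie_basis e)) (fp_basis_var e))"
    by (rule fp_of_lie_superset[OF fin]) blast
  also have "\<dots> = (\<Sum>e\<in>?A.
      fp_scale (free_lie.representation lie_basis_set u (Rep_lie_basis e)) (fp_basis_var e)) +
    (\<Sum>e\<in>?A.
      fp_scale (free_lie.representation lie_basis_set v (Rep_lie_basis e)) (fp_basis_var e))"
    by (simp add: rep fp_scale_conv_mult single_add distrib_right sum.distrib)
  also have "(\<Sum>e\<in>?A.
      fp_scale (free_lie.representation lie_basis_set u (Rep_lie_basis e)) (fp_basis_var e)) = fp_of_lie u"
    by (rule fp_of_lie_superset[OF fin, symmetric]) blast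
  also have "(\<Sum>e\<in>?A.
      fp_scale (free_lie.representation lie_basis_set v (Rep_lie_basis e)) (fp_basis_var e)) = fp_of_lie v"
    by (rule fp_of_lie_superset[OF fin, symmetric]) blast
  finally show ?thesis .
qed

lemma fp_of_lie_zero [simp]: "fp_of_lie 0 = 0"
  using fp_of_lie_add[of 0 0] by simp

lemma fp_of_lie_scale: "fp_of_lie (lie_scale c u) = fp_scale c (fp_of_lie u)"
proof -
  let ?S = "\<lambda>u. {e. free_lie.representation lie_basis_set u (Rep_lie_basis e) \<noteq> 0}"
  have rep: "free_lie.representation lie_basis_set (lie_scale c u) b =
      c * free_lie.representation lie_basis_set u b" for b
    by (simp add: free_lie.representation_scale lie_basis_set)
  have "fp_of_lie (lie_scale c u) = (\<Sum>e\<in>?S u.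
     fp_scale (free_lie.representation lie_basis_set (lie_scale c u) (Rep_lie_basis e)) (fp_basis_var e))"
    by (rule fp_of_lie_superset[OF finite_lie_representation]) (auto simp: rep)
  also have "\<dots> = fp_scale c (fp_of_lie u)"
    unfolding fp_of_lie_def
    by (simp add: rep fp_scale_conv_mult sum_distrib_left mult.assoc[symmetric] mult_single)
  finally show ?thesis .
qed

lemma fp_of_lie_uminus: "fp_of_lie (- u) = - fp_of_lie u"
  using fp_of_lie_add[of u "- u"] by (simp add: add_eq_0_iff)

lemma fp_of_lie_basis: "fp_of_lie (Rep_lie_basis e) = fp_basis_var e"
proof -
  have "free_lie.representation lie_basis_set (Rep_lie_basis e) =
      (\<lambda>b. if b = Rep_lie_basis e then 1 else 0)"
    by (rule free_lie.representation_basis) (simp_all add: lie_basis_set Rep_lie_basis)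
  then show ?thesis
    by (subst fp_of_lie_superset[of "{e}"])
      (auto simp: Rep_lie_basis_inject fp_scale_conv_mult split: if_splits)
qed

lemma fp_br_add_left: "fp_br (f + g) h = fp_br f h + fp_br g h"
proof -
  let ?A = "fp_vars f \<union> fp_vars g \<union> fp_vars (f + g)"
  show ?thesis
    by (simp add: fp_br_superset[of ?A _ "fp_vars h"] fp_pderiv_add distrib_right sum.distrib le_supI1)
qed

lemma fp_br_skew: "fp_br g f = - fp_br f g"
proof -
  have skew: "fp_pderiv e g * fp_pderiv d f * fp_of_lie (lie_br (Rep_lie_basis e) (Rep_lie_basis d)) =
      - (fp_pderiv d f * fp_pderiv e g * fp_of_lie (lie_br (Rep_lie_basis d) (Rep_lie_basis e)))"
    for d e
    by (subst free_lie.br_skew) (simp add: fp_of_lie_uminus mult.commute)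
  have "fp_br g f = (\<Sum>e\<in>fp_vars g. \<Sum>d\<in>fp_vars f.
      - (fp_pderiv d f * fp_pderiv e g * fp_of_lie (lie_br (Rep_lie_basis d) (Rep_lie_basis e))))"
    unfolding fp_br_def[of g f] by (simp only: skew)
  also have "\<dots> = - fp_br f g"
    unfolding fp_br_def by (subst sum.swap) (simp add: sum_negf)
  finally show ?thesis .
qed

lemma fp_br_mult_left: "fp_br (f * g) h = fp_br f h * g + f * fp_br g h"
proof -
  let ?A = "fp_vars f \<union> fp_vars g \<union> fp_vars (f * g)"
  let ?L = "\<lambda>d e. fp_of_lie (lie_br (Rep_lie_basis d) (Rep_lie_basis e))"
  have "fp_br (f * g) h = (\<Sum>d\<in>?A. \<Sum>e\<in>fp_vars h.
      (fp_pderiv d f * fp_pderiv e h * ?L d e) * g + f * (fp_pderiv d g * fp_pderiv e h * ?L d e))"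
    by (simp add: fp_br_superset[of ?A _ "fp_vars h"] fp_pderiv_mult algebra_simps)
  also have "\<dots> = fp_br f h * g + f * fp_br g h"
    by (simp add: fp_br_superset[of ?A _ "fp_vars h"] le_supI1 sum.distrib
        sum_distrib_left sum_distrib_right)
  finally show ?thesis .
qed

lemma fp_br_const_left [simp]: "fp_br (Poly_Mapping.single 0 c) h = 0"
  by (simp add: fp_br_def)

lemma fp_br_scale_left: "fp_br (fp_scale c f) h = fp_scale c (fp_br f h)"
  by (simp add: fp_scale_conv_mult fp_br_mult_left)

lemma fp_br_add_right: "fp_br h (f + g) = fp_br h f + fp_br h g"
  using fp_br_add_left[of f g h] by (simp add: fp_br_skew[of h])

lemma fp_br_mult_right: "fp_br h (f * g) = fp_br h f * g + f * fp_br h g"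
  using fp_br_mult_left[of f g h] by (simp add: fp_br_skew[of h])

lemma fp_br_scale_right: "fp_br h (fp_scale c f) = fp_scale c (fp_br h f)"
  using fp_br_scale_left[of c f h] by (simp add: fp_br_skew[of h] fp_scale_conv_mult)

lemma fp_br_const_right [simp]: "fp_br h (Poly_Mapping.single 0 c) = 0"
  by (simp add: fp_br_def)

lemma fp_vars_basis_var: "fp_vars (fp_basis_var e) = {e}"
  by (simp add: fp_vars_def fp_basis_var_def)

lemma fp_br_basis_var:
  "fp_br (fp_basis_var d) (fp_basis_var e) = fp_of_lie (lie_br (Rep_lie_basis d) (Rep_lie_basis e))"
  by (simp add: fp_br_def fp_vars_basis_var fp_pderiv_var)

lemma fp_br_self: "fp_br f f = 0"
proof (induction f rule: fp_induct)
  case (const c)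
  show ?case by simp
next
  case (var e)
  show ?case by (simp add: fp_br_basis_var free_lie.br_self)
next
  case (add f g)
  then show ?case
    by (simp add: fp_br_add_left fp_br_add_right fp_br_skew[of g f])
next
  case (mult f g)
  then show ?case
    by (simp add: fp_br_mult_left fp_br_mult_right fp_br_skew[of g f])
qed

lemma lie_induct_basis [case_names zero step]:
  fixes u :: "('k::field, 'x) free_lie"
  assumes "P 0" "\<And>c e u. P u \<Longrightarrow> P (lie_scale c (Rep_lie_basis e) + u)"
  shows "P u"
proof -
  have "u \<in> free_lie.span lie_basis_set" by (simp add: lie_basis_set)
  then show ?thesis
  proof (induction rule: free_lie.span_induct_alt)
    case base
    show ?case by (rule assms(1))
  next
    case (step c x y)
    then show ?case using assms(2)[of y c "Abs_lie_basis x"] by (simp add: Abs_lie_basis_inverse)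
  qed
qed

lemma fp_br_of_lie: "fp_br (fp_of_lie u) (fp_of_lie v) = fp_of_lie (lie_br u v)"
proof -
  have zero: "fp_br 0 f = 0" "fp_br f 0 = 0" for f :: "('a, 'b) free_poisson"
    using fp_br_const_left[of 0 f] fp_br_const_right[of f 0] by simp_all
  have basis: "fp_br (fp_basis_var d) (fp_of_lie v) = fp_of_lie (lie_br (Rep_lie_basis d) v)" for d
    by (induction v rule: lie_induct_basis)
      (simp_all add: zero fp_of_lie_add fp_of_lie_scale fp_of_lie_basis fp_br_add_right
        fp_br_scale_right fp_br_basis_var free_lie.br_add_right free_lie.br_scale_right)
  show ?thesis
    by (induction u rule: lie_induct_basis)
      (simp_all add: zero fp_of_lie_add fp_of_lie_scale fp_of_lie_basis fp_br_add_left
        fp_br_scale_left basis free_lie.br_add_left free_lie.br_scale_left)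
qed

lemma fp_br_jacobi: "fp_br f (fp_br g h) + fp_br g (fp_br h f) + fp_br h (fp_br f g) = 0"
proof -
  define J where "J f g h = fp_br f (fp_br g h) + fp_br g (fp_br h f) + fp_br h (fp_br f g)"
    for f g h :: "('a, 'b) free_poisson"
  have zero: "fp_br 0 f = 0" "fp_br f 0 = 0" for f :: "('a, 'b) free_poisson"
    using fp_br_const_left[of 0 f] fp_br_const_right[of f 0] by simp_all
  have rot: "J f g h = J g h f" for f g h
    by (simp add: J_def ac_simps)
  have const: "J (Poly_Mapping.single 0 c) g h = 0" for c g h
    by (simp add: J_def zero)
  have add: "J (f + f') g h = J f g h + J f' g h" for f f' g h
    by (simp add: J_def fp_br_add_left fp_br_add_right)
  have minus: "fp_br g (- f) = - fp_br g f" for f g :: "('a, 'b) free_poisson"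
    using fp_br_add_right[of g f "- f"] by (simp add: zero add_eq_0_iff)
  have diff: "fp_br g (f - f') = fp_br g f - fp_br g f'" for f f' g :: "('a, 'b) free_poisson"
    using fp_br_add_right[of g f "- f'"] by (simp add: minus)
  have mult: "J (f * f') g h = J f g h * f' + f * J f' g h" for f f' g h
    unfolding J_def
    by (simp add: fp_br_mult_left fp_br_mult_right fp_br_add_left fp_br_add_right
        fp_br_skew[of h f] fp_br_skew[of h f'] fp_br_skew[of "fp_br g h"] fp_br_skew[of f g] fp_br_skew[of f' g] minus diff algebra_simps)
  have step: "J f g h = 0" if "\<And>e. J (fp_basis_var e) g h = 0" for f g h
    by (induction f rule: fp_induct) (simp_all add: const that add mult)
  have "J (fp_basis_var a) (fp_basis_var b) (fp_basis_var c) = 0" for a b c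
  proof -
    let ?u = "Rep_lie_basis a" and ?v = "Rep_lie_basis b" and ?w = "Rep_lie_basis c"
    have "J (fp_of_lie ?u) (fp_of_lie ?v) (fp_of_lie ?w) =
        fp_of_lie (lie_br ?u (lie_br ?v ?w) + lie_br ?v (lie_br ?w ?u) + lie_br ?w (lie_br ?u ?v))"
      by (simp add: J_def fp_br_of_lie fp_of_lie_add)
    then show ?thesis by (simp add: fp_of_lie_basis free_lie.br_jacobi)
  qed
  then have "J h (fp_basis_var a) (fp_basis_var b) = 0" for a b h by (rule step)
  then have "J g h (fp_basis_var a) = 0" for a g h using rot step by metis
  then have "J f g h = 0" using rot step by metis
  then show ?thesis by (simp add: J_def)
qed

global_interpretation free_poisson: poisson_algebra
  "fp_scale :: 'k::field \<Rightarrow> ('k, 'x) free_poisson \<Rightarrow> ('k, 'x) free_poisson"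
  "fp_br :: ('k, 'x) free_poisson \<Rightarrow> ('k, 'x) free_poisson \<Rightarrow> ('k, 'x) free_poisson"
  by (intro poisson_algebra.intro lie_algebra.intro lie_algebra_axioms.intro
      poisson_algebra_axioms.intro fp_vector_space)
    (simp_all add: fp_br_add_left fp_br_add_right fp_br_scale_left fp_br_scale_right
      fp_br_self fp_br_jacobi fp_scale_mult_left fp_br_mult_right)


section \<open>Tame automorphisms\<close>

text \<open>
  The free Poisson algebra on the generators other than \<open>i\<close> is taken inside the whole algebra,
  as the Poisson subalgebra that these generators generate. The identity is elementary, so it
  is tame without a separate rule for the empty composition.
\<close>

definition elementary ::
    "(('k::field, 'x) free_poisson \<Rightarrow> ('k, 'x) free_poisson) \<Rightarrow> bool" where
  "elementary \<phi> \<longleftrightarrow> free_poisson.automorphism \<phi> \<and>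
     (\<exists>i \<alpha> h. \<alpha> \<noteq> 0 \<and> h \<in> free_poisson.subalgebra_generated (fp_gen ` {j. j \<noteq> i}) \<and>
        \<phi> (fp_gen i) = fp_scale \<alpha> (fp_gen i) + h \<and>
        (\<forall>j. j \<noteq> i \<longrightarrow> \<phi> (fp_gen j) = fp_gen j))"

inductive tame ::
    "(('k::field, 'x) free_poisson \<Rightarrow> ('k, 'x) free_poisson) \<Rightarrow> bool" where
  elementary: "elementary \<phi> \<Longrightarrow> tame \<phi>"
| comp: "elementary \<phi> \<Longrightarrow> tame \<psi> \<Longrightarrow> tame (\<phi> \<circ> \<psi>)"

end

theory Submission
  imports Defs "HOL-Computational_Algebra.Polynomial" "HOL-Library.Multiset"
begin

text \<open>
  Let \<open>x\<close>, \<open>y\<close> be the generators and let \<open>\<pi>\<close> be the projection of the free Poisson algebra onto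
  \<open>k[x, y]\<close> that kills all brackets.

  The key fact is that a locally nilpotent Poisson derivation \<open>d\<close> maps \<open>x\<close> and \<open>y\<close> into \<open>k[x, y]\<close>.
  Otherwise the factors of largest weight of the iterates of \<open>d\<close> evolve, after specialising the
  coefficients to scalars, under a nonzero bihomogeneous derivation of the free associative algebra
  with values of degree at least two on the generators. Such a derivation is not locally nilpotent:
  the last nonzero divided powers of its iterates on \<open>x\<close> and \<open>y\<close> have bidegrees that are not
  proportional, so their leading words generate a free monoid.

  If \<open>\<phi>\<close> is an automorphism that is trivial modulo brackets, this applies to \<open>\<phi> d \<phi>\<inverse>\<close> for
  \<open>d = y\<^sup>n \<partial>/\<partial>x\<close> and shows \<open>\<phi> d \<phi>\<inverse> = d\<close>. Hence \<open>d (\<phi> x) = (\<phi> y)\<^sup>n\<close> for all \<open>n\<close>, and comparing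
  degrees in \<open>x\<close> forces \<open>\<phi> y = y\<close>; by symmetry \<open>\<phi>\<close> is the identity.

  An arbitrary automorphism is reduced to this case by elementary ones, as in Jung's theorem: with
  \<open>g = \<pi> (\<phi> y)\<close> the derivation \<open>{g, \<cdot>}\<close> of \<open>k[x, y]\<close> (for the bracket with \<open>{x, y} = 1\<close>) is locally
  nilpotent, and so are its leading forms. The leading form of \<open>g\<close> along the edge of its Newton
  polygon then has a polynomial integral curve, and comparing degrees on this curve shows that an
  elementary substitution lowers the degrees of \<open>g\<close>.
\<close>

text \<open>The obstacle is that the free Poisson algebra consists of polynomials in Lie elements,
  so that iterates of a derivation mix products with brackets. Weight is therefore assigned to
  single factors and never added up over a product. If a derivation raises weight by at most
  \<open>N > 0\<close>, the coefficients \<open>fp_pderiv e p\<close> of an element of weight at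
  most \<open>L\<close> have no factor of weight \<open>L + N\<close>; at that level they act as
  scalars and can be frozen at a point \<open>\<rho>\<close>, which leaves a linear problem in Lie
  elements. The irrational ratio of the two weights makes this remainder homogeneous in each letter,
  so that all words in the value of a generator reach their last nonzero divided power after the
  same number of steps and can be compared there. For an automorphism trivial modulo brackets, it is
  a degree bound common to all powers of \<open>\<phi> y\<close> that forces degree zero. In the
  reduction of an arbitrary automorphism only the degrees of \<open>g\<close> are followed; once
  \<open>g\<close> depends on one variable, the constant Jacobian settles the image of
  \<open>x\<close> too.\<close>

abbreviation "single \<equiv> Poly_Mapping.single"
abbreviation "lookup \<equiv> Poly_Mapping.lookup"
abbreviation "keys \<equiv> Poly_Mapping.keys"

section \<open>Substitution homomorphisms and partial derivatives\<close>

lemma fp_vars_add: "fp_vars (f + g) \<subseteq> fp_vars f \<union> fp_vars g"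
  unfolding fp_vars_def using keys_add[of f g] by blast

lemma fp_vars_mult: "fp_vars (f * g) \<subseteq> fp_vars f \<union> fp_vars g"
proof
  fix e assume "e \<in> fp_vars (f * g)"
  then obtain m where m: "m \<in> keys (f * g)" "e \<in> keys m"
    by (auto simp: fp_vars_def)
  then obtain a b where "m = a + b" "a \<in> keys f" "b \<in> keys g"
    using keys_mult[of f g] by blast
  with m show "e \<in> fp_vars f \<union> fp_vars g"
    using keys_add[of a b] by (auto simp: fp_vars_def)
qed

lemma fp_vars_single: "fp_vars (single m c) \<subseteq> keys m"
  by (auto simp: fp_vars_def split: if_splits)

lemma fp_vars_const [simp]: "fp_vars (single 0 c) = {}"
  using fp_vars_single[of 0 c] by simp

lemma fp_vars_zero [simp]: "fp_vars 0 = {}"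
  by (simp add: fp_vars_def)

lemma fp_vars_one [simp]: "fp_vars 1 = {}"
  by (simp add: fp_vars_def)

lemma fp_vars_uminus [simp]: "fp_vars (- f) = fp_vars f"
  by (simp add: fp_vars_def in_keys_iff)

lemma fp_vars_diff: "fp_vars (f - g) \<subseteq> fp_vars f \<union> fp_vars g"
  using fp_vars_add[of f "- g"] by simp

lemma fp_vars_scale: "fp_vars (fp_scale c f) \<subseteq> fp_vars f"
  using fp_vars_mult[of "single 0 c" f] by (simp add: fp_scale_conv_mult)

lemma fp_vars_power: "fp_vars (f ^ n) \<subseteq> fp_vars f"
  by (induction n) (use fp_vars_mult in fastforce)+

lemma fp_vars_sum: "fp_vars (sum f A) \<subseteq> (\<Union>i\<in>A. fp_vars (f i))"
  by (induction A rule: infinite_finite_induct) (use fp_vars_add in fastforce)+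

lemma lookup_fp_pderiv:
  "lookup (fp_pderiv e f) n =
    lookup f (n + single e 1) * of_nat (Suc (lookup n e))"
proof -
  let ?s = "single e (1::nat)"
  have *: "(c * of_nat (lookup m e) when m - ?s = n) =
      (if m = n + ?s then c * of_nat (Suc (lookup n e)) else 0)" for m and c :: 'a
  proof (cases "lookup m e = 0")
    case True
    then have "m \<noteq> n + ?s" by (auto simp: lookup_add)
    then show ?thesis using True by (simp add: when_def)
  next
    case False
    then have m: "m - ?s + ?s = m"
      by (intro poly_mapping_eqI) (auto simp: lookup_minus lookup_add lookup_single when_def)
    then have "m - ?s = n \<longleftrightarrow> m = n + ?s" by auto
    then show ?thesis by (auto simp: when_def lookup_add)
  qed
  have "lookup (fp_pderiv e f) n = (\<Sum>m\<in>keys f.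
      if m = n + ?s then lookup f m * of_nat (Suc (lookup n e)) else 0)"
    unfolding fp_pderiv_def lookup_sum lookup_single * by simp
  also have "\<dots> = lookup f (n + ?s) * of_nat (Suc (lookup n e))"
    by (simp add: sum.delta' in_keys_iff)
  finally show ?thesis .
qed

lemma keys_fp_pderiv:
  assumes "n \<in> keys (fp_pderiv e f)"
  shows "n + single e 1 \<in> keys f"
  using assms by (auto simp: in_keys_iff lookup_fp_pderiv)

lemma fp_vars_pderiv: "fp_vars (fp_pderiv e f) \<subseteq> fp_vars f"
proof
  fix d assume "d \<in> fp_vars (fp_pderiv e f)"
  then obtain n where n: "n \<in> keys (fp_pderiv e f)" "d \<in> keys n"
    by (auto simp: fp_vars_def)
  have "d \<in> keys (n + single e 1)"
    using n(2) by (auto simp: in_keys_iff lookup_add)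
  with keys_fp_pderiv[OF n(1)] show "d \<in> fp_vars f" by (auto simp: fp_vars_def)
qed

text \<open>Characteristic zero makes the exponent that differentiation brings down a nonzero
  scalar, and lowering that exponent by one is injective on the monomials containing
  \<open>e\<close>, so nothing cancels.\<close>

lemma fp_pderiv_nonzero:
  fixes f :: "('k::field_char_0, 'x) free_poisson"
  assumes "e \<in> fp_vars f"
  shows "fp_pderiv e f \<noteq> 0"
proof -
  obtain m where m: "m \<in> keys f" "e \<in> keys m"
    using assms by (auto simp: fp_vars_def)
  let ?n = "m - single e 1"
  have "?n + single e 1 = m"
    using m(2) by (intro poly_mapping_eqI)
      (auto simp: lookup_minus lookup_add lookup_single when_def in_keys_iff)
  then have "lookup (fp_pderiv e f) ?n =
      lookup f m * of_nat (Suc (lookup ?n e))"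
    by (simp only: lookup_fp_pderiv)
  then have "lookup (fp_pderiv e f) ?n \<noteq> 0"
    using m(1) by (simp add: in_keys_iff del: of_nat_Suc)
  then show ?thesis by auto
qed

lemma fp_vars_empty_iff: "fp_vars f = {} \<longleftrightarrow> (\<exists>c. f = single 0 c)"
proof
  assume "fp_vars f = {}"
  then have "m = 0" if "m \<in> keys f" for m
    using that by (auto simp: fp_vars_def)
  then have "f = single 0 (lookup f 0)"
    by (intro poly_mapping_eqI) (auto simp: lookup_single when_def in_keys_iff)
  then show "\<exists>c. f = single 0 c" by blast
qed auto

lemma fp_pderiv_uminus: "fp_pderiv e (- f) = - fp_pderiv e f"
  using fp_pderiv_add[of e f "- f"] by (simp add: add_eq_0_iff)

lemma fp_pderiv_diff: "fp_pderiv e (f - g) = fp_pderiv e f - fp_pderiv e g"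
  using fp_pderiv_add[of e f "- g"] by (simp add: fp_pderiv_uminus)

lemma fp_pderiv_scale: "fp_pderiv e (fp_scale c f) = fp_scale c (fp_pderiv e f)"
  by (simp add: fp_scale_conv_mult fp_pderiv_mult)

text \<open>The coefficient map \<open>\<kappa>\<close> is a parameter so that substitution into the
  algebra itself, evaluation at a point and restriction to a polynomial curve are instances of one
  notion.\<close>

locale fp_hom =
  fixes \<kappa> :: "'k::field \<Rightarrow> 'b::comm_ring_1" and h :: "('k, 'x) free_poisson \<Rightarrow> 'b"
  assumes add: "h (p + q) = h p + h q"
    and mult: "h (p * q) = h p * h q"
    and const: "h (single 0 c) = \<kappa> c"
    and coeff_one: "\<kappa> 1 = 1"
begin

lemma zero: "h 0 = 0"
  using add[of 0 0] by simp

lemma one: "h 1 = 1"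
  using const[of 1] by (simp add: coeff_one)

lemma uminus: "h (- p) = - h p"
  using add[of p "- p"] by (simp add: zero add_eq_0_iff)

lemma diff: "h (p - q) = h p - h q"
  using add[of p "- q"] by (simp add: uminus)

lemma scale: "h (fp_scale c p) = \<kappa> c * h p"
  by (simp add: fp_scale_conv_mult mult const)

lemma sum: "h (sum f A) = (\<Sum>i\<in>A. h (f i))"
  by (induction A rule: infinite_finite_induct) (simp_all add: zero add)

lemma power: "h (p ^ n) = h p ^ n"
  by (induction n) (simp_all add: one mult)

end

lemma single_mult_fp_basis_var:
  "single m c * fp_basis_var e ^ n = single (m + single e n) c"
proof (induction n)
  case (Suc n)
  have "single m c * fp_basis_var e ^ Suc n =
      single m c * fp_basis_var e ^ n * fp_basis_var e"
    by (simp add: ac_simps)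
  also have "\<dots> = single (m + single e n + single e 1) c"
    unfolding Suc.IH by (simp add: fp_basis_var_def mult_single)
  finally show ?case by (simp add: single_add[symmetric] add.assoc)
qed simp

lemma fp_monomial_prod:
  "single m c = single 0 c * (\<Prod>e\<in>keys m. fp_basis_var e ^ lookup m e)"
proof -
  have "single 0 c * (\<Prod>e\<in>A. fp_basis_var e ^ lookup m e) =
      single (\<Sum>e\<in>A. single e (lookup m e)) c" if "finite A" for A
    using that
  proof (induction A)
    case (insert e A)
    have "single 0 c * (\<Prod>e\<in>insert e A. fp_basis_var e ^ lookup m e) =
      (single 0 c * (\<Prod>e\<in>A. fp_basis_var e ^ lookup m e)) * fp_basis_var e ^ lookup m e"
      by (simp only: prod.insert[OF insert.hyps] ac_simps)
    also have "\<dots> = single ((\<Sum>e\<in>A. single e (lookup m e)) +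
        single e (lookup m e)) c"
      unfolding insert.IH by (rule single_mult_fp_basis_var)
    finally show ?case by (simp only: sum.insert[OF insert.hyps] add.commute)
  qed simp
  moreover have "(\<Sum>e\<in>keys m. single e (lookup m e)) = m"
    by (rule poly_mapping_eqI) (auto simp: lookup_sum lookup_single when_def in_keys_iff)
  ultimately show ?thesis by simp
qed

lemma (in fp_hom) expand:
  "h p = (\<Sum>m\<in>keys p. \<kappa> (lookup p m) *
     (\<Prod>e\<in>keys m. h (fp_basis_var e) ^ lookup m e))"
proof -
  have prod: "h (\<Prod>e\<in>A. f e) = (\<Prod>e\<in>A. h (f e))" for f and A :: "('k, 'x) lie_basis set"
    by (induction A rule: infinite_finite_induct) (simp_all add: one mult)
  have monomial: "h (single m c) = \<kappa> c *
     (\<Prod>e\<in>keys m. h (fp_basis_var e) ^ lookup m e)" for m c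
    by (subst fp_monomial_prod) (simp only: mult const prod power)
  have "h p = h (\<Sum>m\<in>keys p. single m (lookup p m))"
    by (simp add: fp_sum_monomials)
  then show ?thesis by (simp only: sum monomial)
qed

lemma fp_hom_eqI:
  assumes "fp_hom \<kappa> h" "fp_hom \<kappa> h'" "\<And>e. e \<in> fp_vars p \<Longrightarrow> h (fp_basis_var e) = h' (fp_basis_var e)"
  shows "h p = h' p"
  by (subst fp_hom.expand[OF assms(1)], subst fp_hom.expand[OF assms(2)])
    (use assms(3) in \<open>auto simp: fp_vars_def intro!: sum.cong prod.cong arg_cong2[where f = "(*)"]
      arg_cong[where f = "\<lambda>x. x ^ _"]\<close>)

definition psubst :: "('k::field \<Rightarrow> 'b::comm_ring_1) \<Rightarrow> (('k, 'x) lie_basis \<Rightarrow> 'b) \<Rightarrow> ('k, 'x) free_poisson \<Rightarrow> 'b" where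
  "psubst \<kappa> v p = (\<Sum>m\<in>keys p. \<kappa> (lookup p m) *
     (\<Prod>e\<in>keys m. v e ^ lookup m e))"

locale coeff_hom =
  fixes \<kappa> :: "'k::field \<Rightarrow> 'b::comm_ring_1"
  assumes add: "\<kappa> (a + b) = \<kappa> a + \<kappa> b" and mult: "\<kappa> (a * b) = \<kappa> a * \<kappa> b" and one: "\<kappa> 1 = 1"
begin

lemma zero: "\<kappa> 0 = 0"
  using add[of 0 0] by simp

lemma psubst_superset:
  assumes "finite A" "keys p \<subseteq> A"
  shows "psubst \<kappa> v p = (\<Sum>m\<in>A. \<kappa> (lookup p m) *
     (\<Prod>e\<in>keys m. v e ^ lookup m e))"
  unfolding psubst_def using assms
  by (intro sum.mono_neutral_left) (auto simp: in_keys_iff zero)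

lemma psubst_add: "psubst \<kappa> v (p + q) = psubst \<kappa> v p + psubst \<kappa> v q"
proof -
  let ?A = "keys p \<union> keys q"
  have "keys (p + q) \<subseteq> ?A" by (rule keys_add)
  then show ?thesis
    by (simp add: psubst_superset[of ?A] lookup_add add distrib_right sum.distrib)
qed

lemma psubst_single: "psubst \<kappa> v (single m c) =
    \<kappa> c * (\<Prod>e\<in>keys m. v e ^ lookup m e)"
  by (subst psubst_superset[of "{m}"]) auto

lemma psubst_sum: "psubst \<kappa> v (sum f A) = (\<Sum>i\<in>A. psubst \<kappa> v (f i))"
  by (induction A rule: infinite_finite_induct) (simp_all add: psubst_add psubst_def[of _ _ 0])

lemma psubst_mult: "psubst \<kappa> v (p * q) = psubst \<kappa> v p * psubst \<kappa> v q"
proof -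
  have prod: "(\<Prod>e\<in>keys (m + n). v e ^ lookup (m + n) e) =
      (\<Prod>e\<in>keys m. v e ^ lookup m e) *
      (\<Prod>e\<in>keys n. v e ^ lookup n e)" for m n :: "_ \<Rightarrow>\<^sub>0 nat"
  proof -
    let ?A = "keys m \<union> keys n"
    have sup: "(\<Prod>e\<in>keys k. v e ^ lookup k e) = (\<Prod>e\<in>?A. v e ^ lookup k e)"
      if "keys k \<subseteq> ?A" for k
      using that by (intro prod.mono_neutral_left) (auto simp: in_keys_iff)
    show ?thesis
      using sup[of "m + n"] sup[of m] sup[of n] keys_add[of m n]
      by (simp add: lookup_add power_add prod.distrib)
  qed
  let ?f = "\<lambda>m. single m (lookup p m)"
  let ?g = "\<lambda>m. single m (lookup q m)"
  have "psubst \<kappa> v (sum ?f (keys p) * sum ?g (keys q)) =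
      psubst \<kappa> v (sum ?f (keys p)) * psubst \<kappa> v (sum ?g (keys q))"
    by (simp add: sum_product psubst_sum mult_single psubst_single mult prod ac_simps)
  then show ?thesis by (simp only: fp_sum_monomials)
qed

lemma psubst_var [simp]: "psubst \<kappa> v (fp_basis_var e) = v e"
  by (simp add: fp_basis_var_def psubst_single one)

lemma fp_hom_psubst: "fp_hom \<kappa> (psubst \<kappa> v)"
  by unfold_locales (simp_all add: psubst_add psubst_mult psubst_single one)

end

text \<open>A derivation along a homomorphism \<open>h\<close>, so that one formula covers
  \<open>pderiv\<close> on a curve, Poisson derivations (with \<open>h\<close> the identity) and the
  Jacobian of an endomorphism induced on \<open>k[x, y]\<close>.\<close>

lemma fp_hom_chain_rule:
  assumes h: "fp_hom \<kappa> h"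
    and add: "\<And>p q. d (p + q) = d p + d q"
    and mult: "\<And>p q. d (p * q) = d p * h q + h p * d q"
    and const: "\<And>c. d (single 0 c) = 0"
    and A: "finite A" "fp_vars p \<subseteq> A"
  shows "d p = (\<Sum>e\<in>A. h (fp_pderiv e p) * d (fp_basis_var e))"
proof -
  interpret h: fp_hom \<kappa> h by (rule h)
  have sup: "(\<Sum>e\<in>fp_vars p. h (fp_pderiv e p) * d (fp_basis_var e)) =
      (\<Sum>e\<in>A. h (fp_pderiv e p) * d (fp_basis_var e))" if "finite A" "fp_vars p \<subseteq> A" for A p
    using that by (intro sum.mono_neutral_left) (auto simp: fp_pderiv_not_in_vars h.zero)
  have "d p = (\<Sum>e\<in>fp_vars p. h (fp_pderiv e p) * d (fp_basis_var e))"
  proof (induction p rule: fp_induct)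
    case (const c)
    show ?case by (simp add: assms(4))
  next
    case (var e)
    show ?case by (simp add: fp_vars_basis_var fp_pderiv_var h.one)
  next
    case (add f g)
    let ?A = "fp_vars f \<union> fp_vars g"
    have "d (f + g) = (\<Sum>e\<in>?A. h (fp_pderiv e (f + g)) * d (fp_basis_var e))"
      using add by (simp add: assms(2) sup[of ?A f] sup[of ?A g] fp_pderiv_add h.add
          distrib_right sum.distrib)
    also have "\<dots> = (\<Sum>e\<in>fp_vars (f + g). h (fp_pderiv e (f + g)) * d (fp_basis_var e))"
      by (rule sup[symmetric]) (simp_all add: fp_vars_add)
    finally show ?case .
  next
    case (mult f g)
    let ?A = "fp_vars f \<union> fp_vars g"
    have "d (f * g) = (\<Sum>e\<in>?A. h (fp_pderiv e f) * d (fp_basis_var e)) * h g +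
        h f * (\<Sum>e\<in>?A. h (fp_pderiv e g) * d (fp_basis_var e))"
      using mult by (simp add: assms(3) sup[of ?A f] sup[of ?A g])
    also have "\<dots> = (\<Sum>e\<in>?A. h (fp_pderiv e (f * g)) * d (fp_basis_var e))"
      by (simp add: fp_pderiv_mult h.add h.mult sum.distrib[symmetric]
          sum_distrib_left sum_distrib_right algebra_simps)
    also have "\<dots> = (\<Sum>e\<in>fp_vars (f * g). h (fp_pderiv e (f * g)) * d (fp_basis_var e))"
      by (rule sup[symmetric]) (simp_all add: fp_vars_mult)
    finally show ?case .
  qed
  then show ?thesis using sup[OF A] by simp
qed

lemma fp_hom_id: "fp_hom (single 0) (\<lambda>p :: ('k::field, 'x) free_poisson. p)"
  by unfold_locales simp_all

global_interpretation fp_single: coeff_hom "single 0 :: 'k::field \<Rightarrow> ('k, 'x) free_poisson"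
  by unfold_locales (simp_all add: single_add mult_single)

abbreviation fp_subst :: "(('k::field, 'x) lie_basis \<Rightarrow> ('k, 'x) free_poisson) \<Rightarrow> ('k, 'x) free_poisson \<Rightarrow> ('k, 'x) free_poisson"
  where "fp_subst \<equiv> psubst (single 0)"

global_interpretation fp_subst: fp_hom "single 0" "fp_subst v" for v :: "('k::field, 'x) lie_basis \<Rightarrow> ('k, 'x) free_poisson"
  by (rule fp_single.fp_hom_psubst)

global_interpretation fp_scalar: coeff_hom "\<lambda>c :: 'k::field. c"
  by unfold_locales simp_all

abbreviation fp_eval :: "(('k::field, 'x) lie_basis \<Rightarrow> 'k) \<Rightarrow> ('k, 'x) free_poisson \<Rightarrow> 'k"
  where "fp_eval \<equiv> psubst (\<lambda>c. c)"

global_interpretation fp_eval: fp_hom "\<lambda>c. c" "fp_eval \<rho>" for \<rho> :: "('k::field, 'x) lie_basis \<Rightarrow> 'k"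
  by (rule fp_scalar.fp_hom_psubst)

section \<open>Testing polynomials at points and along curves\<close>

global_interpretation fp_pconst: coeff_hom "\<lambda>c :: 'k::field. [:c:]"
  by unfold_locales (simp_all add: one_pCons)

abbreviation fp_curve :: "(('k::field, 'x) lie_basis \<Rightarrow> 'k poly) \<Rightarrow> ('k, 'x) free_poisson \<Rightarrow> 'k poly"
  where "fp_curve \<equiv> psubst (\<lambda>c. [:c:])"

global_interpretation fp_curve: fp_hom "\<lambda>c. [:c:]" "fp_curve v" for v :: "('k::field, 'x) lie_basis \<Rightarrow> 'k poly"
  by (rule fp_pconst.fp_hom_psubst)

lemma poly_fp_curve: "poly (fp_curve v p) t = fp_eval (\<lambda>e. poly (v e) t) p"
proof -
  have "fp_hom (\<lambda>c. c) (\<lambda>p. poly (fp_curve v p) t)"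
    by unfold_locales (simp_all add: fp_curve.add fp_curve.mult fp_curve.const)
  from fp_hom_eqI[OF this fp_eval.fp_hom_axioms] show ?thesis by simp
qed

lemma pderiv_fp_curve:
  assumes "finite A" "fp_vars p \<subseteq> A"
  shows "pderiv (fp_curve v p) = (\<Sum>e\<in>A. fp_curve v (fp_pderiv e p) * pderiv (v e))"
  using fp_hom_chain_rule[OF fp_curve.fp_hom_axioms[of v], of "\<lambda>p. pderiv (fp_curve v p)", OF _ _ _ assms]
  by (simp add: fp_curve.add fp_curve.mult fp_curve.const pderiv_add pderiv_mult pderiv_pCons algebra_simps)

text \<open>Induction on the total degree: a polynomial that vanishes everywhere vanishes on every
  line parallel to a coordinate axis, so its partial derivatives vanish everywhere too. By induction
  they are zero and \<open>p\<close> is constant.\<close>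

lemma fp_eval_all_zero:
  fixes p :: "('k::field_char_0, 'x) free_poisson"
  assumes "\<And>\<rho>. fp_eval \<rho> p = 0"
  shows "p = 0"
proof -
  define deg where "deg m = (\<Sum>e\<in>keys m. lookup m e)" for m :: "('k, 'x) lie_basis \<Rightarrow>\<^sub>0 nat"
  have deg_Suc: "deg (m + single e 1) = Suc (deg m)" for m e
  proof -
    have sup: "deg k = (\<Sum>d\<in>insert e (keys m). lookup k d)"
      if "keys k \<subseteq> insert e (keys m)" for k
      unfolding deg_def using that by (intro sum.mono_neutral_left) (auto simp: in_keys_iff)
    have "keys (m + single e 1) \<subseteq> insert e (keys m)"
      using keys_add[of m "single e 1"] by auto
    then have "deg (m + single e 1) =
        (\<Sum>d\<in>insert e (keys m). lookup m d + (if e = d then Suc 0 else 0))"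
      by (subst sup) (simp_all add: lookup_add lookup_single when_def)
    also have "\<dots> = Suc (deg m)"
      by (simp only: sum.distrib sup[of m, OF subset_insertI]) simp
    finally show ?thesis .
  qed
  have "p = 0" if "\<And>m. m \<in> keys p \<Longrightarrow> deg m < n" "\<And>\<rho>. fp_eval \<rho> p = 0" for n p
    using that
  proof (induction n arbitrary: p)
    case 0
    then show ?case by (metis keys_eq_empty ex_in_conv less_nat_zero_code)
  next
    case (Suc n)
    have "fp_pderiv e p = 0" for e
    proof (rule Suc.IH)
      fix m assume "m \<in> keys (fp_pderiv e p)"
      from Suc.prems(1)[OF keys_fp_pderiv[OF this]] show "deg m < n" by (simp add: deg_Suc[unfolded One_nat_def])
    next
      fix \<rho> :: "('k, 'x) lie_basis \<Rightarrow> 'k"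
      \<comment> \<open>The line through \<open>\<rho>\<close> in direction \<open>e\<close>; the
        parameter value \<open>0\<close> gives back \<open>\<rho>\<close>.\<close>
      let ?v = "\<lambda>d. if d = e then [:\<rho> e, 1:] else [:\<rho> d:]"
      have "poly (fp_curve ?v p) t = 0" for t
        using Suc.prems(2) by (simp add: poly_fp_curve)
      then have "fp_curve ?v p = 0" using poly_all_0_iff_0 by blast
      then have "0 = (\<Sum>d\<in>insert e (fp_vars p). fp_curve ?v (fp_pderiv d p) * pderiv (?v d))"
        using pderiv_fp_curve[of "insert e (fp_vars p)" p ?v] by auto
      also have "\<dots> = (\<Sum>d\<in>insert e (fp_vars p). if d = e then fp_curve ?v (fp_pderiv e p) else 0)"
        by (rule sum.cong) (auto simp: pderiv_pCons)
      finally have "fp_curve ?v (fp_pderiv e p) = 0" by simp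
      then have "poly (fp_curve ?v (fp_pderiv e p)) 0 = 0" by simp
      moreover have "(\<lambda>d. poly (?v d) 0) = \<rho>" by auto
      ultimately show "fp_eval \<rho> (fp_pderiv e p) = 0" by (simp add: poly_fp_curve)
    qed
    then have "fp_vars p = {}" using fp_pderiv_nonzero by blast
    then obtain c where "p = single 0 c" by (auto simp: fp_vars_empty_iff)
    then show ?case using Suc.prems(2)[of "\<lambda>_. 0"] by (simp add: fp_eval.const)
  qed
  from this[of p "Suc (\<Sum>m\<in>keys p. deg m)"] show ?thesis
    using assms member_le_sum[of _ "keys p" deg] by (force simp: less_Suc_eq_le)
qed

text \<open>The line joining a point where \<open>p\<close> is nonzero to one where \<open>q\<close>
  is nonzero carries two nonzero univariate polynomials, and their product has a nonzero
  value.\<close>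

lemma fp_eval_nonzero2:
  fixes p q :: "('k::field_char_0, 'x) free_poisson"
  assumes "p \<noteq> 0" "q \<noteq> 0"
  obtains \<rho> where "fp_eval \<rho> p \<noteq> 0" "fp_eval \<rho> q \<noteq> 0"
proof -
  obtain \<rho> \<sigma> where *: "fp_eval \<rho> p \<noteq> 0" "fp_eval \<sigma> q \<noteq> 0"
    using assms fp_eval_all_zero by metis
  define v where "v e = [:\<rho> e, \<sigma> e - \<rho> e:]" for e
  have 0: "poly (fp_curve v r) 0 = fp_eval \<rho> r" for r by (simp add: poly_fp_curve v_def)
  have 1: "poly (fp_curve v r) 1 = fp_eval \<sigma> r" for r by (simp add: poly_fp_curve v_def)
  have "fp_curve v p * fp_curve v q \<noteq> 0" using * 0[of p] 1[of q] by auto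
  then obtain t where "poly (fp_curve v p * fp_curve v q) t \<noteq> 0"
    using poly_all_0_iff_0 by blast
  then show thesis by (intro that[of "\<lambda>e. poly (v e) t"]) (auto simp: poly_fp_curve)
qed

text \<open>Restricted to a line, a unit becomes a unit of \<open>k[t]\<close>, hence constant; so
  \<open>p\<close> takes equal values at any two points.\<close>

lemma fp_unit_const:
  fixes p q :: "('k::field_char_0, 'x) free_poisson"
  assumes "p * q = 1"
  obtains c where "p = single 0 c" "c \<noteq> 0"
proof -
  have const: "fp_eval \<rho> p = fp_eval \<sigma> p" for \<rho> \<sigma>
  proof -
    define v where "v e = [:\<rho> e, \<sigma> e - \<rho> e:]" for e
    have "fp_curve v p * fp_curve v q = 1" by (simp add: fp_curve.mult[symmetric] assms fp_curve.one)
    then have "fp_curve v p dvd 1" by (metis dvd_triv_left)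
    then obtain c where "fp_curve v p = [:c:]" using is_unit_polyE by blast
    then have "poly (fp_curve v p) 0 = poly (fp_curve v p) 1" by simp
    then show ?thesis by (simp add: poly_fp_curve v_def)
  qed
  define c where "c = fp_eval (\<lambda>_. 0) p"
  have "p - single 0 c = 0"
    by (rule fp_eval_all_zero) (use const in \<open>auto simp: fp_eval.diff fp_eval.const c_def\<close>)
  then have "p = single 0 c" by simp
  moreover have "c \<noteq> 0" using assms calculation by auto
  ultimately show thesis using that by blast
qed

section \<open>Divided powers of derivations\<close>

text \<open>Dividing by the factorial removes the binomial coefficients from the Leibniz rule. The
  exponents form an arbitrary monoid, so that commutative polynomials and noncommutative ones (with
  words as exponents) are both covered.\<close>

definition divided_power ::
    "(('w::monoid_add \<Rightarrow>\<^sub>0 'k::field_char_0) \<Rightarrow> ('w \<Rightarrow>\<^sub>0 'k)) \<Rightarrow> nat \<Rightarrow> ('w \<Rightarrow>\<^sub>0 'k) \<Rightarrow> ('w \<Rightarrow>\<^sub>0 'k)"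
  where "divided_power d n a = single 0 (inverse (fact n)) * (d ^^ n) a"

locale algebra_der =
  fixes d :: "('w::monoid_add \<Rightarrow>\<^sub>0 'k::field_char_0) \<Rightarrow> ('w \<Rightarrow>\<^sub>0 'k)"
  assumes add: "d (a + b) = d a + d b"
    and mult: "d (a * b) = d a * b + a * d b"
    and const: "d (single 0 c) = 0"
begin

lemma zero: "d 0 = 0"
  using add[of 0 0] by simp

lemma sum: "d (sum f A) = (\<Sum>i\<in>A. d (f i))"
  by (induction A rule: infinite_finite_induct) (simp_all add: zero add)

lemma scalar_mult: "d (single 0 c * a) = single 0 c * d a"
  by (simp add: mult const)

lemma iter_zero: "(d ^^ n) 0 = 0"
  by (induction n) (simp_all add: zero)

lemma iter_add: "(d ^^ n) (a + b) = (d ^^ n) a + (d ^^ n) b"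
  by (induction n) (simp_all add: add)

lemma iter_scalar_mult: "(d ^^ n) (single 0 c * a) = single 0 c * (d ^^ n) a"
  by (induction n) (simp_all add: scalar_mult)

lemma iter_eq_zero_mono: "(d ^^ n) a = 0 \<Longrightarrow> n \<le> m \<Longrightarrow> (d ^^ m) a = 0"
  by (metis funpow_add iter_zero le_add_diff_inverse2 o_apply)

lemma divided_power_0 [simp]: "divided_power d 0 a = a"
  by (simp add: divided_power_def)

lemma divided_power_add: "divided_power d n (a + b) = divided_power d n a + divided_power d n b"
  by (simp add: divided_power_def iter_add distrib_left)

lemma divided_power_scalar_mult:
  "divided_power d n (single 0 c * a) = single 0 c * divided_power d n a"
  by (simp add: divided_power_def iter_scalar_mult mult.assoc[symmetric] mult_single mult.commute)

lemma divided_power_zero: "divided_power d n 0 = 0"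
  by (simp add: divided_power_def iter_zero)

lemma divided_power_eq_zero_iff: "divided_power d n a = 0 \<longleftrightarrow> (d ^^ n) a = 0"
proof
  assume "divided_power d n a = 0"
  then have "single 0 (fact n) * divided_power d n a = 0" by simp
  then show "(d ^^ n) a = 0"
    by (simp add: divided_power_def mult.assoc[symmetric] mult_single)
qed (simp add: divided_power_def)

lemma der_divided_power: "d (divided_power d n a) = of_nat (Suc n) * divided_power d (Suc n) a"
proof -
  have "of_nat (Suc n) * inverse (fact (Suc n)) = (inverse (fact n) :: 'k)"
    by (simp add: mult.assoc[symmetric] del: of_nat_Suc)
  then show ?thesis
    by (simp add: divided_power_def scalar_mult single_of_nat[symmetric] mult.assoc[symmetric] mult_single
        del: of_nat_Suc single_of_nat)
qed

lemma divided_power_der: "divided_power d n (d a) = of_nat (Suc n) * divided_power d (Suc n) a"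
proof -
  have "divided_power d n (d a) = d (divided_power d n a)"
    by (simp add: divided_power_def scalar_mult funpow_swap1)
  then show ?thesis by (simp only: der_divided_power)
qed

lemma divided_power_mult:
  "divided_power d n (a * b) = (\<Sum>i\<le>n. divided_power d i a * divided_power d (n - i) b)"
proof (induction n)
  case (Suc n)
  let ?e = "divided_power d"
  have central: "x * (of_nat k * y) = of_nat k * (x * y)" for k and x y :: "'w \<Rightarrow>\<^sub>0 'k"
    by (metis mult.assoc mult_of_nat_commute)
  \<comment> \<open>Applying \<open>d\<close> to the formula for \<open>n\<close> yields the
    products for \<open>Suc n\<close> twice, with factors \<open>i\<close> and
    \<open>Suc n - i\<close>; these add up to \<open>Suc n\<close>, which is then divided
    out.\<close>
  have "of_nat (Suc n) * ?e (Suc n) (a * b) = d (?e n (a * b))"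
    by (simp only: der_divided_power)
  also have "\<dots> = (\<Sum>i\<le>n. of_nat (Suc i) * (?e (Suc i) a * ?e (n - i) b)) +
      (\<Sum>i\<le>n. of_nat (Suc (n - i)) * (?e i a * ?e (Suc (n - i)) b))"
    unfolding Suc.IH sum mult der_divided_power sum.distrib central by (simp only: mult.assoc)
  also have "(\<Sum>i\<le>n. of_nat (Suc i) * (?e (Suc i) a * ?e (n - i) b)) =
      (\<Sum>i\<le>Suc n. of_nat i * (?e i a * ?e (Suc n - i) b))"
    by (subst sum.atMost_Suc_shift) simp
  also have "(\<Sum>i\<le>n. of_nat (Suc (n - i)) * (?e i a * ?e (Suc (n - i)) b)) =
      (\<Sum>i\<le>Suc n. of_nat (Suc n - i) * (?e i a * ?e (Suc n - i) b))"
    by (simp add: Suc_diff_le del: of_nat_Suc of_nat_diff)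
  also have "(\<Sum>i\<le>Suc n. of_nat i * (?e i a * ?e (Suc n - i) b)) + \<dots> =
      (\<Sum>i\<le>Suc n. of_nat (Suc n) * (?e i a * ?e (Suc n - i) b))"
    unfolding sum.distrib[symmetric] distrib_right[symmetric] of_nat_add[symmetric]
    by (intro sum.cong) auto
  also have "\<dots> = of_nat (Suc n) * (\<Sum>i\<le>Suc n. ?e i a * ?e (Suc n - i) b)"
    by (simp only: sum_distrib_left)
  finally have "of_nat (Suc n) * ?e (Suc n) (a * b) = of_nat (Suc n) * (\<Sum>i\<le>Suc n. ?e i a * ?e (Suc n - i) b)" .
  then have "single 0 (inverse (of_nat (Suc n))) * (of_nat (Suc n) * ?e (Suc n) (a * b)) =
      single 0 (inverse (of_nat (Suc n))) * (of_nat (Suc n) * (\<Sum>i\<le>Suc n. ?e i a * ?e (Suc n - i) b))"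
    by simp
  then show ?case
    by (simp add: single_of_nat[symmetric] mult.assoc[symmetric] mult_single del: of_nat_Suc single_of_nat)
qed simp

definition nilp :: "('w \<Rightarrow>\<^sub>0 'k) \<Rightarrow> bool" where
  "nilp a \<longleftrightarrow> (\<exists>n. (d ^^ n) a = 0)"

lemma nilp_add:
  assumes "nilp a" "nilp b"
  shows "nilp (a + b)"
proof -
  obtain m n where "(d ^^ m) a = 0" "(d ^^ n) b = 0" using assms by (auto simp: nilp_def)
  then have "(d ^^ (m + n)) (a + b) = 0"
    using iter_eq_zero_mono[of m a "m + n"] iter_eq_zero_mono[of n b "m + n"] by (simp add: iter_add)
  then show ?thesis by (auto simp: nilp_def)
qed

text \<open>Each application of \<open>d\<close> to \<open>b p q\<close> uses up one of the
  \<open>m\<close> steps left for \<open>p\<close> or one of the \<open>n\<close> left for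
  \<open>q\<close>. The product \<open>b\<close> is arbitrary because the statement serves
  multiplication and the Poisson bracket alike.\<close>

lemma iter_bilinear:
  assumes zero: "\<And>q. b 0 q = 0" "\<And>p. b p 0 = 0" and leib: "\<And>p q. d (b p q) = b (d p) q + b p (d q)"
  shows "(d ^^ m) p = 0 \<Longrightarrow> (d ^^ n) q = 0 \<Longrightarrow> (d ^^ (m + n)) (b p q) = 0"
proof (induction "m + n" arbitrary: m n p q)
  case 0
  then show ?case by (simp add: zero)
next
  case (Suc k)
  show ?case
  proof (cases "m = 0 \<or> n = 0")
    case True
    then have "b p q = 0" using Suc.prems zero by auto
    then show ?thesis by (simp add: iter_zero)
  next
    case False
    then obtain m' n' where m: "m = Suc m'" and n: "n = Suc n'" by (metis not0_implies_Suc)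
    have "(d ^^ k) (b (d p) q) = 0"
      using Suc.hyps(1)[of m' n "d p" q] Suc.hyps(2) Suc.prems m by (simp add: funpow_Suc_right del: funpow.simps)
    moreover have "(d ^^ k) (b p (d q)) = 0"
      using Suc.hyps(1)[of m n' p "d q"] Suc.hyps(2) Suc.prems n by (simp add: funpow_Suc_right del: funpow.simps)
    ultimately show ?thesis
      by (simp add: Suc.hyps(2)[symmetric] funpow_Suc_right leib iter_add del: funpow.simps)
  qed
qed

lemma nilp_mult:
  assumes "nilp a" "nilp b"
  shows "nilp (a * b)"
  using assms iter_bilinear[of "(*)", OF mult_zero_left mult_zero_right mult] unfolding nilp_def by blast

lemma nilp_const: "nilp (single 0 c)"
  unfolding nilp_def by (rule exI[of _ 1]) (simp add: const)

lemma nilp_zero: "nilp 0"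
  using nilp_const[of 0] by simp

end

section \<open>Poisson endomorphisms and derivations\<close>

lemma fp_br_zero_left [simp]: "fp_br 0 f = 0"
  by (rule free_poisson.br_zero_left)

lemma fp_br_zero_right [simp]: "fp_br f 0 = 0"
  by (rule free_poisson.br_zero_right)

lemma fp_br_one_right [simp]: "fp_br f 1 = 0"
  using fp_br_const_right[of f 1] by simp

lemma free_lie_induct [case_names gen zero add scale br]:
  fixes u :: "('k::field, 'x) free_lie"
  assumes gen: "\<And>x. P (lie_gen x)" and zero: "P 0"
    and add: "\<And>u v. P u \<Longrightarrow> P v \<Longrightarrow> P (u + v)"
    and scale: "\<And>c u. P u \<Longrightarrow> P (lie_scale c u)"
    and br: "\<And>u v. P u \<Longrightarrow> P v \<Longrightarrow> P (lie_br u v)"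
  shows "P u"
proof -
  have "P (abs_free_lie t)" for t :: "('k, 'x) lie_term"
  proof (induction t)
    case (TGen x)
    show ?case using gen by (metis lie_gen.abs_eq)
  next
    case TZero
    show ?case using zero by (metis zero_free_lie_def)
  next
    case (TAdd s t)
    then show ?case using add by (simp add: abs_free_lie_add)
  next
    case (TScale c s)
    then show ?case using scale by (metis lie_scale.abs_eq)
  next
    case (TBr s t)
    then show ?case using br by (metis lie_br.abs_eq)
  qed
  then show ?thesis by (metis Quotient_abs_rep[OF Quotient_free_lie])
qed

locale poisson_endo = fp_hom "single 0" h
  for h :: "('k::field, 'x) free_poisson \<Rightarrow> ('k, 'x) free_poisson" +
  assumes br: "h (fp_br p q) = fp_br (h p) (h q)"
begin

lemma scale': "h (fp_scale c p) = fp_scale c (h p)"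
  by (simp add: fp_scale_conv_mult mult const)

end

lemma poisson_endo_eqI:
  assumes "poisson_endo h" "poisson_endo h'" "\<And>x. h (fp_gen x) = h' (fp_gen x)"
  shows "h p = h' p"
proof -
  interpret h: poisson_endo h by fact
  interpret h': poisson_endo h' by fact
  have "h (fp_of_lie u) = h' (fp_of_lie u)" for u
    by (induction u rule: free_lie_induct)
      (simp_all add: assms(3)[unfolded fp_gen_def] h.zero h'.zero fp_of_lie_add h.add h'.add
        fp_of_lie_scale h.scale' h'.scale' fp_br_of_lie[symmetric] h.br h'.br)
  then show ?thesis
    using fp_hom_eqI[OF h.fp_hom_axioms h'.fp_hom_axioms] by (metis fp_of_lie_basis)
qed

section \<open>Poisson endomorphisms with prescribed values on the generators\<close>

primrec term_hom :: "('x \<Rightarrow> ('k::field, 'x) free_poisson) \<Rightarrow> ('k, 'x) lie_term \<Rightarrow> ('k, 'x) free_poisson" where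
  "term_hom a (TGen x) = a x"
| "term_hom a TZero = 0"
| "term_hom a (TAdd s t) = term_hom a s + term_hom a t"
| "term_hom a (TScale c s) = fp_scale c (term_hom a s)"
| "term_hom a (TBr s t) = fp_br (term_hom a s) (term_hom a t)"

lemma term_hom_cong: "lie_eq s t \<Longrightarrow> term_hom a s = term_hom a t"
  by (induction rule: lie_eq.induct)
    (simp_all add: free_poisson.scale_right_distrib free_poisson.scale_left_distrib
      fp_br_add_left fp_br_add_right fp_br_scale_left fp_br_scale_right fp_br_self fp_br_jacobi)

lift_definition lie_hom :: "('x \<Rightarrow> ('k::field, 'x) free_poisson) \<Rightarrow> ('k, 'x) free_lie \<Rightarrow> ('k, 'x) free_poisson"
  is term_hom by (rule term_hom_cong)

lemma lie_hom_simps [simp]: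
  "lie_hom a (lie_gen x) = a x"
  "lie_hom a 0 = 0"
  "lie_hom a (u + v) = lie_hom a u + lie_hom a v"
  "lie_hom a (lie_scale c u) = fp_scale c (lie_hom a u)"
  "lie_hom a (lie_br u v) = fp_br (lie_hom a u) (lie_hom a v)"
proof -
  show "lie_hom a (lie_gen x) = a x" by transfer simp
  show "lie_hom a 0 = 0" by transfer simp
  show "lie_hom a (u + v) = lie_hom a u + lie_hom a v" by transfer simp
  show "lie_hom a (lie_scale c u) = fp_scale c (lie_hom a u)" by transfer simp
  show "lie_hom a (lie_br u v) = fp_br (lie_hom a u) (lie_hom a v)" by transfer simp
qed

definition poisson_hom :: "('x \<Rightarrow> ('k::field, 'x) free_poisson) \<Rightarrow> ('k, 'x) free_poisson \<Rightarrow> ('k, 'x) free_poisson" where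
  "poisson_hom a = fp_subst (\<lambda>e. lie_hom a (Rep_lie_basis e))"

lemma poisson_hom_of_lie: "poisson_hom a (fp_of_lie u) = lie_hom a u"
  by (induction u rule: lie_induct_basis)
    (simp_all add: poisson_hom_def fp_of_lie_add fp_of_lie_scale fp_of_lie_basis fp_subst.zero
      fp_subst.add fp_subst.mult fp_subst.const fp_scale_conv_mult)

lemma poisson_hom_gen [simp]: "poisson_hom a (fp_gen x) = a x"
  by (simp add: fp_gen_def poisson_hom_of_lie)

lemma poisson_endo_poisson_hom: "poisson_endo (poisson_hom a)"
proof -
  interpret fp_hom "single 0" "poisson_hom a"
    unfolding poisson_hom_def by (rule fp_subst.fp_hom_axioms)
  have var: "poisson_hom a (fp_basis_var e) = lie_hom a (Rep_lie_basis e)" for e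
    by (simp add: poisson_hom_def)
  have 1: "poisson_hom a (fp_br (fp_basis_var d) q) = fp_br (poisson_hom a (fp_basis_var d)) (poisson_hom a q)" for d q
    by (induction q rule: fp_induct)
      (simp_all add: zero const fp_br_basis_var poisson_hom_of_lie var fp_br_add_right add
        fp_br_mult_right mult)
  have "poisson_hom a (fp_br p q) = fp_br (poisson_hom a p) (poisson_hom a q)" for p q
    by (induction p rule: fp_induct)
      (simp_all add: zero const 1 fp_br_add_left add fp_br_mult_left mult)
  then show ?thesis by unfold_locales
qed

lemma poisson_endo_id: "poisson_endo (\<lambda>p. p)"
  by (intro poisson_endo.intro fp_hom_id poisson_endo_axioms.intro) simp

lemma poisson_endo_comp:
  assumes "poisson_endo g" "poisson_endo h"
  shows "poisson_endo (\<lambda>p. g (h p))"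
proof -
  interpret g: poisson_endo g by fact
  interpret h: poisson_endo h by fact
  show ?thesis
    by unfold_locales (simp_all add: g.add h.add g.mult h.mult g.const h.const g.br h.br)
qed

lemma automorphism_poisson_endo:
  assumes "free_poisson.automorphism \<phi>"
  shows "poisson_endo \<phi>"
proof
  fix c
  have "\<phi> (fp_scale c 1) = fp_scale c 1"
    using assms by (simp add: free_poisson.automorphism_def)
  then show "\<phi> (single 0 c) = single 0 c"
    by (simp add: fp_scale_conv_mult)
qed (use assms in \<open>auto simp: free_poisson.automorphism_def\<close>)

lemma automorphismI:
  assumes "poisson_endo g" "poisson_endo h" "\<And>x. g (h (fp_gen x)) = fp_gen x" "\<And>x. h (g (fp_gen x)) = fp_gen x"
  shows "free_poisson.automorphism g"
proof -
  interpret g: poisson_endo g by fact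
  have gh: "g (h p) = p" for p
    by (rule poisson_endo_eqI[OF poisson_endo_comp[OF assms(1,2)] poisson_endo_id assms(3)])
  have hg: "h (g p) = p" for p
    by (rule poisson_endo_eqI[OF poisson_endo_comp[OF assms(2,1)] poisson_endo_id assms(4)])
  have "bij g" by (rule o_bij[of h]) (auto simp: gh hg)
  then show ?thesis
    by (simp add: free_poisson.automorphism_def g.add g.scale' g.one g.mult g.br)
qed

lemma automorphism_comp:
  assumes "free_poisson.automorphism \<phi>" "free_poisson.automorphism \<psi>"
  shows "free_poisson.automorphism (\<phi> \<circ> \<psi>)"
  using assms unfolding free_poisson.automorphism_def by (auto intro: bij_comp)

lemma automorphism_inverse:
  assumes "free_poisson.automorphism \<phi>"
  obtains \<psi> where "free_poisson.automorphism \<psi>" "\<And>p. \<phi> (\<psi> p) = p" "\<And>p. \<psi> (\<phi> p) = p"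
proof
  interpret \<phi>: poisson_endo \<phi> by (rule automorphism_poisson_endo[OF assms])
  have bij: "bij \<phi>" using assms by (simp add: free_poisson.automorphism_def)
  let ?\<psi> = "inv \<phi>"
  show 1: "\<phi> (?\<psi> p) = p" for p by (meson bij bij_inv_eq_iff)
  show 2: "?\<psi> (\<phi> p) = p" for p using bij by (simp add: bij_is_inj)
  have inv: "?\<psi> q = p \<longleftrightarrow> q = \<phi> p" for p q by (metis 1 2)
  show "free_poisson.automorphism ?\<psi>"
    using bij_imp_bij_inv[OF bij]
    by (simp add: free_poisson.automorphism_def inv \<phi>.add \<phi>.scale' \<phi>.one \<phi>.mult \<phi>.br 1)
qed

section \<open>Poisson derivations with prescribed values on the generators\<close>

locale poisson_der = algebra_der d
  for d :: "('k::field_char_0, 'x) free_poisson \<Rightarrow> ('k, 'x) free_poisson" +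
  assumes br: "d (fp_br p q) = fp_br (d p) q + fp_br p (d q)"
begin

lemma scale: "d (fp_scale c p) = fp_scale c (d p)"
  by (simp add: fp_scale_conv_mult scalar_mult)

lemma chain_rule:
  assumes "finite A" "fp_vars p \<subseteq> A"
  shows "d p = (\<Sum>e\<in>A. fp_pderiv e p * d (fp_basis_var e))"
  by (rule fp_hom_chain_rule[OF fp_hom_id add mult const assms])

end

lemma poisson_der_eqI:
  assumes "poisson_der d" "poisson_der d'" "\<And>x. d (fp_gen x) = d' (fp_gen x)"
  shows "d p = d' p"
proof -
  interpret d: poisson_der d by fact
  interpret d': poisson_der d' by fact
  have "d (fp_of_lie u) = d' (fp_of_lie u)" for u
    by (induction u rule: free_lie_induct)
      (simp_all add: assms(3)[unfolded fp_gen_def] d.zero d'.zero fp_of_lie_add d.add d'.add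
        fp_of_lie_scale d.scale d'.scale fp_br_of_lie[symmetric] d.br d'.br)
  then have "d (fp_basis_var e) = d' (fp_basis_var e)" for e by (metis fp_of_lie_basis)
  then show ?thesis
    by (simp add: d.chain_rule[of "fp_vars p"] d'.chain_rule[of "fp_vars p"])
qed

text \<open>In the bracket rule the undifferentiated factors enter through their classes in the free
  Lie algebra, so compatibility with the congruence rule for brackets follows at once from the
  induction hypotheses.\<close>

primrec term_der :: "('x \<Rightarrow> ('k::field, 'x) free_poisson) \<Rightarrow> ('k, 'x) lie_term \<Rightarrow> ('k, 'x) free_poisson" where
  "term_der a (TGen x) = a x"
| "term_der a TZero = 0"
| "term_der a (TAdd s t) = term_der a s + term_der a t"
| "term_der a (TScale c s) = fp_scale c (term_der a s)"
| "term_der a (TBr s t) = fp_br (term_der a s) (fp_of_lie (abs_free_lie t)) +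
     fp_br (fp_of_lie (abs_free_lie s)) (term_der a t)"

lemma term_der_cong: "lie_eq s t \<Longrightarrow> term_der a s = term_der a t"
proof (induction rule: lie_eq.induct)
  case (br_cong s s' t t')
  then have "abs_free_lie s = abs_free_lie s'" "abs_free_lie t = abs_free_lie t'"
    by (simp_all add: free_lie.abs_eq_iff)
  then show ?case using br_cong by simp
next
  case (br_self s)
  show ?case by (simp add: fp_br_skew[of "term_der a s"])
next
  case (br_jacobi s t u)
  let ?s = "fp_of_lie (abs_free_lie s)" and ?t = "fp_of_lie (abs_free_lie t)" and ?u = "fp_of_lie (abs_free_lie u)"
  \<comment> \<open>Differentiating the Jacobi identity gives three Jacobi identities, one for each
    argument that is differentiated.\<close>
  have "term_der a (TAdd (TAdd (TBr s (TBr t u)) (TBr t (TBr u s))) (TBr u (TBr s t))) =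
    (fp_br (term_der a s) (fp_br ?t ?u) + fp_br ?t (fp_br ?u (term_der a s)) + fp_br ?u (fp_br (term_der a s) ?t)) +
    (fp_br ?s (fp_br (term_der a t) ?u) + fp_br (term_der a t) (fp_br ?u ?s) + fp_br ?u (fp_br ?s (term_der a t))) +
    (fp_br ?s (fp_br ?t (term_der a u)) + fp_br ?t (fp_br (term_der a u) ?s) + fp_br (term_der a u) (fp_br ?s ?t))"
    by (simp add: lie_br.abs_eq[symmetric] fp_br_of_lie[symmetric] fp_br_add_right)
  then show ?case by (simp only: fp_br_jacobi) simp
qed (simp_all add: free_poisson.scale_right_distrib free_poisson.scale_left_distrib abs_free_lie_add
  lie_scale.abs_eq[symmetric] fp_of_lie_add fp_of_lie_scale zero_free_lie_def[symmetric]
  fp_br_add_left fp_br_add_right fp_br_scale_left fp_br_scale_right)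

lift_definition lie_der :: "('x \<Rightarrow> ('k::field, 'x) free_poisson) \<Rightarrow> ('k, 'x) free_lie \<Rightarrow> ('k, 'x) free_poisson"
  is term_der by (rule term_der_cong)

lemma lie_der_simps [simp]:
  "lie_der a (lie_gen x) = a x"
  "lie_der a 0 = 0"
  "lie_der a (u + v) = lie_der a u + lie_der a v"
  "lie_der a (lie_scale c u) = fp_scale c (lie_der a u)"
proof -
  show "lie_der a (lie_gen x) = a x" by transfer simp
  show "lie_der a 0 = 0" by transfer simp
  show "lie_der a (u + v) = lie_der a u + lie_der a v" by transfer simp
  show "lie_der a (lie_scale c u) = fp_scale c (lie_der a u)" by transfer simp
qed

lemma lie_der_br [simp]:
  "lie_der a (lie_br u v) = fp_br (lie_der a u) (fp_of_lie v) + fp_br (fp_of_lie u) (lie_der a v)"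
proof -
  obtain s t where "u = abs_free_lie s" "v = abs_free_lie t"
    by (metis Quotient_abs_rep[OF Quotient_free_lie])
  then show ?thesis by (simp add: lie_br.abs_eq lie_der.abs_eq)
qed

definition poisson_der_of :: "('x \<Rightarrow> ('k::field, 'x) free_poisson) \<Rightarrow> ('k, 'x) free_poisson \<Rightarrow> ('k, 'x) free_poisson" where
  "poisson_der_of a p = (\<Sum>e\<in>fp_vars p. fp_pderiv e p * lie_der a (Rep_lie_basis e))"

lemma poisson_der_of_superset:
  assumes "finite A" "fp_vars p \<subseteq> A"
  shows "poisson_der_of a p = (\<Sum>e\<in>A. fp_pderiv e p * lie_der a (Rep_lie_basis e))"
  unfolding poisson_der_of_def using assms
  by (intro sum.mono_neutral_left) (auto simp: fp_pderiv_not_in_vars)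

lemma poisson_der_of_rules:
  "poisson_der_of a (p + q) = poisson_der_of a p + poisson_der_of a q"
  "poisson_der_of a (p * q) = poisson_der_of a p * q + p * poisson_der_of a q"
  "poisson_der_of a (single 0 c) = 0"
  "poisson_der_of a (fp_basis_var e) = lie_der a (Rep_lie_basis e)"
proof -
  let ?A = "fp_vars p \<union> fp_vars q"
  show "poisson_der_of a (p + q) = poisson_der_of a p + poisson_der_of a q"
    using fp_vars_add[of p q]
    by (simp add: poisson_der_of_superset[of ?A] fp_pderiv_add distrib_right sum.distrib)
  show "poisson_der_of a (p * q) = poisson_der_of a p * q + p * poisson_der_of a q"
    using fp_vars_mult[of p q]
    by (simp add: poisson_der_of_superset[of ?A] fp_pderiv_mult sum.distrib[symmetric]
        sum_distrib_left sum_distrib_right algebra_simps)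
  show "poisson_der_of a (single 0 c) = 0"
    by (simp add: poisson_der_of_def)
  show "poisson_der_of a (fp_basis_var e) = lie_der a (Rep_lie_basis e)"
    by (simp add: poisson_der_of_def fp_vars_basis_var fp_pderiv_var)
qed

lemma poisson_der_of_of_lie: "poisson_der_of a (fp_of_lie u) = lie_der a u"
proof (induction u rule: lie_induct_basis)
  case zero
  show ?case by (simp add: poisson_der_of_def)
next
  case (step c e u)
  then show ?case
    by (simp add: fp_of_lie_add fp_of_lie_scale fp_of_lie_basis fp_scale_conv_mult poisson_der_of_rules)
qed

lemma poisson_der_of_gen [simp]: "poisson_der_of a (fp_gen x) = a x"
  by (simp add: fp_gen_def poisson_der_of_of_lie)

lemma poisson_der_poisson_der_of: "poisson_der (poisson_der_of a)"
proof -
  note der = poisson_der_of_rules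
  have zero: "poisson_der_of a 0 = 0" by (simp add: poisson_der_of_def)
  have 1: "poisson_der_of a (fp_br (fp_basis_var e) q) =
      fp_br (poisson_der_of a (fp_basis_var e)) q + fp_br (fp_basis_var e) (poisson_der_of a q)" for e q
    by (induction q rule: fp_induct)
      (simp_all add: zero der fp_br_basis_var poisson_der_of_of_lie fp_of_lie_basis fp_br_add_right
        fp_br_mult_right algebra_simps)
  have "poisson_der_of a (fp_br p q) = fp_br (poisson_der_of a p) q + fp_br p (poisson_der_of a q)" for p q
    by (induction p rule: fp_induct)
      (simp_all add: zero der(1-3) 1 fp_br_add_left fp_br_mult_left algebra_simps)
  then show ?thesis by unfold_locales (simp_all add: der)
qed

global_interpretation poisson_der_of: poisson_der "poisson_der_of a" for a :: "'x \<Rightarrow> ('k::field_char_0, 'x) free_poisson"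
  by (rule poisson_der_poisson_der_of)

context poisson_der
begin

lemma nilp_br: "nilp p \<Longrightarrow> nilp q \<Longrightarrow> nilp (fp_br p q)"
  unfolding nilp_def using iter_bilinear[of fp_br, OF fp_br_zero_left fp_br_zero_right br] by blast

lemma nilp_generators:
  assumes "\<And>x. nilp (fp_gen x)"
  shows "nilp p"
proof -
  have "nilp (fp_of_lie u)" for u
    by (induction u rule: free_lie_induct)
      (simp_all add: assms[unfolded fp_gen_def] nilp_zero fp_of_lie_add nilp_add fp_of_lie_scale
        fp_scale_conv_mult nilp_const nilp_mult fp_br_of_lie[symmetric] nilp_br)
  then have "nilp (fp_basis_var e)" for e by (metis fp_of_lie_basis)
  then show ?thesis
    by (induction p rule: fp_induct) (simp_all add: nilp_const nilp_add nilp_mult)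
qed

end

section \<open>The free Lie algebra inside the free associative algebra\<close>

text \<open>With concatenation as addition of exponents, convolution of finitely supported functions
  on words is the multiplication of the free associative algebra.\<close>

instantiation list :: (type) monoid_add
begin

definition zero_list :: "'a list" where "0 = []"

definition plus_list :: "'a list \<Rightarrow> 'a list \<Rightarrow> 'a list" where "u + v = u @ v"

instance by standard (simp_all add: zero_list_def plus_list_def)

end

type_synonym ('k, 'x) free_assoc = "'x list \<Rightarrow>\<^sub>0 'k"

lemma poly_mapping_sum_single:
  "(\<Sum>w\<in>keys a. single w (lookup a w)) = a"
  by (rule poly_mapping_eqI) (auto simp: lookup_sum lookup_single when_def in_keys_iff)

lemma poly_mapping_induct_add [case_names zero single add]:
  fixes a :: "'w \<Rightarrow>\<^sub>0 'k::comm_monoid_add"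
  assumes "P 0" "\<And>w c. P (single w c)" "\<And>a b. P a \<Longrightarrow> P b \<Longrightarrow> P (a + b)"
  shows "P a"
proof -
  have "P (\<Sum>w\<in>A. single w (lookup a w))" for A
    by (induction A rule: infinite_finite_induct) (simp_all add: assms)
  then show ?thesis by (metis poly_mapping_sum_single)
qed

lemma free_assoc_scalar_central:
  "a * single 0 c = single 0 c * (a :: ('k::comm_ring_1, 'x) free_assoc)"
  by (induction a rule: poly_mapping_induct_add) (simp_all add: mult_single mult.commute distrib_left distrib_right)

lemma free_assoc_scalar_left_commute:
  "a * (single 0 c * b) = single 0 c * (a * b :: ('k::comm_ring_1, 'x) free_assoc)"
  by (simp add: mult.assoc[symmetric] free_assoc_scalar_central)

lemma lookup_scalar_mult:
  "lookup (single 0 c * a) w = c * lookup (a :: ('k::comm_ring_1, 'x) free_assoc) w"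
  by (simp add: mult_map_scale_conv_mult[symmetric] Poly_Mapping.map.rep_eq when_def)

primrec term_assoc :: "('k::field, 'x) lie_term \<Rightarrow> ('k, 'x) free_assoc" where
  "term_assoc (TGen x) = single [x] 1"
| "term_assoc TZero = 0"
| "term_assoc (TAdd s t) = term_assoc s + term_assoc t"
| "term_assoc (TScale c s) = single 0 c * term_assoc s"
| "term_assoc (TBr s t) = term_assoc s * term_assoc t - term_assoc t * term_assoc s"

lemma term_assoc_cong: "lie_eq s t \<Longrightarrow> term_assoc s = term_assoc t"
proof (induction rule: lie_eq.induct)
  case (scale_scale c d s)
  then show ?case by (simp add: mult.assoc[symmetric] mult_single)
next
  case (br_scale_left c s t)
  then show ?case by (simp add: right_diff_distrib free_assoc_scalar_left_commute mult.assoc)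
next
  case (br_scale_right s c t)
  then show ?case by (simp add: right_diff_distrib free_assoc_scalar_left_commute mult.assoc)
qed (simp_all add: algebra_simps single_add)

lift_definition lie_assoc :: "('k::field, 'x) free_lie \<Rightarrow> ('k, 'x) free_assoc"
  is term_assoc by (rule term_assoc_cong)

lemma lie_assoc_simps [simp]:
  "lie_assoc (lie_gen x) = single [x] 1"
  "lie_assoc (0 :: ('k::field, 'x) free_lie) = 0"
  "lie_assoc (u + v) = lie_assoc u + lie_assoc v"
  "lie_assoc (lie_scale c u) = single 0 c * lie_assoc u"
  "lie_assoc (lie_br u v) = lie_assoc u * lie_assoc v - lie_assoc v * lie_assoc u"
proof -
  show "lie_assoc (lie_gen x) = single [x] 1" by transfer simp
  show "lie_assoc (0 :: ('k::field, 'x) free_lie) = 0" by transfer simp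
  show "lie_assoc (u + v) = lie_assoc u + lie_assoc v" by transfer simp
  show "lie_assoc (lie_scale c u) = single 0 c * lie_assoc u" by transfer simp
  show "lie_assoc (lie_br u v) = lie_assoc u * lie_assoc v - lie_assoc v * lie_assoc u" by transfer simp
qed

text \<open>
  The free associative algebra acts on the free Poisson algebra, with the generator \<open>x\<close> acting as
  \<open>{x, \<cdot>} + x \<cdot>\<close>. A Lie element \<open>u\<close> then acts as \<open>{u, \<cdot>} + E(u) \<cdot>\<close>, where \<open>E\<close> is the Euler
  derivation; hence \<open>E(u)\<close> vanishes as soon as the image of \<open>u\<close> in the free associative algebra does.
\<close>

lemma fp_br_uminus_right: "fp_br p (- q) = - fp_br p q"
  using fp_br_add_right[of p q "- q"] by (simp add: add_eq_0_iff)

primrec word_act :: "'x list \<Rightarrow> ('k::field, 'x) free_poisson \<Rightarrow> ('k, 'x) free_poisson" where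
  "word_act [] p = p"
| "word_act (x # w) p = fp_br (fp_gen x) (word_act w p) + fp_gen x * word_act w p"

lemma word_act_append: "word_act (u @ v) p = word_act u (word_act v p)"
  by (induction u) simp_all

lemma word_act_add: "word_act w (p + q) = word_act w p + word_act w q"
  by (induction w) (simp_all add: fp_br_add_right algebra_simps)

lemma word_act_scale: "word_act w (fp_scale c p) = fp_scale c (word_act w p)"
  by (induction w) (simp_all add: fp_br_scale_right fp_scale_mult_right free_poisson.scale_right_distrib)

lemma word_act_zero: "word_act w 0 = 0"
  by (induction w) simp_all

definition assoc_act :: "('k::field, 'x) free_assoc \<Rightarrow> ('k, 'x) free_poisson \<Rightarrow> ('k, 'x) free_poisson" where
  "assoc_act a p = (\<Sum>w\<in>keys a. fp_scale (lookup a w) (word_act w p))"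

lemma assoc_act_superset:
  assumes "finite A" "keys a \<subseteq> A"
  shows "assoc_act a p = (\<Sum>w\<in>A. fp_scale (lookup a w) (word_act w p))"
  unfolding assoc_act_def using assms
  by (intro sum.mono_neutral_left) (auto simp: in_keys_iff)

lemma assoc_act_add: "assoc_act (a + b) p = assoc_act a p + assoc_act b p"
proof -
  let ?A = "keys a \<union> keys b"
  show ?thesis
    using keys_add[of a b]
    by (simp add: assoc_act_superset[of ?A] lookup_add free_poisson.scale_left_distrib sum.distrib)
qed

lemma assoc_act_zero [simp]: "assoc_act 0 p = 0"
  by (simp add: assoc_act_def)

lemma assoc_act_diff: "assoc_act (a - b) p = assoc_act a p - assoc_act b p"
  using assoc_act_add[of "a - b" b p] by (simp add: algebra_simps)

lemma assoc_act_single: "assoc_act (single w c) p = fp_scale c (word_act w p)"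
  by (subst assoc_act_superset[of "{w}"]) auto

lemma assoc_act_add_right: "assoc_act a (p + q) = assoc_act a p + assoc_act a q"
  by (simp add: assoc_act_def word_act_add free_poisson.scale_right_distrib sum.distrib)

lemma assoc_act_mult: "assoc_act (a * b) p = assoc_act a (assoc_act b p)"
proof (induction a rule: poly_mapping_induct_add)
  case (single u c)
  show ?case
  proof (induction b rule: poly_mapping_induct_add)
    case (single v d)
    show ?case
      by (simp add: mult_single assoc_act_single plus_list_def word_act_append word_act_scale)
  next
    case (add a b)
    then show ?case by (simp add: distrib_left assoc_act_add assoc_act_add_right)
  qed (simp add: assoc_act_single word_act_zero)
qed (simp_all add: distrib_right assoc_act_add)

text \<open>With \<open>\<alpha>\<close> constantly \<open>1\<close> this is the Euler derivation;
  with \<open>\<alpha>\<close> the indicator of one generator, its eigenvalues count the occurrences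
  of that generator.\<close>

definition scale_der :: "('x \<Rightarrow> 'k::field_char_0) \<Rightarrow> ('k, 'x) free_poisson \<Rightarrow> ('k, 'x) free_poisson" where
  "scale_der \<alpha> = poisson_der_of (\<lambda>x. fp_scale (\<alpha> x) (fp_gen x))"

lemma assoc_act_lie:
  "assoc_act (lie_assoc u) p = fp_br (fp_of_lie u) p + scale_der (\<lambda>_. 1) (fp_of_lie u) * p"
proof (induction u arbitrary: p rule: free_lie_induct)
  case (gen x)
  show ?case by (simp add: assoc_act_single scale_der_def fp_gen_def[symmetric])
next
  case zero
  show ?case by (simp add: scale_der_def poisson_der_of.zero)
next
  case (add u v)
  then show ?case
    by (simp add: assoc_act_add fp_of_lie_add fp_br_add_left scale_der_def
        poisson_der_of.add algebra_simps)
next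
  case (scale c u)
  then show ?case
    by (simp add: assoc_act_mult assoc_act_single fp_of_lie_scale fp_br_scale_left scale_der_def
        poisson_der_of.scale free_poisson.scale_right_distrib
        fp_scale_mult_left zero_list_def)
next
  case (br u v)
  let ?u = "fp_of_lie u" and ?v = "fp_of_lie v" and ?E = "scale_der (\<lambda>_. 1) :: ('a, 'b) free_poisson \<Rightarrow> _"
  have E: "?E (fp_br ?u ?v) = fp_br (?E ?u) ?v + fp_br ?u (?E ?v)"
    by (simp add: scale_der_def poisson_der_of.br)
  have J: "fp_br (fp_br ?u ?v) p = fp_br ?u (fp_br ?v p) - fp_br ?v (fp_br ?u p)"
    using fp_br_jacobi[of ?u ?v p]
    by (simp add: fp_br_skew[of "fp_br ?u ?v" p] fp_br_skew[of ?u p] fp_br_uminus_right neg_eq_iff_add_eq_0 ac_simps)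
  \<comment> \<open>In the commutator of the operators of \<open>u\<close> and \<open>v\<close> the
    terms \<open>{u, E(v)} - {v, E(u)}\<close> survive as a multiplication; they make up
    \<open>E({u, v})\<close> because \<open>E\<close> is a derivation. The rest is
    \<open>{{u, v}, p}\<close> by the Jacobi identity.\<close>
  show ?case
    by (simp add: assoc_act_diff assoc_act_mult br fp_of_lie_scale fp_br_of_lie[symmetric] E J
        fp_br_add_right fp_br_mult_right fp_br_skew[of "?E ?u"] algebra_simps)
qed

section \<open>Content of Lie monomials\<close>

text \<open>A relation rather than a function: zero, for instance, arises as \<open>[x, x]\<close>
  and as \<open>[x, [x, x]]\<close> and so has several contents. Uniqueness for basis elements is
  \<open>content_basis_unique\<close>.\<close>

inductive lie_content :: "('k::field, 'x) free_lie \<Rightarrow> 'x multiset \<Rightarrow> bool" where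
  gen: "lie_content (lie_gen x) {#x#}"
| br: "lie_content u M \<Longrightarrow> lie_content v N \<Longrightarrow> lie_content (lie_br u v) (M + N)"

lemma lie_content_nonempty: "lie_content u M \<Longrightarrow> M \<noteq> {#}"
  by (induction rule: lie_content.induct) auto

definition basis_content :: "('k::field, 'x) lie_basis \<Rightarrow> 'x multiset" where
  "basis_content e = (SOME M. lie_content (Rep_lie_basis e) M)"

lemma lie_content_content: "lie_content (Rep_lie_basis e) (basis_content e)"
proof -
  have "\<exists>M. lie_content u M" if "u \<in> lie_monomials" for u :: "('a, 'b) free_lie"
    using that by induction (blast intro: lie_content.intros)+
  then have "\<exists>M. lie_content (Rep_lie_basis e) M"
    using Rep_lie_basis[of e] lie_basis_set(1) by blast
  then show ?thesis unfolding basis_content_def by (rule someI_ex)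
qed

lemma scale_der_lie_content:
  "lie_content u M \<Longrightarrow> scale_der \<alpha> (fp_of_lie u) = fp_scale (\<Sum>x\<in>#M. \<alpha> x) (fp_of_lie u)"
proof (induction rule: lie_content.induct)
  case (gen x)
  show ?case by (simp add: scale_der_def fp_gen_def[symmetric])
next
  case (br u M v N)
  then show ?case
    by (simp add: fp_br_of_lie[symmetric] scale_der_def poisson_der_of.br
        fp_br_scale_left fp_br_scale_right free_poisson.scale_left_distrib)
qed

text \<open>On Lie elements \<open>scale_der\<close> is diagonal in the chosen basis, because basis
  elements are monomials and so eigenvectors. Comparing eigenvalues is how the grading by content is
  read off below.\<close>

lemma fp_pderiv_scale_der:
  "fp_pderiv e (scale_der \<alpha> (fp_of_lie u)) = fp_scale (\<Sum>x\<in>#basis_content e. \<alpha> x) (fp_pderiv e (fp_of_lie u))"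
proof (induction u rule: lie_induct_basis)
  case zero
  show ?case by (simp add: scale_der_def poisson_der_of.zero)
next
  case (step c d u)
  have "scale_der \<alpha> (fp_basis_var d) = fp_scale (\<Sum>x\<in>#basis_content d. \<alpha> x) (fp_basis_var d)"
    using scale_der_lie_content[OF lie_content_content[of d]] by (simp add: fp_of_lie_basis)
  then show ?case
    using step
    by (simp add: fp_of_lie_add fp_of_lie_scale fp_of_lie_basis scale_der_def fp_pderiv_add
        poisson_der_of.add poisson_der_of.scale
        fp_pderiv_scale fp_pderiv_var free_poisson.scale_right_distrib mult.commute)
qed

text \<open>With \<open>\<alpha>\<close> the indicator of \<open>x\<close>, the element is an
  eigenvector whose eigenvalue is the multiplicity of \<open>x\<close> in \<open>M\<close>, while
  its coefficient at \<open>e\<close> is multiplied by the multiplicity of \<open>x\<close> in the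
  content of \<open>e\<close>. In characteristic zero the two numbers agree.\<close>

lemma content_unique:
  fixes u :: "('k::field_char_0, 'x) free_lie"
  assumes "lie_content u M" "e \<in> fp_vars (fp_of_lie u)"
  shows "basis_content e = M"
proof (rule multiset_eqI)
  fix x :: 'x
  let ?\<alpha> = "\<lambda>y. if y = x then 1 else 0 :: 'k"
  have sum: "(\<Sum>y\<in>#N. ?\<alpha> y) = of_nat (count N x)" for N
    by (induction N) auto
  have "fp_scale (of_nat (count (basis_content e) x)) (fp_pderiv e (fp_of_lie u)) =
      fp_scale (of_nat (count M x)) (fp_pderiv e (fp_of_lie u))"
    using fp_pderiv_scale_der[of e ?\<alpha> u] scale_der_lie_content[OF assms(1), of ?\<alpha>]
    by (auto simp: sum fp_pderiv_scale)
  then show "count (basis_content e) x = count M x"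
    using fp_pderiv_nonzero[OF assms(2)] by auto
qed

lemma content_basis_unique:
  fixes e :: "('k::field_char_0, 'x) lie_basis"
  assumes "lie_content (Rep_lie_basis e) M"
  shows "basis_content e = M"
  by (rule content_unique[OF assms]) (simp add: fp_of_lie_basis fp_vars_basis_var)

text \<open>Injectivity of the map to the free associative algebra. If the image of \<open>u\<close>
  is zero, letting it act on \<open>1\<close> gives \<open>E(u) = 0\<close>, as brackets with
  \<open>1\<close> vanish; but \<open>E\<close> multiplies the coefficient at \<open>e\<close> by
  the number of letters of \<open>e\<close>, which is nonzero in characteristic zero.\<close>

lemma lie_assoc_nonzero:
  fixes u :: "('k::field_char_0, 'x) free_lie"
  assumes "e \<in> fp_vars (fp_of_lie u)"
  shows "lie_assoc u \<noteq> 0"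
proof
  assume "lie_assoc u = 0"
  then have "scale_der (\<lambda>_. 1) (fp_of_lie u) = 0"
    using assoc_act_lie[of u 1] by simp
  then have "fp_scale (\<Sum>x\<in>#basis_content e. 1) (fp_pderiv e (fp_of_lie u)) = 0"
    using fp_pderiv_scale_der[of e "\<lambda>_. 1" u] by simp
  moreover have "(\<Sum>x\<in>#basis_content e. 1 :: 'k) = of_nat (size (basis_content e))"
    by (simp add: sum_mset_constant)
  moreover have "size (basis_content e) \<noteq> 0" using lie_content_nonempty[OF lie_content_content] by simp
  ultimately show False using fp_pderiv_nonzero[OF assms] by simp
qed

text \<open>A bracket of two generators is nonzero only if they are distinct, and longer brackets
  contain the letters of a shorter nonzero one. In two variables, every nonzero iterated bracket
  thus involves both letters.\<close>

lemma lie_content_cases: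
  assumes "lie_content u M" "u \<noteq> 0"
  shows "(\<exists>x. u = lie_gen x \<and> M = {#x#}) \<or>
    (\<exists>v w. u = lie_br v w) \<and> (\<exists>x y. x \<noteq> y \<and> x \<in># M \<and> y \<in># M)"
  using assms
proof induction
  case (br u M v N)
  have "u \<noteq> 0" "v \<noteq> 0" using br.prems by auto
  note IH = br.IH(1)[OF this(1)] br.IH(2)[OF this(2)]
  show ?case
  proof (cases "(\<exists>x. u = lie_gen x \<and> M = {#x#}) \<and> (\<exists>x. v = lie_gen x \<and> N = {#x#})")
    case True
    then obtain x y where "u = lie_gen x" "M = {#x#}" "v = lie_gen y" "N = {#y#}" by blast
    moreover from this br.prems have "x \<noteq> y" by (auto simp: free_lie.br_self)
    ultimately show ?thesis by auto
  next
    case False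
    with IH show ?thesis by fastforce
  qed
qed blast

lemma keys_lie_assoc: "lie_content u M \<Longrightarrow> w \<in> keys (lie_assoc u) \<Longrightarrow> mset w = M"
proof (induction arbitrary: w rule: lie_content.induct)
  case (br u M v N)
  let ?u = "lie_assoc u" and ?v = "lie_assoc v"
  consider "w \<in> keys (?u * ?v)" | "w \<in> keys (?v * ?u)"
    using br.prems keys_diff[of "?u * ?v" "?v * ?u"] by auto
  then show ?case
  proof cases
    case 1
    then obtain a b where "w = a + b" "a \<in> keys ?u" "b \<in> keys ?v"
      using keys_mult[of ?u ?v] by blast
    then show ?thesis using br.IH by (simp add: plus_list_def)
  next
    case 2
    then obtain a b where "w = a + b" "a \<in> keys ?v" "b \<in> keys ?u"
      using keys_mult[of ?v ?u] by blast
    then show ?thesis using br.IH by (simp add: plus_list_def)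
  qed
qed auto

definition gen_var :: "'x \<Rightarrow> ('k::field, 'x) lie_basis" where
  "gen_var x = Abs_lie_basis (lie_gen x)"

lemma basis_nonzero: "Rep_lie_basis e \<noteq> 0"
proof
  assume "Rep_lie_basis e = 0"
  then have "fp_basis_var e = 0" by (metis fp_of_lie_basis fp_of_lie_zero)
  then show False using fp_vars_basis_var[of e] by simp
qed

lemma fp_scale_const:
  "fp_scale c (single 0 d) = single 0 (c * d)"
  "fp_scale c 1 = single 0 c"
  by (simp_all add: fp_scale_conv_mult mult_single)

lemma fp_of_lie_eq_zero: "fp_of_lie u = 0 \<Longrightarrow> u = 0"
proof -
  assume "fp_of_lie u = 0"
  have "fp_pderiv (Abs_lie_basis b) (fp_of_lie u) =
      single 0 (free_lie.representation lie_basis_set u b)" if b: "b \<in> lie_basis_set" for b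
  proof (induction u rule: lie_induct_basis)
    case zero
    show ?case by (simp add: free_lie.representation_zero)
  next
    case (step c e u)
    have "free_lie.representation lie_basis_set (Rep_lie_basis e) b = (if b = Rep_lie_basis e then 1 else 0)"
      by (subst free_lie.representation_basis) (simp_all add: lie_basis_set Rep_lie_basis)
    then show ?case
      using step b Abs_lie_basis_inverse[OF b] Rep_lie_basis_inverse[of e]
      by (auto simp: fp_of_lie_add fp_of_lie_scale fp_of_lie_basis fp_pderiv_add fp_pderiv_scale
          fp_pderiv_var free_lie.representation_add free_lie.representation_scale lie_basis_set
          single_add fp_scale_const)
  qed
  with \<open>fp_of_lie u = 0\<close> have "free_lie.representation lie_basis_set u b = 0" if "b \<in> lie_basis_set" for b
    using that by (metis fp_pderiv_zero lookup_single_eq lookup_zero)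
  then have "free_lie.representation lie_basis_set u b = 0" for b
    using free_lie.representation_ne_zero by blast
  moreover have "(\<Sum>b | free_lie.representation lie_basis_set u b \<noteq> 0.
      lie_scale (free_lie.representation lie_basis_set u b) b) = u"
    by (rule free_lie.sum_nonzero_representation_eq) (simp_all add: lie_basis_set)
  ultimately show "u = 0" by simp
qed

text \<open>The basis was chosen arbitrarily among Lie monomials, so it remains to see that it
  contains the generators: a basis element occurring in \<open>fp_gen x\<close> has content
  \<open>{#x#}\<close>, and the only nonzero monomial of this content is the generator
  itself.\<close>

lemma Rep_gen_var [simp]: "Rep_lie_basis (gen_var x :: ('k::field_char_0, 'x) lie_basis) = lie_gen x"
proof -
  have "fp_gen x \<noteq> (0 :: ('k, 'x) free_poisson)"
    using fp_of_lie_eq_zero[of "lie_gen x :: ('k, 'x) free_lie"] lie_gen_nonzero[of x, where ?'k = 'k]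
    unfolding fp_gen_def by blast
  have "fp_vars (fp_gen x :: ('k, 'x) free_poisson) \<noteq> {}"
  proof
    assume "fp_vars (fp_gen x :: ('k, 'x) free_poisson) = {}"
    then obtain c :: 'k where c: "fp_gen x = single 0 c" by (auto simp: fp_vars_empty_iff)
    \<comment> \<open>The Euler derivation fixes \<open>fp_gen x\<close> but kills
      constants.\<close>
    have "scale_der (\<lambda>_. 1 :: 'k) (fp_gen x) = fp_gen x" by (simp add: scale_der_def)
    then show False using \<open>fp_gen x \<noteq> 0\<close> c
      by (metis scale_der_def poisson_der_of.const)
  qed
  then obtain e :: "('k, 'x) lie_basis" where e: "e \<in> fp_vars (fp_gen x)" by blast
  then have "basis_content e = {#x#}" using content_unique[OF lie_content.gen] by (simp add: fp_gen_def)
  then have "Rep_lie_basis e = lie_gen x"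
    using lie_content_cases[OF lie_content_content[of e] basis_nonzero] by auto
  then have "lie_gen x \<in> (lie_basis_set :: ('k, 'x) free_lie set)" by (metis Rep_lie_basis)
  then show ?thesis by (simp add: gen_var_def Abs_lie_basis_inverse)
qed

lemma fp_gen_conv_var: "fp_gen x = (fp_basis_var (gen_var x) :: ('k::field_char_0, 'x) free_poisson)"
  by (metis Rep_gen_var fp_gen_def fp_of_lie_basis)

lemma content_gen_var [simp]: "basis_content (gen_var x :: ('k::field_char_0, 'x) lie_basis) = {#x#}"
  by (rule content_basis_unique) (simp add: lie_content.gen)

lemma gen_var_inject [simp]: "(gen_var x :: ('k::field_char_0, 'x) lie_basis) = gen_var y \<longleftrightarrow> x = y"
  by (metis content_gen_var single_eq_single)

lemma not_gen_var:
  fixes e :: "('k::field_char_0, 'x) lie_basis"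
  assumes "e \<notin> range gen_var"
  obtains u v x y where "Rep_lie_basis e = lie_br u v" "x \<noteq> y" "x \<in># basis_content e" "y \<in># basis_content e"
proof -
  have "Rep_lie_basis e \<noteq> lie_gen x" for x
    using assms by (metis Rep_gen_var Rep_lie_basis_inject rangeI)
  with lie_content_cases[OF lie_content_content[of e] basis_nonzero] show thesis using that by blast
qed

section \<open>Derivations of the free associative algebra in two variables\<close>

lemma two_cases: "(c :: 2) = a \<or> c = b" if "a \<noteq> b"
proof -
  have "card {a, b} = card (UNIV :: 2 set)" using that by simp
  then have "{a, b} = (UNIV :: 2 set)" by (intro card_subset_eq) auto
  then show ?thesis by blast
qed

text \<open>Descent as in the Euclidean algorithm: where two factorisations first differ, one
  generating word is a prefix of the other, say \<open>f b = f a @ g\<close>. The pair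
  \<open>f a\<close>, \<open>g\<close> is shorter, still does not commute, and the words in the old
  pair are words in the new one.\<close>

lemma noncommuting_words_free:
  fixes f :: "2 \<Rightarrow> 'a list"
  assumes "f a @ f b \<noteq> f b @ f a" "concat (map f u) = concat (map f v)"
  shows "u = v"
  using assms
proof (induction "length (f a) + length (f b)" arbitrary: f a b u v rule: less_induct)
  case less
  have ab: "a \<noteq> b" using less.prems(1) by auto
  have nonempty: "f c \<noteq> []" for c using two_cases[OF ab, of c] less.prems(1) by auto
  have descent: False if ne: "f a @ f b \<noteq> f b @ f a" and eq: "f a @ concat (map f u) = f b @ concat (map f v)"
    and pre: "f b = f a @ g" and IH: "\<forall>(f' :: 2 \<Rightarrow> 'a list) u v. length (f' a) + length (f' b) < length (f a) + length (f b) \<longrightarrow>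
      f' a @ f' b \<noteq> f' b @ f' a \<longrightarrow> concat (map f' u) = concat (map f' v) \<longrightarrow> u = v"
    for a b u v g
  proof -
    have ab: "a \<noteq> b" using ne by auto
    define f' where "f' = f(b := g)"
    \<comment> \<open>\<open>s\<close> rewrites the old letters in terms of the new pair; every
      \<open>s c\<close> begins with \<open>a\<close>.\<close>
    define s where "s c = (if c = a then [a] else [a, b])" for c
    have f': "f' a = f a" "f' b = g" using ab by (simp_all add: f'_def)
    have f: "f c = concat (map f' (s c))" for c
      using two_cases[OF ab, of c] ab pre by (auto simp: s_def f')
    have subst: "concat (map f w) = concat (map f' (concat (map s w)))" for w
      by (induction w) (simp_all add: f)
    have eq': "concat (map f' (concat (map s u))) = concat (map f' (b # concat (map s v)))"
      using eq pre subst[of u] subst[of v] f' by simp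
    have ne': "f' a @ f' b \<noteq> f' b @ f' a" using ne pre by (simp add: f')
    have "length (f' a) + length (f' b) < length (f a) + length (f b)"
      using pre nonempty by (simp add: f')
    \<comment> \<open>Impossible: the left side is empty or begins with \<open>a\<close>, which
      differs from \<open>b\<close>.\<close>
    with IH ne' eq' have "concat (map s u) = b # concat (map s v)" by blast
    then show False using ab by (cases u) (auto simp: s_def split: if_splits)
  qed
  show ?case using less.prems(2)
  proof (induction u arbitrary: v)
    case Nil
    then show ?case using nonempty by (cases v) auto
  next
    case (Cons c u)
    then obtain c' v' where v: "v = c' # v'" using nonempty by (cases v) auto
    have eq: "f c @ concat (map f u) = f c' @ concat (map f v')" using Cons.prems v by simp
    show ?case
    proof (cases "c = c'")
      case True
      then show ?thesis using Cons.IH[of v'] eq v by simp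
    next
      case False
      have comm: "f c @ f c' \<noteq> f c' @ f c" "length (f c) + length (f c') = length (f a) + length (f b)"
        using False two_cases[OF ab, of c] two_cases[OF ab, of c'] less.prems(1) by auto
      have IH: "\<forall>(f' :: 2 \<Rightarrow> 'a list) u v. length (f' p) + length (f' q) < length (f p) + length (f q) \<longrightarrow>
          f' p @ f' q \<noteq> f' q @ f' p \<longrightarrow> concat (map f' u) = concat (map f' v) \<longrightarrow> u = v"
        if "(p, q) = (c, c') \<or> (p, q) = (c', c)" for p q
      proof -
        have "length (f p) + length (f q) = length (f a) + length (f b)" using comm(2) that by auto
        then show ?thesis using less.hyps[of _ p q] by metis
      qed
      from eq have "(\<exists>g. f c' = f c @ g) \<or> (\<exists>g. f c = f c' @ g)"
        unfolding append_eq_append_conv2 by metis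
      then show ?thesis
      proof
        assume "\<exists>g. f c' = f c @ g"
        then obtain g where "f c' = f c @ g" by blast
        from descent[OF comm(1) eq this IH] show ?thesis by simp
      next
        assume "\<exists>g. f c = f c' @ g"
        then obtain g where "f c = f c' @ g" by blast
        from descent[OF comm(1)[symmetric] eq[symmetric] this IH] show ?thesis by simp
      qed
    qed
  qed
qed

text \<open>Words of equal length are compared lexicographically, as binary numbers.\<close>

primrec word_value :: "2 list \<Rightarrow> nat" where
  "word_value [] = 0"
| "word_value (c # w) = (if c = 0 then 0 else 2 ^ length w) + word_value w"

lemma word_value_less: "word_value w < 2 ^ length w"
  by (induction w) auto

lemma word_value_append: "word_value (u @ v) = word_value u * 2 ^ length v + word_value v"
  by (induction u) (simp_all add: power_add algebra_simps)

lemma word_value_inject: "length u = length v \<Longrightarrow> word_value u = word_value v \<Longrightarrow> u = v"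
proof (induction u v rule: list_induct2)
  case (Cons c u c' v)
  have "c = c'"
  proof (rule ccontr)
    assume ne: "c \<noteq> c'"
    then have "c = 0 \<and> c' \<noteq> 0 \<or> c \<noteq> 0 \<and> c' = 0" using two_cases by metis
    then show False
      using Cons.prems Cons.hyps word_value_less[of u] word_value_less[of v] by auto
  qed
  moreover from this have "word_value u = word_value v" using Cons.prems Cons.hyps by (auto split: if_splits)
  ultimately show ?case using Cons.IH by simp
qed simp

section \<open>Leading words and evaluation of noncommutative polynomials\<close>

definition leading_word :: "('k::field, 2) free_assoc \<Rightarrow> 2 list \<Rightarrow> bool" where
  "leading_word a u \<longleftrightarrow> u \<in> keys a \<and>
     (\<forall>w\<in>keys a. w \<noteq> u \<longrightarrow> length w = length u \<and> word_value w < word_value u)"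

lemma leading_word_exists:
  assumes "a \<noteq> 0" "\<And>w. w \<in> keys a \<Longrightarrow> length w = n"
  obtains u where "leading_word a u"
proof -
  have "keys a \<noteq> {}" using assms(1) by simp
  then have "Max (word_value ` keys a) \<in> word_value ` keys a"
    by (intro Max_in) auto
  then obtain u where u: "u \<in> keys a" "Max (word_value ` keys a) = word_value u" by auto
  have "word_value w < word_value u" if "w \<in> keys a" "w \<noteq> u" for w
  proof -
    have "word_value w \<le> word_value u" unfolding u(2)[symmetric] using that by (intro Max_ge) auto
    moreover have "word_value w \<noteq> word_value u" using that u assms(2) word_value_inject by metis
    ultimately show ?thesis by simp
  qed
  then show thesis using u assms(2) by (intro that[of u]) (auto simp: leading_word_def)
qed

lemma leading_word_mult:
  assumes a: "leading_word a u" and b: "leading_word b v"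
  shows "leading_word (a * b) (u @ v)"
proof -
  have less: "length (u' @ v') = length (u @ v) \<and> word_value (u' @ v') < word_value (u @ v)"
    if "u' \<in> keys a" "v' \<in> keys b" "u' \<noteq> u \<or> v' \<noteq> v" for u' v'
  proof -
    have len: "length u' = length u" "length v' = length v"
      using that a b by (auto simp: leading_word_def)
    have "word_value (u' @ v') < word_value (u @ v)"
    proof (cases "u' = u")
      case True
      then show ?thesis using that b len by (auto simp: leading_word_def word_value_append)
    next
      case False
      \<comment> \<open>A smaller prefix costs at least \<open>2 ^ length v\<close>, more than any
        suffix of that length can make up.\<close>
      then have "word_value u' + 1 \<le> word_value u" using that a by (auto simp: leading_word_def)
      then have "(word_value u' + 1) * 2 ^ length v \<le> word_value u * 2 ^ length v" by (rule mult_le_mono1)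
      then show ?thesis using word_value_less[of v'] len by (simp add: word_value_append)
    qed
    then show ?thesis using len by simp
  qed
  define c where "c = lookup a u"
  define e where "e = lookup b v"
  let ?a = "a - single u c" and ?b = "b - single v e"
  have ka: "keys ?a \<subseteq> keys a - {u}"
    by (auto simp: in_keys_iff lookup_minus lookup_single c_def when_def split: if_splits)
  have kb: "keys ?b \<subseteq> keys b - {v}"
    by (auto simp: in_keys_iff lookup_minus lookup_single e_def when_def split: if_splits)
  have "a * b = single (u @ v) (c * e) + (single u c * ?b + ?a * b)"
    by (simp add: algebra_simps mult_single plus_list_def)
  moreover have "u @ v \<notin> keys (single u c * ?b)"
  proof
    assume "u @ v \<in> keys (single u c * ?b)"
    then obtain u' v' where "u @ v = u' @ v'" "u' = u" "v' \<in> keys ?b"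
      using keys_mult[of "single u c" ?b] by (auto simp: plus_list_def split: if_splits)
    then show False using kb by auto
  qed
  moreover have "u @ v \<notin> keys (?a * b)"
  proof
    assume "u @ v \<in> keys (?a * b)"
    then obtain u' v' where uv: "u @ v = u' @ v'" "u' \<in> keys ?a" "v' \<in> keys b"
      using keys_mult[of ?a b] by (auto simp: plus_list_def)
    then show False using ka less[of u' v'] by auto
  qed
  ultimately have "lookup (a * b) (u @ v) = c * e"
    by (simp add: lookup_add in_keys_iff)
  moreover have "c \<noteq> 0" "e \<noteq> 0" using a b by (auto simp: c_def e_def leading_word_def in_keys_iff)
  ultimately have "u @ v \<in> keys (a * b)" by (simp add: in_keys_iff)
  moreover have "length w = length (u @ v) \<and> word_value w < word_value (u @ v)"
    if w: "w \<in> keys (a * b)" "w \<noteq> u @ v" for w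
  proof -
    obtain u' v' where "w = u' @ v'" "u' \<in> keys a" "v' \<in> keys b"
      using w keys_mult[of a b] by (auto simp: plus_list_def)
    then show ?thesis using less[of u' v'] w by auto
  qed
  ultimately show ?thesis by (auto simp: leading_word_def)
qed

definition word_eval :: "('x \<Rightarrow> 'a::monoid_mult) \<Rightarrow> 'x list \<Rightarrow> 'a" where
  "word_eval g w = prod_list (map g w)"

lemma word_eval_simps [simp]: "word_eval g [] = 1" "word_eval g (c # w) = g c * word_eval g w"
  by (simp_all add: word_eval_def)

lemma leading_word_eval:
  assumes "\<And>c. leading_word (g c) (f c)"
  shows "leading_word (word_eval g w) (concat (map f w))"
proof (induction w)
  case Nil
  show ?case by (simp add: leading_word_def zero_list_def)
next
  case (Cons c w)
  then show ?case using leading_word_mult[OF assms[of c]] by simp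
qed

text \<open>The values of distinct words have distinct leading words, because \<open>f 0\<close> and
  \<open>f 1\<close> generate a free monoid. A leading word of largest \<open>word_value\<close>
  occurs in just one of the values and does not cancel.\<close>

lemma assoc_eval_nonzero:
  fixes a :: "('k::field, 2) free_assoc" and g :: "2 \<Rightarrow> ('k, 2) free_assoc"
  assumes "a \<noteq> 0" and mset: "\<And>w. w \<in> keys a \<Longrightarrow> mset w = M"
    and lead: "\<And>c. leading_word (g c) (f c)" and comm: "f 0 @ f 1 \<noteq> f 1 @ f 0"
  shows "(\<Sum>w\<in>keys a. single 0 (lookup a w) * word_eval g w) \<noteq> 0"
proof -
  define F where "F w = concat (map f w)" for w
  have len: "length (F w) = length (F w')" if "w \<in> keys a" "w' \<in> keys a" for w w'
  proof -
    have "mset (map (length \<circ> f) w) = mset (map (length \<circ> f) w')" using mset that by (metis mset_map)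
    then show ?thesis unfolding F_def length_concat map_map by (metis sum_mset_sum_list)
  qed
  have "keys a \<noteq> {}" using assms(1) by simp
  then have "Max (word_value ` F ` keys a) \<in> word_value ` F ` keys a"
    by (intro Max_in) auto
  then obtain u where u: "u \<in> keys a" "Max (word_value ` F ` keys a) = word_value (F u)" by auto
  have zero: "lookup (word_eval g w) (F u) = 0" if w: "w \<in> keys a" "w \<noteq> u" for w
  proof (rule ccontr)
    assume *: "lookup (word_eval g w) (F u) \<noteq> 0"
    have "F w \<noteq> F u" using noncommuting_words_free[OF comm] w by (auto simp: F_def)
    have "word_value (F w) \<le> word_value (F u)"
      unfolding u(2)[symmetric] using w by (intro Max_ge) auto
    moreover have "F u = F w \<or> word_value (F u) < word_value (F w)"
      using leading_word_eval[of g f w, OF lead] * by (auto simp: leading_word_def in_keys_iff F_def)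
    ultimately show False using \<open>F w \<noteq> F u\<close> by auto
  qed
  have "lookup (\<Sum>w\<in>keys a. single 0 (lookup a w) * word_eval g w) (F u) =
      (\<Sum>w\<in>keys a. if w = u then lookup a u * lookup (word_eval g u) (F u) else 0)"
    unfolding lookup_sum lookup_scalar_mult by (intro sum.cong) (auto simp: zero)
  also have "\<dots> = lookup a u * lookup (word_eval g u) (F u)"
    using u(1) by simp
  also have "\<dots> \<noteq> 0"
    using u(1) leading_word_eval[of g f u, OF lead] by (auto simp: leading_word_def in_keys_iff F_def)
  finally show ?thesis by auto
qed

lemma single_Nil_one: "single [] 1 = (1 :: ('k::field, 'x) free_assoc)"
  by (simp add: zero_list_def[symmetric])

section \<open>Derivations of the free associative algebra\<close>

primrec word_der :: "('x \<Rightarrow> ('k::field_char_0, 'x) free_assoc) \<Rightarrow> 'x list \<Rightarrow> ('k, 'x) free_assoc" where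
  "word_der g [] = 0"
| "word_der g (x # w) = g x * single w 1 + single [x] 1 * word_der g w"

lemma word_der_append:
  fixes g :: "'x \<Rightarrow> ('k::field_char_0, 'x) free_assoc"
  shows "word_der g (u @ v) = word_der g u * single v 1 + single u 1 * word_der g v"
proof (induction u)
  case Nil
  show ?case by (simp add: single_Nil_one)
next
  case (Cons x u)
  have "single (u @ v) 1 = single u 1 * single v (1 :: 'k)"
    "single (x # u) 1 = single [x] 1 * single u (1 :: 'k)"
    by (simp_all add: mult_single plus_list_def)
  then show ?case using Cons by (simp add: algebra_simps)
qed

definition assoc_der :: "('x \<Rightarrow> ('k::field_char_0, 'x) free_assoc) \<Rightarrow> ('k, 'x) free_assoc \<Rightarrow> ('k, 'x) free_assoc" where
  "assoc_der g a = (\<Sum>w\<in>keys a. single 0 (lookup a w) * word_der g w)"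

lemma assoc_der_superset:
  assumes "finite A" "keys a \<subseteq> A"
  shows "assoc_der g a = (\<Sum>w\<in>A. single 0 (lookup a w) * word_der g w)"
  unfolding assoc_der_def using assms
  by (intro sum.mono_neutral_left) (auto simp: in_keys_iff)

lemma assoc_der_single: "assoc_der g (single w c) = single 0 c * word_der g w"
  by (subst assoc_der_superset[of "{w}"]) auto

lemma assoc_der_add: "assoc_der g (a + b) = assoc_der g a + assoc_der g b"
proof -
  let ?A = "keys a \<union> keys b"
  show ?thesis
    using keys_add[of a b]
    by (simp add: assoc_der_superset[of ?A] lookup_add single_add distrib_right sum.distrib)
qed

global_interpretation assoc_der: algebra_der "assoc_der g" for g :: "'x \<Rightarrow> ('k::field_char_0, 'x) free_assoc"
proof
  show "assoc_der g (a + b) = assoc_der g a + assoc_der g b" for a b by (rule assoc_der_add)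
  show "assoc_der g (single 0 c) = 0" for c
    by (simp add: assoc_der_single zero_list_def)
  have zero: "assoc_der g 0 = 0" by (simp add: assoc_der_def)
  show "assoc_der g (a * b) = assoc_der g a * b + a * assoc_der g b" for a b
  proof (induction a rule: poly_mapping_induct_add)
    case (single u c)
    show ?case
    proof (induction b rule: poly_mapping_induct_add)
      case (single v e)
      have scalar: "single w b = single 0 b * single w 1" for w :: "'x list" and b :: 'k
        by (simp add: mult_single)
      have "assoc_der g (single u c * single v e) =
          single 0 (c * e) * (word_der g u * single v 1 + single u 1 * word_der g v)"
        by (simp add: mult_single plus_list_def assoc_der_single word_der_append)
      also have "single 0 (c * e) = single 0 c * single (0 :: 'x list) e"
        by (simp add: mult_single)
      also have "\<dots> * (word_der g u * single v 1 + single u 1 * word_der g v) =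
          (single 0 c * word_der g u) * (single 0 e * single v 1) +
          (single 0 c * single u 1) * (single 0 e * word_der g v)"
        by (simp only: distrib_left mult.assoc free_assoc_scalar_left_commute[of "word_der g u" e]
            free_assoc_scalar_left_commute[of "single u 1" e])
      finally show ?case by (simp only: assoc_der_single scalar[symmetric])
    qed (simp_all add: zero assoc_der_add distrib_left)
  qed (simp_all add: zero assoc_der_add distrib_right)
qed

text \<open>The derivation touches one letter of a word at a time, so \<open>N\<close> is added
  exactly once.\<close>

lemma keys_assoc_der:
  assumes "\<And>w. w \<in> keys a \<Longrightarrow> mset w = M"
    and "\<And>c w. w \<in> keys (g c) \<Longrightarrow> mset w = {#c#} + N"
    and "w \<in> keys (assoc_der g a)"
  shows "mset w = M + N"
proof -
  have word: "mset v = mset u + N" if "v \<in> keys (word_der g u)" for u v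
    using that
  proof (induction u arbitrary: v)
    case (Cons x u)
    then consider "v \<in> keys (g x * single u 1)"
      | "v \<in> keys (single [x] 1 * word_der g u)"
      using keys_add[of "g x * single u 1"] by auto
    then show ?case
    proof cases
      case 1
      then obtain w where "w \<in> keys (g x)" "v = w @ u"
        using keys_mult[of "g x" "single u 1"] by (auto simp: plus_list_def)
      then show ?thesis using assms(2) by (auto simp: ac_simps)
    next
      case 2
      then obtain w where "w \<in> keys (word_der g u)" "v = x # w"
        using keys_mult[of "single [x] 1" "word_der g u"] by (auto simp: plus_list_def)
      then show ?thesis using Cons.IH by auto
    qed
  qed simp
  have "w \<in> (\<Union>u\<in>keys a. keys (single 0 (lookup a u) * word_der g u))"
    using assms(3) keys_sum unfolding assoc_der_def by fast
  then obtain u where u: "u \<in> keys a" "w \<in> keys (single 0 (lookup a u) * word_der g u)"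
    by blast
  then have "w \<in> keys (word_der g u)" by (auto simp: in_keys_iff lookup_scalar_mult)
  then show ?thesis using word[of w u] assms(1)[OF u(1)] by simp
qed

text \<open>Commuting words are powers of a common word, so their contents are proportional.\<close>

lemma commuting_words_count:
  assumes "u @ v = v @ u"
  shows "count (mset u) a * count (mset v) b = count (mset u) b * count (mset v) a"
proof -
  obtain m n z where z: "concat (replicate m z) = u" "concat (replicate n z) = v"
    using comm_append_are_replicate[OF assms] by blast
  have "count (mset (concat (replicate k z))) c = k * count (mset z) c" for k c
    by (induction k) simp_all
  then show ?thesis unfolding z[symmetric] by simp
qed

text \<open>If \<open>g c\<close> is nonzero, its divided power of order \<open>K w0\<close> equals
  \<open>g c\<close> evaluated at the last nonzero divided powers \<open>\<xi>\<close> of the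
  letters, which is nonzero. But \<open>g c\<close> is the derivative of the letter
  \<open>c\<close>, so this is a multiple of a divided power of that letter of order greater than
  \<open>m c\<close>, hence zero.\<close>

lemma nilpotent_assoc_der_zero:
  fixes g :: "2 \<Rightarrow> ('k::field_char_0, 2) free_assoc"
  assumes keys: "\<And>c w. w \<in> keys (g c) \<Longrightarrow> mset w = {#c#} + N"
    and nil: "\<And>c. \<exists>n. (assoc_der g ^^ n) (single [c] 1) = 0"
  shows "g c = 0"
proof (rule ccontr)
  assume "g c \<noteq> 0"
  let ?d = "assoc_der g" and ?x = "\<lambda>b. single [b] (1 :: 'k)"
  let ?e = "divided_power ?d"
  \<comment> \<open>The order of the last nonzero iterate on the letter \<open>b\<close>.\<close>
  define m where "m b = (LEAST n. (?d ^^ Suc n) (?x b) = 0)" for b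
  have ex: "\<exists>n. (?d ^^ Suc n) (?x b) = 0" for b
    using nil[of b] assoc_der.iter_eq_zero_mono[of _ g "?x b" "Suc _"] by (meson le_SucI order_refl)
  have m0: "(?d ^^ Suc (m b)) (?x b) = 0" for b
    unfolding m_def by (rule LeastI_ex[OF ex])
  have m1: "(?d ^^ m b) (?x b) \<noteq> 0" for b
  proof (cases "m b")
    case (Suc n)
    then have "n < m b" by simp
    from not_less_Least[OF this[unfolded m_def]] show ?thesis unfolding Suc .
  qed (use lookup_single_eq[of "[b]" "1 :: 'k"] in \<open>auto simp del: lookup_single_eq\<close>)
  define \<xi> where "\<xi> b = ?e (m b) (?x b)" for b
  have above: "?e k (?x b) = 0" if "m b < k" for k b
    using assoc_der.iter_eq_zero_mono[OF m0, of b k] that by (simp add: assoc_der.divided_power_eq_zero_iff)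
  have \<xi>: "\<xi> b \<noteq> 0" for b
    using m1 by (simp add: \<xi>_def assoc_der.divided_power_eq_zero_iff)
  have keys_iter: "mset w = {#b#} + repeat_mset k N" if "w \<in> keys ((?d ^^ k) (?x b))" for k b w
    using that
  proof (induction k arbitrary: w)
    case (Suc k)
    have "mset w = ({#b#} + repeat_mset k N) + N"
      by (rule keys_assoc_der[OF Suc.IH keys]) (use Suc.prems in auto)
    then show ?case by simp
  qed auto
  have keys_\<xi>: "mset w = {#b#} + repeat_mset (m b) N" if "w \<in> keys (\<xi> b)" for b w
    by (rule keys_iter) (use that in \<open>auto simp: \<xi>_def divided_power_def in_keys_iff lookup_scalar_mult\<close>)
  have "\<exists>u. leading_word (\<xi> b) u" for b
  proof -
    have "length w = size ({#b#} + repeat_mset (m b) N)" if "w \<in> keys (\<xi> b)" for w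
      using keys_\<xi>[OF that] by (metis size_mset)
    then show ?thesis using leading_word_exists[OF \<xi>] by blast
  qed
  then obtain f where f: "leading_word (\<xi> b) (f b)" for b by metis
  have mf: "mset (f b) = {#b#} + repeat_mset (m b) N" for b
    using f[of b] keys_\<xi> by (simp add: leading_word_def)
  \<comment> \<open>With \<open>N 0\<close> and \<open>N 1\<close> the multiplicities in
    \<open>N\<close>, proportional contents would require \<open>(1 + m 0 * N 0) * (1 + m 1 * N 1) =
    (m 0 * N 1) * (m 1 * N 0)\<close>, whose left side is larger.\<close>
  have comm: "f 0 @ f 1 \<noteq> f 1 @ f 0"
  proof
    assume "f 0 @ f 1 = f 1 @ f 0"
    from commuting_words_count[OF this, of 0 1] show False by (simp add: mf algebra_simps)
  qed
  define K where "K w = sum_list (map m w)" for w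
  \<comment> \<open>By the Leibniz rule each letter \<open>b\<close> can absorb at most
    \<open>m b\<close> of the \<open>k\<close> steps; for \<open>k = K w\<close> there is exactly
    one way to distribute them, for larger \<open>k\<close> none.\<close>
  have top: "?e k (single w 1) = (if k = K w then word_eval \<xi> w else 0)" if "K w \<le> k" for k w
    using that
  proof (induction w arbitrary: k)
    case Nil
    then show ?case
    proof (cases k)
      case (Suc n)
      have "(?d ^^ Suc n) (single [] 1) = 0"
        by (simp add: funpow_Suc_right zero_list_def[symmetric] assoc_der.const assoc_der.iter_zero del: funpow.simps single_one)
      then show ?thesis using Suc by (simp add: K_def assoc_der.divided_power_eq_zero_iff del: funpow.simps)
    qed (simp add: K_def single_Nil_one)
  next
    case (Cons b w)
    have K: "K (b # w) = m b + K w" by (simp add: K_def)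
    have "single (b # w) 1 = ?x b * single w 1"
      by (simp add: mult_single plus_list_def)
    then have "?e k (single (b # w) 1) = (\<Sum>i\<le>k. ?e i (?x b) * ?e (k - i) (single w 1))"
      by (simp add: assoc_der.divided_power_mult)
    also have "\<dots> = (\<Sum>i\<le>k. if i = m b then \<xi> b * ?e (k - m b) (single w 1) else 0)"
    proof (rule sum.cong[OF HOL.refl])
      fix i assume "i \<in> {..k}"
      consider "i < m b" | "i = m b" | "m b < i" by linarith
      then show "?e i (?x b) * ?e (k - i) (single w 1) =
          (if i = m b then \<xi> b * ?e (k - m b) (single w 1) else 0)"
        using above[of b i] Cons.IH[of "k - i"] Cons.prems K by cases (auto simp: \<xi>_def)
    qed
    also have "\<dots> = \<xi> b * ?e (k - m b) (single w 1)"
      using Cons.prems K by simp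
    finally show ?case using Cons.IH[of "k - m b"] Cons.prems K by auto
  qed
  obtain w0 where w0: "w0 \<in> keys (g c)" using \<open>g c \<noteq> 0\<close> by (metis ex_in_conv keys_eq_empty)
  \<comment> \<open>\<open>K\<close> depends only on the content of a word, and all words of
    \<open>g c\<close> have the same content.\<close>
  have Kw: "K w = K w0" if "w \<in> keys (g c)" for w
  proof -
    have "mset (map m w) = mset (map m w0)" using keys[OF that] keys[OF w0] by simp
    then show ?thesis unfolding K_def by (metis sum_mset_sum_list)
  qed
  have "c \<in> set w0" using keys[OF w0] by (metis add_mset_add_single set_mset_mset union_commute union_single_eq_member)
  then have "m c \<le> K w0" unfolding K_def by (simp add: member_le_sum_list)
  have "?e (K w0) (g c) = (\<Sum>w\<in>keys (g c). single 0 (lookup (g c) w) * word_eval \<xi> w)"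
  proof -
    have dsum: "?e n (sum F A) = (\<Sum>i\<in>A. ?e n (F i))" for n F and A :: "2 list set"
      by (induction A rule: infinite_finite_induct) (simp_all add: assoc_der.divided_power_zero assoc_der.divided_power_add)
    have "?e (K w0) (g c) = ?e (K w0) (\<Sum>w\<in>keys (g c). single 0 (lookup (g c) w) * single w 1)"
      by (simp add: mult_single poly_mapping_sum_single)
    also have "\<dots> = (\<Sum>w\<in>keys (g c). single 0 (lookup (g c) w) * word_eval \<xi> w)"
      unfolding dsum assoc_der.divided_power_scalar_mult by (intro sum.cong) (auto simp: top Kw)
    finally show ?thesis .
  qed
  also have "\<dots> \<noteq> 0" by (rule assoc_eval_nonzero[OF \<open>g c \<noteq> 0\<close> keys f comm])
  finally have "?e (K w0) (g c) \<noteq> 0" .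
  moreover have "g c = ?d (?x c)" by (simp add: assoc_der_single single_Nil_one)
  then have "?e (K w0) (g c) = 0"
    using above[of c "Suc (K w0)"] \<open>m c \<le> K w0\<close> by (simp add: assoc_der.divided_power_der)
  ultimately show False by simp
qed

section \<open>Locally nilpotent derivations\<close>

text \<open>
  The weights \<open>1\<close> and \<open>\<surd>2\<close> of the two generators are chosen so that the weight of a monomial
  determines its content.
\<close>

definition weight :: "2 multiset \<Rightarrow> real" where
  "weight M = real (count M 0) + real (count M 1) * sqrt 2"

lemma weight_add: "weight (M + N) = weight M + weight N"
  by (simp add: weight_def algebra_simps)

text \<open>The exponent of \<open>2\<close> is even in the square of \<open>a\<close> and odd in
  twice the square of \<open>b\<close>.\<close>

lemma sqrt2_independent:
  assumes "real_of_int a + real_of_int b * sqrt 2 = 0"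
  shows "a = 0 \<and> b = 0"
proof (rule ccontr)
  assume *: "\<not> ?thesis"
  have "b \<noteq> 0" using * assms by auto
  have "real_of_int a = - (real_of_int b * sqrt 2)" using assms by simp
  then have "(real_of_int a)\<^sup>2 = 2 * (real_of_int b)\<^sup>2" by (simp add: power_mult_distrib)
  then have "real_of_int (a\<^sup>2) = real_of_int (2 * b\<^sup>2)" by simp
  then have sq: "a\<^sup>2 = 2 * b\<^sup>2" by linarith
  have "2 * multiplicity 2 a = multiplicity 2 (a\<^sup>2)"
    using sq \<open>b \<noteq> 0\<close> by (subst prime_elem_multiplicity_power_distrib) auto
  also have "\<dots> = Suc (2 * multiplicity 2 b)"
    using \<open>b \<noteq> 0\<close> by (simp add: sq prime_elem_multiplicity_mult_distrib prime_elem_multiplicity_power_distrib)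
  finally show False by presburger
qed

lemma multiset_2_eqI:
  assumes "count M 0 = count N 0" "count M 1 = count N 1"
  shows "M = (N :: 2 multiset)"
proof (rule multiset_eqI)
  fix x
  show "count M x = count N x" using two_cases[of "0 :: 2" 1 x] assms by auto
qed

lemma weight_inject:
  assumes "weight M - weight N = weight M' - weight N'"
  shows "M + N' = M' + N"
proof -
  have "real_of_int (int (count M 0) - int (count N 0) - int (count M' 0) + int (count N' 0)) +
      real_of_int (int (count M 1) - int (count N 1) - int (count M' 1) + int (count N' 1)) * sqrt 2 = 0"
    using assms by (simp add: weight_def algebra_simps)
  from sqrt2_independent[OF this] show ?thesis
    by (intro multiset_2_eqI) auto
qed

text \<open>Only single variables are bounded, not monomials; this is why \<open>below L\<close> is
  closed under multiplication.\<close>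

abbreviation below :: "real \<Rightarrow> ('k::field_char_0, 2) free_poisson \<Rightarrow> bool" where
  "below L p \<equiv> (\<forall>e\<in>fp_vars p. weight (basis_content e) \<le> L)"

text \<open>The differential of \<open>p\<close> at the point \<open>\<rho>\<close>, restricted to
  variables of weight \<open>L\<close> and mapped to the free associative algebra. Like a tangent
  vector it obeys a Leibniz rule over evaluation at \<open>\<rho>\<close>, see
  \<open>top_part_mult\<close>.\<close>

definition top_part :: "(('k::field_char_0, 2) lie_basis \<Rightarrow> 'k) \<Rightarrow> real \<Rightarrow> ('k, 2) free_poisson \<Rightarrow> ('k, 2) free_assoc" where
  "top_part \<rho> L p = (\<Sum>e\<in>fp_vars p. if weight (basis_content e) = L
     then single 0 (fp_eval \<rho> (fp_pderiv e p)) * lie_assoc (Rep_lie_basis e) else 0)"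

lemma top_part_superset:
  assumes "finite A" "fp_vars p \<subseteq> A"
  shows "top_part \<rho> L p = (\<Sum>e\<in>A. if weight (basis_content e) = L
     then single 0 (fp_eval \<rho> (fp_pderiv e p)) * lie_assoc (Rep_lie_basis e) else 0)"
  unfolding top_part_def using assms
  by (intro sum.mono_neutral_left) (auto simp: fp_pderiv_not_in_vars fp_eval.zero)

lemma top_part_add: "top_part \<rho> L (p + q) = top_part \<rho> L p + top_part \<rho> L q"
  using fp_vars_add[of p q]
  by (simp add: top_part_superset[of "fp_vars p \<union> fp_vars q"] sum.distrib[symmetric] fp_pderiv_add
      fp_eval.add single_add distrib_right if_distrib cong: if_cong sum.cong)

lemma top_part_zero: "top_part \<rho> L 0 = 0"
  by (simp add: top_part_def)

lemma top_part_sum: "top_part \<rho> L (sum f A) = (\<Sum>i\<in>A. top_part \<rho> L (f i))"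
  by (induction A rule: infinite_finite_induct) (simp_all add: top_part_zero top_part_add)

lemma top_part_mult:
  "top_part \<rho> L (p * q) = single 0 (fp_eval \<rho> p) * top_part \<rho> L q +
     single 0 (fp_eval \<rho> q) * top_part \<rho> L p"
proof -
  let ?A = "fp_vars p \<union> fp_vars q"
  have "top_part \<rho> L (p * q) = (\<Sum>e\<in>?A. if weight (basis_content e) = L
     then single 0 (fp_eval \<rho> (fp_pderiv e (p * q))) * lie_assoc (Rep_lie_basis e) else 0)"
    using fp_vars_mult[of p q] by (intro top_part_superset) auto
  also have "\<dots> = (\<Sum>e\<in>?A. single 0 (fp_eval \<rho> p) * (if weight (basis_content e) = L
     then single 0 (fp_eval \<rho> (fp_pderiv e q)) * lie_assoc (Rep_lie_basis e) else 0) +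
     single 0 (fp_eval \<rho> q) * (if weight (basis_content e) = L
     then single 0 (fp_eval \<rho> (fp_pderiv e p)) * lie_assoc (Rep_lie_basis e) else 0))"
    by (intro sum.cong) (auto simp: fp_pderiv_mult fp_eval.add fp_eval.mult single_add distrib_right
        mult.assoc[symmetric] mult_single mult.commute)
  also have "\<dots> = single 0 (fp_eval \<rho> p) * top_part \<rho> L q +
     single 0 (fp_eval \<rho> q) * top_part \<rho> L p"
    by (simp only: sum.distrib sum_distrib_left[symmetric] top_part_superset[of ?A q]
        top_part_superset[of ?A p] finite_Un finite_fp_vars Un_upper1 Un_upper2)
  finally show ?thesis .
qed

lemma top_part_below: "below K p \<Longrightarrow> K < L \<Longrightarrow> top_part \<rho> L p = 0"
  unfolding top_part_def by (intro sum.neutral) auto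

lemma below_mult: "below L p \<Longrightarrow> below L q \<Longrightarrow> below L (p * q)"
  using fp_vars_mult by fast

lemma below_add: "below L p \<Longrightarrow> below L q \<Longrightarrow> below L (p + q)"
  using fp_vars_add by fast

lemma below_sum: "(\<And>i. i \<in> A \<Longrightarrow> below L (f i)) \<Longrightarrow> below L (sum f A)"
  using fp_vars_sum[of f A] by fast

lemma below_mono: "below K p \<Longrightarrow> K \<le> L \<Longrightarrow> below L p"
  by fastforce

lemma below_pderiv: "below L p \<Longrightarrow> below L (fp_pderiv e p)"
  using fp_vars_pderiv by fast

lemma below_lie_content: "lie_content u M \<Longrightarrow> below (weight M) (fp_of_lie u)"
  using content_unique by fastforce

text \<open>A Lie element is linear in the basis variables, so its partial derivatives are scalars
  and its differential at any point gives back the element.\<close>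

lemma sum_lie_assoc:
  fixes u :: "('k::field_char_0, 2) free_lie"
  shows "(\<Sum>e\<in>fp_vars (fp_of_lie u). single 0 (fp_eval \<rho> (fp_pderiv e (fp_of_lie u))) *
    lie_assoc (Rep_lie_basis e)) = lie_assoc u"
proof (induction u rule: lie_induct_basis)
  case zero
  show ?case by simp
next
  case (step c d u)
  let ?F = "\<lambda>e p. single 0 (fp_eval \<rho> (fp_pderiv e p)) * lie_assoc (Rep_lie_basis e)"
  have sup: "(\<Sum>e\<in>fp_vars p. ?F e p) = (\<Sum>e\<in>A. ?F e p)" if "finite A" "fp_vars p \<subseteq> A" for A p
    using that by (intro sum.mono_neutral_left) (auto simp: fp_pderiv_not_in_vars fp_eval.zero)
  let ?A = "insert d (fp_vars (fp_of_lie u))"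
  let ?p = "fp_of_lie (lie_scale c (Rep_lie_basis d) + u)"
  have p: "?p = fp_scale c (fp_basis_var d) + fp_of_lie u"
    by (simp add: fp_of_lie_add fp_of_lie_scale fp_of_lie_basis)
  have "fp_vars ?p \<subseteq> ?A"
    unfolding p using fp_vars_add fp_vars_scale fp_vars_basis_var by fast
  then have "(\<Sum>e\<in>fp_vars ?p. ?F e ?p) = (\<Sum>e\<in>?A. ?F e ?p)" by (intro sup) auto
  also have "\<dots> = (\<Sum>e\<in>?A. (if e = d then single 0 c * lie_assoc (Rep_lie_basis d) else 0) + ?F e (fp_of_lie u))"
    unfolding p by (intro sum.cong)
      (auto simp: fp_pderiv_add fp_pderiv_scale fp_pderiv_var fp_eval.add fp_eval.scale fp_eval.one
        fp_eval.zero single_add distrib_right)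
  also have "\<dots> = lie_assoc (lie_scale c (Rep_lie_basis d) + u)"
    unfolding sum.distrib by (subst sup[of ?A, symmetric]) (auto simp: step)
  finally show ?case .
qed

lemma top_part_lie_content:
  assumes "lie_content u M"
  shows "top_part \<rho> L (fp_of_lie u) = (if weight M = L then lie_assoc u else 0)"
  using content_unique[OF assms] sum_lie_assoc[where u = u and \<rho> = \<rho>]
  by (auto simp: top_part_def cong: sum.cong)

text \<open>A variable of weight \<open>a + b\<close> can only come from the bracket of two basis
  elements: the coefficients stay below \<open>max a b\<close>, which is less than
  \<open>a + b\<close> because both bounds are positive. So the top part sees the coefficients as
  scalars and the bracket as a commutator.\<close>

lemma below_br:
  assumes "below a p" "below b q" "0 < a" "0 < b"
  shows "below (a + b) (fp_br p q)"
    and "top_part \<rho> (a + b) (fp_br p q) = top_part \<rho> a p * top_part \<rho> b q - top_part \<rho> b q * top_part \<rho> a p"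
proof -
  let ?P = "\<lambda>d. if weight (basis_content d) = a then single 0 (fp_eval \<rho> (fp_pderiv d p)) * lie_assoc (Rep_lie_basis d) else 0"
  let ?Q = "\<lambda>e. if weight (basis_content e) = b then single 0 (fp_eval \<rho> (fp_pderiv e q)) * lie_assoc (Rep_lie_basis e) else 0"
  let ?br = "\<lambda>d e. lie_br (Rep_lie_basis d) (Rep_lie_basis e)"
  have basis_content: "lie_content (?br d e) (basis_content d + basis_content e)" for d e :: "('a, 2) lie_basis"
    by (intro lie_content.br lie_content_content)
  have le: "weight (basis_content d) \<le> a" "weight (basis_content e) \<le> b" if "d \<in> fp_vars p" "e \<in> fp_vars q" for d e
    using that assms by auto
  have coeff: "below (max a b) (fp_pderiv d p * fp_pderiv e q)" for d e
    using assms by (intro below_mult below_pderiv) auto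
  have "below (a + b) (fp_pderiv d p * fp_pderiv e q * fp_of_lie (?br d e))"
    if "d \<in> fp_vars p" "e \<in> fp_vars q" for d e
    using le[OF that] assms
    by (intro below_mult[OF below_mono[OF coeff] below_mono[OF below_lie_content[OF basis_content]]])
      (auto simp: weight_add)
  then show "below (a + b) (fp_br p q)"
    unfolding fp_br_def by (intro below_sum) auto
  have summand: "top_part \<rho> (a + b) (fp_pderiv d p * fp_pderiv e q * fp_of_lie (?br d e)) =
      ?P d * ?Q e - ?Q e * ?P d"
    (is "?l = ?r")
    if "d \<in> fp_vars p" "e \<in> fp_vars q" for d e
  proof -
    have "?l = single 0 (fp_eval \<rho> (fp_pderiv d p) * fp_eval \<rho> (fp_pderiv e q)) *
        (if weight (basis_content d) + weight (basis_content e) = a + b then lie_assoc (?br d e) else 0)"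
      using top_part_below[OF coeff[of d e], of "a + b" \<rho>] assms
      by (subst top_part_mult) (simp add: top_part_lie_content[OF basis_content] weight_add fp_eval.mult)
    also have "(weight (basis_content d) + weight (basis_content e) = a + b) = (weight (basis_content d) = a \<and> weight (basis_content e) = b)"
      using le[OF that] by auto
    also have "single 0 (fp_eval \<rho> (fp_pderiv d p) * fp_eval \<rho> (fp_pderiv e q)) =
        single 0 (fp_eval \<rho> (fp_pderiv d p)) * single (0 :: 2 list) (fp_eval \<rho> (fp_pderiv e q))"
      by (simp add: mult_single)
    also have "\<dots> * (if weight (basis_content d) = a \<and> weight (basis_content e) = b then lie_assoc (?br d e) else 0) = ?r"
    proof -
      have comm: "single (0 :: 2 list) x * (single 0 y * z) = single 0 y * (single 0 x * z)"
        for x y :: 'a and z by (rule free_assoc_scalar_left_commute)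
      show ?thesis
        by (simp add: right_diff_distrib mult.assoc free_assoc_scalar_left_commute[of "lie_assoc _"] comm)
    qed
    finally show ?thesis .
  qed
  have "top_part \<rho> (a + b) (fp_br p q) = (\<Sum>d\<in>fp_vars p. \<Sum>e\<in>fp_vars q.
      top_part \<rho> (a + b) (fp_pderiv d p * fp_pderiv e q * fp_of_lie (?br d e)))"
    unfolding fp_br_def by (simp only: top_part_sum)
  also have "\<dots> = (\<Sum>d\<in>fp_vars p. \<Sum>e\<in>fp_vars q. ?P d * ?Q e - ?Q e * ?P d)"
    by (intro sum.cong) (simp_all add: summand)
  also have "\<dots> = (\<Sum>d\<in>fp_vars p. \<Sum>e\<in>fp_vars q. ?P d * ?Q e) - (\<Sum>e\<in>fp_vars q. \<Sum>d\<in>fp_vars p. ?Q e * ?P d)"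
    unfolding sum_subtractf by (subst sum.swap[of _ "fp_vars p" "fp_vars q"]) (rule HOL.refl)
  also have "\<dots> = top_part \<rho> a p * top_part \<rho> b q - top_part \<rho> b q * top_part \<rho> a p"
    unfolding top_part_def[of \<rho> a p] top_part_def[of \<rho> b q] sum_product by (rule HOL.refl)
  finally show "top_part \<rho> (a + b) (fp_br p q) = top_part \<rho> a p * top_part \<rho> b q - top_part \<rho> b q * top_part \<rho> a p" .
qed

lemma weight_pos: "lie_content u M \<Longrightarrow> 0 < weight M"
proof (induction rule: lie_content.induct)
  case (gen x)
  show ?case using two_cases[of 0 1 x] by (auto simp: weight_def)
qed (simp add: weight_add)

text \<open>
  Up to factors of smaller weight, a derivation raising weights by at most \<open>N\<close> acts on the factors
  of largest weight as the derivation of the free associative algebra with values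
  \<open>top_part \<rho> (weight {#c#} + N) (d (fp_gen c))\<close>.
\<close>

lemma top_part_derivation:
  fixes d :: "('k::field_char_0, 2) free_poisson \<Rightarrow> ('k, 2) free_poisson"
    and \<rho> :: "('k, 2) lie_basis \<Rightarrow> 'k"
  assumes "poisson_der d" and N: "0 < N" "\<And>c. below (weight {#c#} + N) (d (fp_gen c))"
  defines "\<delta> \<equiv> assoc_der (\<lambda>c. top_part \<rho> (weight {#c#} + N) (d (fp_gen c)))"
  assumes p: "below L p"
  shows "below (L + N) (d p)" "top_part \<rho> (L + N) (d p) = \<delta> (top_part \<rho> L p)"
proof -
  interpret d: poisson_der d by fact
  have minus: "\<delta> (a - b) = \<delta> a - \<delta> b" for a b
    using assoc_der.add[of _ "a - b" b] by (simp add: \<delta>_def algebra_simps)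
  have mon: "below (weight M + N) (d (fp_of_lie u)) \<and>
      top_part \<rho> (weight M + N) (d (fp_of_lie u)) = \<delta> (lie_assoc u)" if "lie_content u M" for u M
    using that
  proof (induction rule: lie_content.induct)
    case (gen x)
    show ?case
      using N(2)[of x] by (simp add: fp_gen_def[symmetric] \<delta>_def assoc_der_single single_Nil_one)
  next
    case (br u M v M')
    let ?u = "fp_of_lie u" and ?v = "fp_of_lie v"
    note uv = weight_pos[OF br.hyps(1)] weight_pos[OF br.hyps(2)]
      below_lie_content[OF br.hyps(1)] below_lie_content[OF br.hyps(2)]
    have eq: "weight (M + M') + N = (weight M + N) + weight M'" "weight (M + M') + N = weight M + (weight M' + N)"
      by (simp_all add: weight_add)
    note 1 = below_br[where a = "weight M + N" and p = "d ?u" and b = "weight M'" and q = ?v, folded eq(1)]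
    note 2 = below_br[where a = "weight M" and p = ?u and b = "weight M' + N" and q = "d ?v", folded eq(2)]
    have d: "d (fp_of_lie (lie_br u v)) = fp_br (d ?u) ?v + fp_br ?u (d ?v)"
      by (simp add: fp_br_of_lie[symmetric] d.br)
    have "below (weight (M + M') + N) (d (fp_of_lie (lie_br u v)))"
      unfolding d using 1(1) 2(1) uv br.IH N by (intro below_add) auto
    moreover have "top_part \<rho> (weight (M + M') + N) (d (fp_of_lie (lie_br u v))) = \<delta> (lie_assoc (lie_br u v))"
      unfolding d top_part_add using 1(2)[of \<rho>] 2(2)[of \<rho>] uv br.IH N
      by (simp add: top_part_lie_content[OF br.hyps(1)] top_part_lie_content[OF br.hyps(2)] minus)
        (simp add: \<delta>_def assoc_der.mult)
    ultimately show ?case by simp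
  qed
  have e: "below (weight (basis_content e) + N) (d (fp_basis_var e))"
    "top_part \<rho> (weight (basis_content e) + N) (d (fp_basis_var e)) = \<delta> (lie_assoc (Rep_lie_basis e))" for e
    using mon[OF lie_content_content[of e]] by (simp_all add: fp_of_lie_basis)
  have dp: "d p = (\<Sum>e\<in>fp_vars p. fp_pderiv e p * d (fp_basis_var e))"
    by (rule d.chain_rule) simp_all
  have le: "weight (basis_content e) \<le> L" if "e \<in> fp_vars p" for e using p that by blast
  \<comment> \<open>As \<open>N\<close> is positive, these coefficients have top part zero at
    \<open>L + N\<close> and contribute only their values at \<open>\<rho>\<close>.\<close>
  have pd: "below L (fp_pderiv e p)" for e by (rule below_pderiv[OF p])
  have "below (L + N) (fp_pderiv e p * d (fp_basis_var e))" if "e \<in> fp_vars p" for e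
    using le[OF that] N(1) by (intro below_mult[OF below_mono[OF pd] below_mono[OF e(1)]]) auto
  then show "below (L + N) (d p)" unfolding dp by (intro below_sum)
  have summand: "top_part \<rho> (L + N) (fp_pderiv e p * d (fp_basis_var e)) =
      (if weight (basis_content e) = L then single 0 (fp_eval \<rho> (fp_pderiv e p)) * \<delta> (lie_assoc (Rep_lie_basis e)) else 0)"
    if "e \<in> fp_vars p" for e
  proof -
    have "top_part \<rho> (L + N) (d (fp_basis_var e)) = 0" if "weight (basis_content e) \<noteq> L"
      using that le[OF \<open>e \<in> fp_vars p\<close>] by (intro top_part_below[OF e(1)[of e]]) auto
    then show ?thesis
      using e(2)[of e] by (auto simp: top_part_mult top_part_below[OF pd] N(1))
  qed
  have "top_part \<rho> (L + N) (d p) = (\<Sum>e\<in>fp_vars p. if weight (basis_content e) = L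
      then single 0 (fp_eval \<rho> (fp_pderiv e p)) * \<delta> (lie_assoc (Rep_lie_basis e)) else 0)"
    unfolding dp top_part_sum by (intro sum.cong) (auto simp: summand)
  also have "\<dots> = \<delta> (top_part \<rho> L p)"
    unfolding top_part_def \<delta>_def assoc_der.sum
    by (intro sum.cong) (auto simp: assoc_der.scalar_mult assoc_der.zero)
  finally show "top_part \<rho> (L + N) (d p) = \<delta> (top_part \<rho> L p)" .
qed

text \<open>If some value involves a bracket, the largest rise \<open>N\<close> of weight on the
  generators is at least \<open>1\<close> and is attained by a bracket \<open>e0\<close>. With
  \<open>\<rho>\<close> chosen so that the coefficient of \<open>e0\<close> survives, the top parts
  of the iterates follow a homogeneous derivation of the free associative algebra that is nilpotent
  on the letters and yet nonzero.\<close>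

lemma locally_nilpotent_poisson_der:
  fixes d :: "('k::field_char_0, 2) free_poisson \<Rightarrow> ('k, 2) free_poisson"
  assumes der: "poisson_der d" and nil: "\<And>c. algebra_der.nilp d (fp_gen c)"
  shows "fp_vars (d (fp_gen c)) \<subseteq> range gen_var"
proof (rule ccontr)
  assume "\<not> ?thesis"
  then obtain e1 where e1: "e1 \<in> fp_vars (d (fp_gen c))" "e1 \<notin> range gen_var" by blast
  interpret d: poisson_der d by (rule der)
  define S where "S = (\<Union>b. (\<lambda>e. weight (basis_content e) - weight {#b#}) ` fp_vars (d (fp_gen b)))"
  define N where "N = Max S"
  have UNIV2: "(UNIV :: 2 set) = {0, 1}" using two_cases[of "0 :: 2" 1] by auto
  have S: "finite S" by (simp add: S_def UNIV2)
  have "weight (basis_content e1) - weight {#c#} \<in> S" using e1(1) by (auto simp: S_def)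
  with S have S: "finite S" "S \<noteq> {}" by auto
  have N_ge: "weight (basis_content e) - weight {#b#} \<le> N" if "e \<in> fp_vars (d (fp_gen b))" for e b
    unfolding N_def using S that by (intro Max_ge) (auto simp: S_def)
  have "N \<in> S" unfolding N_def using S by (rule Max_in)
  then obtain b0 e0 where e0: "e0 \<in> fp_vars (d (fp_gen b0))" "N = weight (basis_content e0) - weight {#b0#}"
    by (auto simp: S_def)
  obtain x y where xy: "x \<noteq> y" "x \<in># basis_content e1" "y \<in># basis_content e1" using not_gen_var[OF e1(2)] by metis
  have "z \<in># basis_content e1" for z using xy two_cases[OF xy(1), of z] by auto
  then have "1 \<le> count (basis_content e1) 0" "1 \<le> count (basis_content e1) 1" by simp_all
  \<comment> \<open>A bracket contains both letters, while a generator weighs at most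
    \<open>sqrt 2\<close>.\<close>
  then have "1 + sqrt 2 \<le> weight (basis_content e1)" unfolding weight_def by (intro add_mono) auto
  moreover have "weight {#c#} \<le> sqrt 2" using two_cases[of "0 :: 2" 1 c] by (auto simp: weight_def)
  ultimately have N1: "1 \<le> N" using N_ge[OF e1(1)] by linarith
  \<comment> \<open>A generator in place of \<open>e0\<close> would mean a rise of at most
    \<open>sqrt 2 - 1\<close>, which is less than \<open>1\<close>.\<close>
  have "e0 \<notin> range gen_var"
  proof
    assume "e0 \<in> range gen_var"
    then obtain z where "e0 = gen_var z" by blast
    then have "N \<le> sqrt 2 - 1"
      using e0(2) two_cases[of "0 :: 2" 1 z] two_cases[of "0 :: 2" 1 b0] by (auto simp: weight_def)
    moreover have "sqrt 2 < 2" by (rule real_less_lsqrt) auto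
    ultimately show False using N1 by linarith
  qed
  then obtain x' y' where xy': "x' \<noteq> y'" "x' \<in># basis_content e0" "y' \<in># basis_content e0" using not_gen_var by metis
  \<comment> \<open>Both letters occur in \<open>e0\<close>, in particular \<open>b0\<close>; hence
    the rise \<open>N\<close> is itself the weight of a multiset.\<close>
  have "b0 \<in># basis_content e0" using xy' two_cases[OF xy'(1), of b0] by auto
  then obtain M where M: "basis_content e0 = {#b0#} + M" by (metis multi_member_split add_mset_add_single union_commute)
  have N: "N = weight M" unfolding e0(2) M weight_add by simp
  obtain \<rho> where \<rho>: "fp_eval \<rho> (fp_pderiv e0 (d (fp_gen b0))) \<noteq> 0"
    using fp_pderiv_nonzero[OF e0(1)] fp_eval_nonzero2 by metis
  define g where "g b = top_part \<rho> (weight {#b#} + N) (d (fp_gen b))" for b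
  have below: "below (weight {#b#} + N) (d (fp_gen b))" for b using N_ge by (auto simp: algebra_simps)
  note top = top_part_derivation(1)[OF der _ below] top_part_derivation(2)[where \<rho> = \<rho>, OF der _ below, folded g_def]
  have keys: "mset w = {#b#} + M" if "w \<in> keys (g b)" for b w
  proof -
    let ?t = "\<lambda>e. if weight (basis_content e) = weight {#b#} + N
      then single 0 (fp_eval \<rho> (fp_pderiv e (d (fp_gen b)))) * lie_assoc (Rep_lie_basis e) else 0"
    have "w \<in> (\<Union>e\<in>fp_vars (d (fp_gen b)). keys (?t e))"
      using that keys_sum[of ?t "fp_vars (d (fp_gen b))"] unfolding g_def top_part_def by blast
    then obtain e where "w \<in> keys (?t e)" by blast
    then have e: "weight (basis_content e) = weight {#b#} + N"
      "w \<in> keys (single 0 (fp_eval \<rho> (fp_pderiv e (d (fp_gen b)))) * lie_assoc (Rep_lie_basis e))"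
      by (auto split: if_splits)
    then have "w \<in> keys (lie_assoc (Rep_lie_basis e))" by (auto simp: in_keys_iff lookup_scalar_mult)
    then have "mset w = basis_content e" by (rule keys_lie_assoc[OF lie_content_content])
    moreover have "basis_content e + {#} = {#b#} + M + {#}"
      by (rule weight_inject) (simp only: e(1) N weight_add)
    ultimately show ?thesis by simp
  qed
  have iter: "below (weight {#b#} + real n * N) ((d ^^ n) (fp_gen b)) \<and>
      top_part \<rho> (weight {#b#} + real n * N) ((d ^^ n) (fp_gen b)) = (assoc_der g ^^ n) (single [b] 1)" for b n
  proof (induction n)
    case 0
    show ?case
      using below_lie_content[OF lie_content.gen[of b, where ?'k = 'k]]
        top_part_lie_content[OF lie_content.gen[of b, where ?'k = 'k], where \<rho> = \<rho> and L = "weight {#b#}"]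
      by (simp add: fp_gen_def)
  next
    case (Suc n)
    have eq: "weight {#b#} + real (Suc n) * N = weight {#b#} + real n * N + N" by (simp add: algebra_simps)
    show ?case unfolding eq using top[where L = "weight {#b#} + real n * N" and p = "(d ^^ n) (fp_gen b)"] Suc N1
      by (simp add: g_def)
  qed
  have "\<exists>n. (assoc_der g ^^ n) (single [b] 1) = 0" for b
    using nil[of b] iter[where b = b] by (metis d.nilp_def top_part_zero)
  from nilpotent_assoc_der_zero[OF keys this] have "g b0 = 0" .
  \<comment> \<open>\<open>g b0\<close> is the image of a Lie element whose coefficient at
    \<open>e0\<close> is nonzero by the choice of \<open>\<rho>\<close>, and
    \<open>lie_assoc\<close> does not kill such an element.\<close>
  moreover have "g b0 \<noteq> 0"
  proof -
    define A where "A = {e \<in> fp_vars (d (fp_gen b0)). weight (basis_content e) = weight {#b0#} + N}"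
    define u where "u = (\<Sum>e\<in>A. lie_scale (fp_eval \<rho> (fp_pderiv e (d (fp_gen b0)))) (Rep_lie_basis e))"
    have fin: "finite A" by (simp add: A_def)
    have sums: "lie_assoc (sum f B) = (\<Sum>i\<in>B. lie_assoc (f i))" "fp_of_lie (sum f B) = (\<Sum>i\<in>B. fp_of_lie (f i))"
      for f and B :: "('k, 2) lie_basis set"
      by (induction B rule: infinite_finite_induct) (simp_all add: fp_of_lie_add)
    have "g b0 = lie_assoc u"
      unfolding g_def top_part_def u_def sums A_def lie_assoc_simps
      by (rule sum.inter_filter[symmetric]) simp
    moreover have "fp_pderiv e0 (fp_of_lie u) = single 0 (fp_eval \<rho> (fp_pderiv e0 (d (fp_gen b0))))"
    proof -
      have "fp_pderiv e0 (fp_of_lie u) = (\<Sum>e\<in>A. if e = e0 then single 0 (fp_eval \<rho> (fp_pderiv e0 (d (fp_gen b0)))) else 0)"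
        unfolding u_def sums fp_pderiv_sum
        by (intro sum.cong) (auto simp: fp_of_lie_scale fp_of_lie_basis fp_pderiv_scale fp_pderiv_var fp_scale_const)
      then show ?thesis using fin e0 by (simp add: A_def)
    qed
    then have "e0 \<in> fp_vars (fp_of_lie u)" using \<rho> fp_pderiv_not_in_vars[of e0 "fp_of_lie u"]
      by (metis lookup_single_eq lookup_zero)
    ultimately show ?thesis using lie_assoc_nonzero by metis
  qed
  ultimately show False by simp
qed

section \<open>Weighted degrees\<close>

definition wdeg :: "('e \<Rightarrow> int) \<Rightarrow> ('e \<Rightarrow>\<^sub>0 nat) \<Rightarrow> int" where
  "wdeg \<omega> m = (\<Sum>e\<in>keys m. int (lookup m e) * \<omega> e)"

lemma wdeg_superset:
  assumes "finite A" "keys m \<subseteq> A"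
  shows "wdeg \<omega> m = (\<Sum>e\<in>A. int (lookup m e) * \<omega> e)"
  unfolding wdeg_def using assms by (intro sum.mono_neutral_left) (auto simp: in_keys_iff)

lemma wdeg_add: "wdeg \<omega> (m + n) = wdeg \<omega> m + wdeg \<omega> n"
  using keys_add[of m n]
  by (simp add: wdeg_superset[of "keys m \<union> keys n"] lookup_add distrib_right sum.distrib)

lemma wdeg_zero [simp]: "wdeg \<omega> 0 = 0"
  by (simp add: wdeg_def)

lemma wdeg_single [simp]: "wdeg \<omega> (single e n) = int n * \<omega> e"
  by (subst wdeg_superset[of "{e}"]) auto

text \<open>A predicate on degrees rather than a bound, so that homogeneous elements, strict bounds
  and weak bounds share one calculus.\<close>

definition degs :: "('e \<Rightarrow> int) \<Rightarrow> (int \<Rightarrow> bool) \<Rightarrow> (('e \<Rightarrow>\<^sub>0 nat) \<Rightarrow>\<^sub>0 'k::zero) \<Rightarrow> bool" where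
  "degs \<omega> R p \<longleftrightarrow> (\<forall>m\<in>keys p. R (wdeg \<omega> m))"

lemma degs_mono: "degs \<omega> R p \<Longrightarrow> (\<And>i. R i \<Longrightarrow> S i) \<Longrightarrow> degs \<omega> S p"
  by (auto simp: degs_def)

lemma degs_zero [simp]: "degs \<omega> R 0"
  by (simp add: degs_def)

lemma degs_add: "degs \<omega> R p \<Longrightarrow> degs \<omega> R q \<Longrightarrow> degs \<omega> R (p + q)"
  using keys_add[of p q] by (auto simp: degs_def)

lemma degs_uminus: "degs \<omega> R (- p) \<longleftrightarrow> degs \<omega> R (p :: _ \<Rightarrow>\<^sub>0 'k::ab_group_add)"
  by (simp add: degs_def in_keys_iff)

lemma degs_diff: "degs \<omega> R p \<Longrightarrow> degs \<omega> R q \<Longrightarrow> degs \<omega> R (p - q :: _ \<Rightarrow>\<^sub>0 'k::ab_group_add)"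
  using degs_add[of \<omega> R p "- q"] by (simp add: degs_uminus)

lemma degs_sum: "(\<And>i. i \<in> A \<Longrightarrow> degs \<omega> R (f i)) \<Longrightarrow> degs \<omega> R (sum f A)"
  by (induction A rule: infinite_finite_induct) (simp_all add: degs_add)

lemma degs_mult:
  assumes "degs \<omega> R p" "degs \<omega> S q" "\<And>i j. R i \<Longrightarrow> S j \<Longrightarrow> T (i + j)"
  shows "degs \<omega> T (p * q)"
  using assms keys_mult[of p q] by (fastforce simp: degs_def wdeg_add)

lemma degs_const: "R 0 \<Longrightarrow> degs \<omega> R (single 0 c)"
  by (simp add: degs_def)

lemma degs_power:
  fixes p :: "('e \<Rightarrow>\<^sub>0 nat) \<Rightarrow>\<^sub>0 'k::comm_ring_1"
  assumes "degs \<omega> (\<lambda>i. i = L) p"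
  shows "degs \<omega> (\<lambda>i. i = int n * L) (p ^ n)"
proof (induction n)
  case 0
  show ?case using degs_const[of "\<lambda>i. i = 0" \<omega> "1 :: 'k"] by simp
next
  case (Suc n)
  show ?case unfolding power_Suc by (rule degs_mult[OF assms Suc]) (simp add: algebra_simps)
qed

lemma degs_var: "R (\<omega> e) \<Longrightarrow> degs \<omega> R (fp_basis_var e)"
  by (auto simp: degs_def fp_basis_var_def)

lemma degs_pderiv: "degs \<omega> R p \<Longrightarrow> degs \<omega> (\<lambda>i. R (i + \<omega> e)) (fp_pderiv e p)"
  using keys_fp_pderiv[of _ e p] by (fastforce simp: degs_def wdeg_add)

definition homog_part :: "('e \<Rightarrow> int) \<Rightarrow> int \<Rightarrow> (('e \<Rightarrow>\<^sub>0 nat) \<Rightarrow>\<^sub>0 'k) \<Rightarrow> (('e \<Rightarrow>\<^sub>0 nat) \<Rightarrow>\<^sub>0 'k::ab_group_add)" where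
  "homog_part \<omega> L p = (\<Sum>m | m \<in> keys p \<and> wdeg \<omega> m = L. single m (lookup p m))"

lemma lookup_homog_part:
  "lookup (homog_part \<omega> L p) m = (if wdeg \<omega> m = L then lookup p m else 0)"
  by (auto simp: homog_part_def lookup_sum lookup_single when_def in_keys_iff)

lemma keys_homog_part: "keys (homog_part \<omega> L p) = {m \<in> keys p. wdeg \<omega> m = L}"
  by (auto simp: in_keys_iff lookup_homog_part split: if_splits)

lemma degs_eq_less_zero:
  assumes "degs \<omega> (\<lambda>i. i = L) p" "degs \<omega> (\<lambda>i. i < L) p"
  shows "p = 0"
proof -
  have "keys p = {}" using assms by (auto simp: degs_def)
  then show ?thesis by simp
qed

section \<open>Hamiltonian derivations in two variables\<close>

definition ham :: "('k::field_char_0, 'x) lie_basis \<Rightarrow> ('k, 'x) lie_basis \<Rightarrow> ('k, 'x) free_poisson \<Rightarrow>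
    ('k, 'x) free_poisson \<Rightarrow> ('k, 'x) free_poisson" where
  "ham u v g p = fp_pderiv u g * fp_pderiv v p - fp_pderiv v g * fp_pderiv u p"

global_interpretation ham: algebra_der "ham u v g" for u v g
  by unfold_locales
    (simp_all add: ham_def fp_pderiv_add fp_pderiv_mult fp_pderiv_not_in_vars algebra_simps)

lemma ham_swap: "ham v u g p = - ham u v g p"
  by (simp add: ham_def)

lemma ham_self: "ham u v g g = 0"
  by (simp add: ham_def mult.commute)

text \<open>The flow \<open>exp(t d)\<close> followed by evaluation at \<open>\<rho>\<close>: local
  nilpotence makes the exponential series a polynomial in \<open>t\<close>, and the Leibniz rule for
  divided powers makes \<open>E\<close> multiplicative.\<close>

lemma integral_curve:
  fixes d :: "('k::field_char_0, 'x) free_poisson \<Rightarrow> ('k, 'x) free_poisson"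
  assumes "algebra_der d" and nil: "\<And>p. algebra_der.nilp d p"
  obtains E where "fp_hom (\<lambda>c. [:c:]) E" "\<And>p. pderiv (E p) = E (d p)" "\<And>p. poly (E p) 0 = fp_eval \<rho> p"
proof -
  interpret algebra_der d by fact
  define E where "E p = Abs_poly (\<lambda>k. fp_eval \<rho> (divided_power d k p))" for p
  have coeff: "coeff (E p) k = fp_eval \<rho> (divided_power d k p)" for p k
  proof -
    obtain n where n: "(d ^^ n) p = 0" using nil[of p] by (auto simp: nilp_def)
    have "divided_power d i p = 0" if "i > n" for i
      using iter_eq_zero_mono[OF n, of i] that by (simp add: divided_power_eq_zero_iff)
    then have "coeff (E p) = (\<lambda>k. fp_eval \<rho> (divided_power d k p))"
      unfolding E_def by (intro coeff_Abs_poly[of n]) (simp add: fp_eval.zero)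
    then show ?thesis by simp
  qed
  show thesis
  proof (rule that[of E])
    show "fp_hom (\<lambda>c. [:c:]) E"
    proof
      fix p q and c :: 'k
      show "E (p + q) = E p + E q"
        by (rule poly_eqI) (simp add: coeff divided_power_add fp_eval.add)
      show "E (p * q) = E p * E q"
        by (rule poly_eqI) (simp add: coeff coeff_mult divided_power_mult fp_eval.sum fp_eval.mult)
      show "E (single 0 c) = [:c:]"
      proof (rule poly_eqI)
        fix k
        have "divided_power d (Suc k) (single 0 c) = 0" for k
          by (simp add: divided_power_def funpow_Suc_right const iter_zero del: funpow.simps)
        then show "coeff (E (single 0 c)) k = coeff [:c:] k"
          by (cases k) (simp_all add: coeff coeff_pCons fp_eval.const fp_eval.zero)
      qed
    qed (simp add: one_pCons)
    show "pderiv (E p) = E (d p)" for p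
    proof (rule poly_eqI)
      fix k
      have "fp_eval \<rho> (of_nat n * q) = of_nat n * fp_eval \<rho> q" for n q
        by (simp add: fp_eval.mult single_of_nat[symmetric] fp_eval.const del: single_of_nat)
      then show "coeff (pderiv (E p)) k = coeff (E (d p)) k"
        by (simp add: coeff_pderiv coeff divided_power_der del: of_nat_Suc)
    qed
    show "poly (E p) 0 = fp_eval \<rho> p" for p
      by (simp add: poly_0_coeff_0 coeff)
  qed
qed

lemma ham_nilp_all:
  assumes "ham.nilp u v g (fp_basis_var u)" "ham.nilp u v g (fp_basis_var v)"
  shows "ham.nilp u v g p"
proof -
  have "ham.nilp u v g (fp_basis_var e)" for e
  proof (cases "e = u \<or> e = v")
    case True
    then show ?thesis using assms by auto
  next
    case False
    then have "(ham u v g ^^ 1) (fp_basis_var e) = 0" by (auto simp: ham_def fp_pderiv_var)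
    then show ?thesis unfolding ham.nilp_def by blast
  qed
  then show ?thesis
    by (induction p rule: fp_induct) (simp_all add: ham.nilp_const ham.nilp_add ham.nilp_mult)
qed

lemma ham_degs:
  assumes "degs \<omega> R g" "degs \<omega> S p" "\<And>i j. R i \<Longrightarrow> S j \<Longrightarrow> T (i + j - \<omega> u - \<omega> v)"
  shows "degs \<omega> T (ham u v g p)"
proof -
  have T: "T (i + j)" if "R (i + a)" "S (j + b)" "a + b = \<omega> u + \<omega> v" for i j a b
  proof -
    have "(i + a) + (j + b) - \<omega> u - \<omega> v = i + j" using that(3) by simp
    then show ?thesis using assms(3)[OF that(1,2)] by (simp only:)
  qed
  show ?thesis
    unfolding ham_def
    by (intro degs_diff degs_mult[OF degs_pderiv[OF assms(1)] degs_pderiv[OF assms(2)]])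
      (erule T, assumption, simp)+
qed

text \<open>On a homogeneous \<open>p\<close>, iterating the leading form gives the part of degree
  \<open>K + n * s\<close> of the iterate of \<open>g\<close>, up to terms of smaller degree. Once
  the latter vanishes, the former is both of this degree and of smaller degree, hence zero.\<close>

lemma ham_homog_part_nilp:
  assumes nil: "\<And>p. ham.nilp u v g p" and L: "\<And>m. m \<in> keys g \<Longrightarrow> wdeg \<omega> m \<le> L"
  shows "ham.nilp u v (homog_part \<omega> L g) p"
proof -
  define W where "W = homog_part \<omega> L g"
  define s where "s = L - \<omega> u - \<omega> v"
  have W: "degs \<omega> (\<lambda>i. i = L) W" by (auto simp: degs_def W_def keys_homog_part)
  have g0: "degs \<omega> (\<lambda>i. i < L) (g - W)"
    using L by (fastforce simp: degs_def W_def in_keys_iff lookup_minus lookup_homog_part split: if_splits)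
  have iter: "degs \<omega> (\<lambda>i. i = K + int n * s) ((ham u v W ^^ n) p) \<and>
      degs \<omega> (\<lambda>i. i < K + int n * s) ((ham u v g ^^ n) p - (ham u v W ^^ n) p)"
    if "degs \<omega> (\<lambda>i. i = K) p" for p K n
  proof (induction n)
    case 0
    then show ?case using that by simp
  next
    case (Suc n)
    define a where "a = (ham u v W ^^ n) p"
    define b where "b = (ham u v g ^^ n) p - a"
    have a: "degs \<omega> (\<lambda>i. i = K + int n * s) a" and b: "degs \<omega> (\<lambda>i. i < K + int n * s) b"
      using Suc by (simp_all add: a_def b_def)
    have "(ham u v g ^^ Suc n) p - (ham u v W ^^ Suc n) p = ham u v g (a + b) - ham u v W a"
      by (simp add: b_def a_def)
    also have "\<dots> = ham u v W b + (ham u v (g - W) a + ham u v (g - W) b)"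
      by (simp add: ham_def fp_pderiv_diff fp_pderiv_add algebra_simps)
    finally have eq: "(ham u v g ^^ Suc n) p - (ham u v W ^^ Suc n) p = \<dots>" .
    have "degs \<omega> (\<lambda>i. i < K + int (Suc n) * s) (ham u v W b)"
      "degs \<omega> (\<lambda>i. i < K + int (Suc n) * s) (ham u v (g - W) a)"
      "degs \<omega> (\<lambda>i. i < K + int (Suc n) * s) (ham u v (g - W) b)"
      by (rule ham_degs[OF W b] ham_degs[OF g0 a] ham_degs[OF g0 b], simp add: s_def algebra_simps)+
    moreover have "degs \<omega> (\<lambda>i. i = K + int (Suc n) * s) (ham u v W a)"
      by (rule ham_degs[OF W a]) (simp add: s_def algebra_simps)
    ultimately show ?case unfolding eq by (simp add: degs_add a_def)
  qed
  have var: "ham.nilp u v W (fp_basis_var e)" for e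
  proof -
    obtain n where n: "(ham u v g ^^ n) (fp_basis_var e) = 0" using nil by (auto simp: ham.nilp_def)
    have "degs \<omega> (\<lambda>i. i = \<omega> e) (fp_basis_var e)" by (rule degs_var) simp
    from iter[OF this, of n] have "(ham u v W ^^ n) (fp_basis_var e) = 0"
      unfolding n diff_0 degs_uminus by (blast intro: degs_eq_less_zero)
    then show ?thesis by (auto simp: ham.nilp_def)
  qed
  show ?thesis unfolding W_def[symmetric] by (rule ham_nilp_all[OF var var])
qed

text \<open>On an integral curve the component \<open>X\<close> of \<open>u\<close> satisfies
  \<open>X' = - X * Q\<close> with a polynomial \<open>Q\<close>. If \<open>X\<close> and
  \<open>Q\<close> are nonzero, \<open>X'\<close> is nonzero of degree at least that of
  \<open>X\<close>, which is impossible. Starting where all coordinates are \<open>1\<close> makes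
  both nonzero.\<close>

lemma ham_monomial_not_nilp:
  fixes u v :: "('k::field_char_0, 'x) lie_basis"
  assumes uv: "u \<noteq> v" and m: "lookup m u > 0" "lookup m v > 0" and "c \<noteq> 0"
    and nil: "\<And>p. ham.nilp u v (single m c) p"
  shows False
proof -
  let ?W = "single m c"
  obtain E where E: "fp_hom (\<lambda>c. [:c:]) E" "\<And>p. pderiv (E p) = E (ham u v ?W p)" "\<And>p. poly (E p) 0 = fp_eval (\<lambda>_. 1) p"
    using integral_curve[OF ham.algebra_der_axioms nil] by metis
  interpret E: fp_hom "\<lambda>c. [:c:]" E by fact
  let ?X = "E (fp_basis_var u)"
  have "poly ?X 0 = 1" by (simp add: E(3))
  then have X: "?X \<noteq> 0" by auto
  define m' where "m' = m - single v 1 - single u 1"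
  have m': "m - single v 1 = single u 1 + m'"
    using m uv by (intro poly_mapping_eqI) (auto simp: m'_def lookup_minus lookup_add lookup_single when_def)
  define c' where "c' = c * of_nat (lookup m v)"
  have "fp_pderiv v ?W = fp_basis_var u * single m' c'"
    unfolding fp_pderiv_single m' by (simp add: fp_basis_var_def mult_single c'_def)
  then have "ham u v ?W (fp_basis_var u) = - (fp_basis_var u * single m' c')"
    using uv by (simp add: ham_def fp_pderiv_var)
  then have X': "pderiv ?X = - (?X * E (single m' c'))"
    by (simp add: E(2) E.uminus E.mult)
  have "poly (E (single m' c')) 0 = c'"
    by (simp add: E(3) fp_scalar.psubst_single)
  then have Q: "E (single m' c') \<noteq> 0" using m \<open>c \<noteq> 0\<close> by (auto simp: c'_def)
  then have "pderiv ?X \<noteq> 0" using X X' by simp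
  then have "degree ?X \<noteq> 0" by (metis pderiv_eq_0_iff)
  moreover have "degree (pderiv ?X) = degree ?X + degree (E (single m' c'))"
    unfolding X' using X Q by (simp add: degree_mult_eq)
  ultimately show False by (simp add: degree_pderiv)
qed

lemma lex_max_exists:
  fixes f g :: "'a \<Rightarrow> int"
  assumes "finite S" "S \<noteq> {}"
  obtains m where "m \<in> S" "\<And>n. n \<in> S \<Longrightarrow> f n < f m \<or> f n = f m \<and> g n \<le> g m"
proof -
  define T where "T = {m \<in> S. f m = Max (f ` S)}"
  have "Max (f ` S) \<in> f ` S" using assms by (intro Max_in) auto
  then obtain m' where "m' \<in> S" "f m' = Max (f ` S)" by (metis imageE)
  then have T: "finite T" "T \<noteq> {}" using assms by (auto simp: T_def)
  then have "Max (g ` T) \<in> g ` T" by (intro Max_in) auto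
  then obtain m where m: "m \<in> T" "g m = Max (g ` T)" by auto
  show thesis
  proof (rule that[of m])
    show "m \<in> S" using m by (simp add: T_def)
    fix n assume n: "n \<in> S"
    have "f n \<le> f m" using n m assms by (auto simp: T_def)
    moreover have "g n \<le> g m" if "f n = f m" using that n m T by (auto simp: T_def)
    ultimately show "f n < f m \<or> f n = f m \<and> g n \<le> g m" by linarith
  qed
qed

text \<open>Taking the leading form for \<open>\<omega>\<close> and then for \<open>\<eta>\<close>
  isolates the monomial \<open>m0\<close>, which inherits local nilpotence and so cannot contain
  both variables.\<close>

lemma ham_vertex:
  fixes u v :: "('k::field_char_0, 'x) lie_basis"
  assumes uv: "u \<noteq> v" and nil: "\<And>p. ham.nilp u v g p" and m0: "m0 \<in> keys g"
    and lex: "\<And>m. m \<in> keys g \<Longrightarrow> m \<noteq> m0 \<Longrightarrow> wdeg \<omega> m < wdeg \<omega> m0 \<or> wdeg \<omega> m = wdeg \<omega> m0 \<and> wdeg \<eta> m < wdeg \<eta> m0"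
  shows "lookup m0 u = 0 \<or> lookup m0 v = 0"
proof (rule ccontr)
  assume *: "\<not> ?thesis"
  define W where "W = homog_part \<omega> (wdeg \<omega> m0) g"
  have le: "wdeg \<omega> m \<le> wdeg \<omega> m0" if "m \<in> keys g" for m
    using lex[OF that] by (cases "m = m0") auto
  have "ham.nilp u v W p" for p unfolding W_def by (rule ham_homog_part_nilp[OF nil le])
  moreover have W: "wdeg \<eta> m \<le> wdeg \<eta> m0" if "m \<in> keys W" for m
    using lex[of m] that by (cases "m = m0") (auto simp: W_def keys_homog_part)
  ultimately have "ham.nilp u v (homog_part \<eta> (wdeg \<eta> m0) W) p" for p by (rule ham_homog_part_nilp)
  moreover have "homog_part \<eta> (wdeg \<eta> m0) W = single m0 (lookup g m0)"
  proof (rule poly_mapping_eqI)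
    fix m
    show "lookup (homog_part \<eta> (wdeg \<eta> m0) W) m = lookup (single m0 (lookup g m0)) m"
      using lex[of m] by (cases "m = m0"; cases "m \<in> keys g")
        (auto simp: W_def lookup_homog_part lookup_single when_def in_keys_iff)
  qed
  ultimately show False
    using ham_monomial_not_nilp[OF uv, of m0 "lookup g m0"] * m0 by (simp add: in_keys_iff)
qed

section \<open>The Newton polygon of a locally nilpotent Hamiltonian\<close>

definition deg_in :: "('k::field, 'x) lie_basis \<Rightarrow> ('k, 'x) free_poisson \<Rightarrow> nat" where
  "deg_in e p = Max (insert 0 ((\<lambda>m. lookup m e) ` keys p))"

lemma deg_in_ge: "m \<in> keys p \<Longrightarrow> lookup m e \<le> deg_in e p"
  unfolding deg_in_def by (intro Max_ge) auto

lemma deg_in_le: "(\<And>m. m \<in> keys p \<Longrightarrow> lookup m e \<le> n) \<Longrightarrow> deg_in e p \<le> n"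
  unfolding deg_in_def by (subst Max_le_iff) auto

lemma deg_in_attained:
  assumes "deg_in e p > 0"
  obtains m where "m \<in> keys p" "lookup m e = deg_in e p"
proof -
  have "deg_in e p \<in> insert 0 ((\<lambda>m. lookup m e) ` keys p)"
    unfolding deg_in_def by (intro Max_in) auto
  then show thesis using assms that by auto
qed

lemma deg_in_zero_iff: "deg_in e p = 0 \<longleftrightarrow> e \<notin> fp_vars p"
proof
  assume "deg_in e p = 0"
  then show "e \<notin> fp_vars p"
    using deg_in_ge[of _ p e] by (fastforce simp: fp_vars_def in_keys_iff)
next
  assume "e \<notin> fp_vars p"
  then have "deg_in e p \<le> 0" by (intro deg_in_le) (auto simp: fp_vars_def in_keys_iff)
  then show "deg_in e p = 0" by simp
qed

lemma keys_two_vars: "fp_vars p \<subseteq> {u, v} \<Longrightarrow> m \<in> keys p \<Longrightarrow> keys m \<subseteq> {u, v}"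
  by (auto simp: fp_vars_def)

lemma two_vars_eqI:
  assumes "keys m \<subseteq> {u, v}" "keys n \<subseteq> {u, v}"
    "lookup m u = lookup n u" "lookup m v = lookup n v"
  shows "m = n"
proof (rule poly_mapping_eqI)
  fix e
  show "lookup m e = lookup n e"
  proof (cases "e = u \<or> e = v")
    case False
    then have "e \<notin> keys m" "e \<notin> keys n" using assms by auto
    then show ?thesis by (simp add: in_keys_iff)
  qed (use assms in auto)
qed

lemma wdeg_two_vars:
  assumes "keys m \<subseteq> {u, v}" "u \<noteq> v"
  shows "wdeg \<omega> m = int (lookup m u) * \<omega> u + int (lookup m v) * \<omega> v"
  using wdeg_superset[OF _ assms(1)] assms(2) by simp

text \<open>Among the monomials of maximal degree in \<open>u\<close>, the one of largest degree in
  \<open>v\<close> is a vertex of the Newton polygon. So it lies on an axis, and this can only be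
  the axis of \<open>u\<close>.\<close>

lemma ham_corner:
  fixes u v :: "('k::field_char_0, 'x) lie_basis"
  assumes uv: "u \<noteq> v" and vars: "fp_vars g \<subseteq> {u, v}" and nil: "\<And>p. ham.nilp u v g p"
    and pos: "deg_in u g > 0"
  shows "single u (deg_in u g) \<in> keys g"
proof -
  let ?\<omega> = "\<lambda>e. if e = u then 1 else 0 :: int" and ?\<eta> = "\<lambda>e. if e = v then 1 else 0 :: int"
  obtain m1 where m1: "m1 \<in> keys g" "lookup m1 u = deg_in u g"
    using deg_in_attained[OF pos] .
  obtain m0 where m0: "m0 \<in> keys g"
    "\<And>m. m \<in> keys g \<Longrightarrow> wdeg ?\<omega> m < wdeg ?\<omega> m0 \<or> wdeg ?\<omega> m = wdeg ?\<omega> m0 \<and> wdeg ?\<eta> m \<le> wdeg ?\<eta> m0"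
    using lex_max_exists[of "keys g" "wdeg ?\<omega>" "wdeg ?\<eta>"] m1(1) by (metis empty_iff finite_keys)
  have wd: "wdeg ?\<omega> m = int (lookup m u)" "wdeg ?\<eta> m = int (lookup m v)"
    if "m \<in> keys g" for m
    using wdeg_two_vars[OF keys_two_vars[OF vars that] uv] uv by auto
  have top: "lookup m0 u = deg_in u g"
    using m0(2)[OF m1(1)] wd m0(1) m1 deg_in_ge[OF m0(1), of u] by auto
  have "lookup m0 u = 0 \<or> lookup m0 v = 0"
  proof (rule ham_vertex[OF uv nil m0(1), of ?\<omega> ?\<eta>])
    fix m assume m: "m \<in> keys g" "m \<noteq> m0"
    then have "\<not> (wdeg ?\<omega> m = wdeg ?\<omega> m0 \<and> wdeg ?\<eta> m = wdeg ?\<eta> m0)"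
      using two_vars_eqI[OF keys_two_vars[OF vars m(1)] keys_two_vars[OF vars m0(1)]] wd m0(1) by auto
    then show "wdeg ?\<omega> m < wdeg ?\<omega> m0 \<or> wdeg ?\<omega> m = wdeg ?\<omega> m0 \<and> wdeg ?\<eta> m < wdeg ?\<eta> m0"
      using m0(2)[OF m(1)] by linarith
  qed
  then have "m0 = single u (deg_in u g)"
    using top pos uv
    by (intro two_vars_eqI[OF keys_two_vars[OF vars m0(1)]]) (auto simp: lookup_single when_def)
  then show ?thesis using m0(1) by simp
qed

text \<open>The weights give both corners the weight \<open>deg_in u g * deg_in v g\<close>. The
  maximal weight is attained at a vertex, which lies on an axis, where the weight is at most this
  product.\<close>

lemma ham_newton_triangle:
  fixes u v :: "('k::field_char_0, 'x) lie_basis"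
  assumes uv: "u \<noteq> v" and vars: "fp_vars g \<subseteq> {u, v}" and nil: "\<And>p. ham.nilp u v g p"
    and pos: "deg_in u g > 0" "deg_in v g > 0" and m: "m \<in> keys g"
  shows "deg_in v g * lookup m u + deg_in u g * lookup m v \<le> deg_in u g * deg_in v g"
proof -
  let ?\<omega> = "\<lambda>e. if e = u then int (deg_in v g) else int (deg_in u g)" and ?\<eta> = "\<lambda>e. if e = u then 1 else 0 :: int"
  obtain m0 where m0: "m0 \<in> keys g"
    "\<And>m. m \<in> keys g \<Longrightarrow> wdeg ?\<omega> m < wdeg ?\<omega> m0 \<or> wdeg ?\<omega> m = wdeg ?\<omega> m0 \<and> wdeg ?\<eta> m \<le> wdeg ?\<eta> m0"
    using lex_max_exists[of "keys g" "wdeg ?\<omega>" "wdeg ?\<eta>"] m by (metis empty_iff finite_keys)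
  have wd: "wdeg ?\<omega> m = int (deg_in v g * lookup m u + deg_in u g * lookup m v)"
    "wdeg ?\<eta> m = int (lookup m u)" if "m \<in> keys g" for m
    using wdeg_two_vars[OF keys_two_vars[OF vars that] uv] uv by (auto simp: algebra_simps)
  have "lookup m0 u = 0 \<or> lookup m0 v = 0"
  proof (rule ham_vertex[OF uv nil m0(1), of ?\<omega> ?\<eta>])
    fix m assume m: "m \<in> keys g" "m \<noteq> m0"
    have "m = m0" if eq: "wdeg ?\<omega> m = wdeg ?\<omega> m0" "wdeg ?\<eta> m = wdeg ?\<eta> m0"
    proof (rule two_vars_eqI[OF keys_two_vars[OF vars m(1)] keys_two_vars[OF vars m0(1)]])
      show u: "lookup m u = lookup m0 u" using eq(2) wd m m0(1) by auto
      have "deg_in v g * lookup m u + deg_in u g * lookup m v =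
          deg_in v g * lookup m0 u + deg_in u g * lookup m0 v"
        using eq(1) unfolding wd(1)[OF m(1)] wd(1)[OF m0(1)] by (simp only: of_nat_eq_iff)
      then show "lookup m v = lookup m0 v" using u pos by simp
    qed
    then show "wdeg ?\<omega> m < wdeg ?\<omega> m0 \<or> wdeg ?\<omega> m = wdeg ?\<omega> m0 \<and> wdeg ?\<eta> m < wdeg ?\<eta> m0"
      using m0(2)[OF m(1)] m(2) by (meson order_le_less)
  qed
  moreover have "deg_in v g * lookup m u + deg_in u g * lookup m v \<le>
      deg_in v g * lookup m0 u + deg_in u g * lookup m0 v"
  proof -
    have "wdeg ?\<omega> m \<le> wdeg ?\<omega> m0" using m0(2)[OF m] by linarith
    then show ?thesis unfolding wd(1)[OF m] wd(1)[OF m0(1)] by (simp only: of_nat_le_iff)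
  qed
  moreover have "deg_in v g * lookup m0 u \<le> deg_in u g * deg_in v g"
    "deg_in u g * lookup m0 v \<le> deg_in u g * deg_in v g"
    using deg_in_ge[OF m0(1)] by (simp_all add: mult.commute)
  ultimately show ?thesis by (metis (no_types, lifting) add_0 add_0_right le_trans mult_0_right)
qed

section \<open>Integral curves of the form along the edge of the Newton polygon\<close>

lemma fp_hom_two_vars:
  assumes h: "fp_hom \<kappa> h" and vars: "fp_vars p \<subseteq> {u, v}" and uv: "u \<noteq> v"
  shows "h p = (\<Sum>m\<in>keys p. \<kappa> (lookup p m) *
    (h (fp_basis_var u) ^ lookup m u * h (fp_basis_var v) ^ lookup m v))"
proof -
  have "(\<Prod>e\<in>keys m. h (fp_basis_var e) ^ lookup m e) =
      h (fp_basis_var u) ^ lookup m u * h (fp_basis_var v) ^ lookup m v"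
    if "m \<in> keys p" for m
  proof -
    have "(\<Prod>e\<in>keys m. h (fp_basis_var e) ^ lookup m e) =
        (\<Prod>e\<in>{u, v}. h (fp_basis_var e) ^ lookup m e)"
      using keys_two_vars[OF vars that] by (intro prod.mono_neutral_left) (auto simp: in_keys_iff)
    then show ?thesis using uv by simp
  qed
  then show ?thesis by (subst fp_hom.expand[OF h]) simp
qed

text \<open>If \<open>k\<close> divides all exponents of \<open>v\<close>, then
  \<open>v ^ (k - 1)\<close> divides the derivative with respect to \<open>v\<close>, which along
  the curve is the velocity of the other component \<open>X\<close> up to sign. The inequality is
  strict since differentiation lowers the degree of \<open>X\<close>.\<close>

lemma curve_degree_bound:
  fixes W :: "('k::field_char_0, 'x) free_poisson"
  assumes E: "fp_hom (\<lambda>c. [:c:]) E" and vars: "fp_vars W \<subseteq> {u, v}" and uv: "u \<noteq> v"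
    and dvd: "\<And>m. m \<in> keys W \<Longrightarrow> k dvd lookup m v"
    and X: "pderiv X = - E (fp_pderiv v W) \<or> pderiv X = E (fp_pderiv v W)" "E (fp_pderiv v W) \<noteq> 0"
  shows "(k - 1) * degree (E (fp_basis_var v)) < degree X"
proof -
  let ?Y = "E (fp_basis_var v)"
  have vars': "fp_vars (fp_pderiv v W) \<subseteq> {u, v}" using fp_vars_pderiv vars by blast
  have "?Y ^ (k - 1) dvd E (fp_pderiv v W)"
    unfolding fp_hom_two_vars[OF E vars' uv]
  proof (intro dvd_sum dvd_mult)
    fix m assume "m \<in> keys (fp_pderiv v W)"
    from dvd[OF keys_fp_pderiv[OF this]] have "k dvd Suc (lookup m v)" by (simp add: lookup_add)
    then have "k \<le> Suc (lookup m v)" by (rule dvd_imp_le) simp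
    then have "k - 1 \<le> lookup m v" by simp
    then show "?Y ^ (k - 1) dvd ?Y ^ lookup m v" by (rule le_imp_power_dvd)
  qed
  then have "degree (?Y ^ (k - 1)) \<le> degree (E (fp_pderiv v W))"
    using X(2) by (intro dvd_imp_degree_le)
  moreover have "degree (E (fp_pderiv v W)) = degree X - 1"
    using X(1) by (metis degree_minus degree_pderiv)
  moreover have "degree X \<noteq> 0" using X by (metis pderiv_eq_0_iff neg_equal_0_iff_equal)
  moreover have "degree (?Y ^ (k - 1)) = (k - 1) * degree ?Y"
    by (cases "?Y = 0") (simp_all add: degree_power_eq power_0_left)
  ultimately show ?thesis by linarith
qed

text \<open>\<open>W\<close> is constant along the curve. Unless
  \<open>degree X = l * degree Y\<close>, one of the two end monomials has strictly largest degree
  in \<open>t\<close>, a contradiction. In case of equality all monomials have the same degree, so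
  their leading coefficients cancel, and \<open>lead_coeff X / lead_coeff Y ^ l\<close> is a root of
  the edge polynomial.\<close>

lemma edge_root:
  fixes W :: "('k::field_char_0, 'x) free_poisson"
  assumes E: "fp_hom (\<lambda>c. [:c:]) E" and vars: "fp_vars W \<subseteq> {u, v}" and uv: "u \<noteq> v"
    and edge: "\<And>m. m \<in> keys W \<Longrightarrow> l * lookup m u + lookup m v = l * n"
    and ends: "single u n \<in> keys W" "single v (l * n) \<in> keys W"
    and pos: "l > 0" "n > 0" "degree (E (fp_basis_var u)) > 0" "degree (E (fp_basis_var v)) > 0"
    and const: "degree (E W) = 0"
  shows "\<exists>c. (\<Sum>m\<in>keys W. lookup W m * c ^ lookup m u) = 0"
proof -
  define X where "X = E (fp_basis_var u)"
  define Y where "Y = E (fp_basis_var v)"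
  define a where "a = degree X"
  define b where "b = degree Y"
  let ?m1 = "single u n" and ?m2 = "single v (l * n)"
  have ab: "a > 0" "b > 0" using pos by (simp_all add: a_def b_def X_def Y_def)
  have nz: "X \<noteq> 0" "Y \<noteq> 0" using ab by (auto simp: a_def b_def)
  define t where "t m = X ^ lookup m u * Y ^ lookup m v" for m
  have deg: "degree (t m) = a * lookup m u + b * lookup m v" for m
    using nz by (simp add: t_def degree_mult_eq degree_power_eq a_def b_def mult.commute)
  have lead: "lead_coeff (t m) = lead_coeff X ^ lookup m u * lead_coeff Y ^ lookup m v" for m
    by (simp add: t_def lead_coeff_mult lead_coeff_power)
  have t0: "t m \<noteq> 0" for m using nz by (simp add: t_def)
  have EW: "E W = (\<Sum>m\<in>keys W. [:lookup W m:] * t m)"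
    unfolding t_def X_def Y_def by (rule fp_hom_two_vars[OF E vars uv])
  have coeff: "coeff (E W) k = (\<Sum>m\<in>keys W. lookup W m * coeff (t m) k)" for k
    by (simp add: EW coeff_sum)
  have single_top: False
    if m0: "m0 \<in> keys W" "degree (t m0) > 0"
      and less: "\<And>m. m \<in> keys W \<Longrightarrow> m \<noteq> m0 \<Longrightarrow> degree (t m) < degree (t m0)" for m0
  proof -
    have "coeff (E W) (degree (t m0)) = (\<Sum>m\<in>keys W. if m = m0 then lookup W m0 * lead_coeff (t m0) else 0)"
      unfolding coeff by (intro sum.cong) (auto simp: less coeff_eq_0)
    also have "\<dots> = lookup W m0 * lead_coeff (t m0)" using m0 by simp
    also have "\<dots> \<noteq> 0" using m0 t0 by (simp add: in_keys_iff)
    finally have "degree (t m0) \<le> degree (E W)" by (rule le_degree)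
    then show False using const m0 by simp
  qed
  have le: "lookup m u \<le> n" and mv: "lookup m v = l * (n - lookup m u)"
    if "m \<in> keys W" for m
  proof -
    have "l * lookup m u \<le> l * n" using edge[OF that] by linarith
    then show "lookup m u \<le> n" using pos by simp
    then show "lookup m v = l * (n - lookup m u)"
      using edge[OF that] by (simp add: right_diff_distrib')
  qed
  have m1: "lookup m u < n" if "m \<in> keys W" "m \<noteq> ?m1" for m
  proof (rule ccontr)
    assume "\<not> ?thesis"
    then have "m = ?m1" using le[OF that(1)] mv[OF that(1)] uv
      by (intro two_vars_eqI[OF keys_two_vars[OF vars that(1)]]) (auto simp: lookup_single when_def)
    then show False using that by simp
  qed
  have m2: "lookup m u > 0" if "m \<in> keys W" "m \<noteq> ?m2" for m
  proof (rule ccontr)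
    assume "\<not> ?thesis"
    then have "m = ?m2" using mv[OF that(1)] uv
      by (intro two_vars_eqI[OF keys_two_vars[OF vars that(1)]]) (auto simp: lookup_single when_def)
    then show False using that by simp
  qed
  have degW: "degree (t m) = a * lookup m u + b * l * (n - lookup m u)"
    if "m \<in> keys W" for m using deg mv[OF that] by simp
  have deg1: "degree (t ?m1) = a * n" and deg2: "degree (t ?m2) = b * l * n"
    using uv by (simp_all add: deg lookup_single when_def)
  have "\<not> a > b * l"
  proof
    assume *: "a > b * l"
    show False
    proof (rule single_top[OF ends(1)])
      show "degree (t ?m1) > 0" using deg1 ab pos by simp
      fix m assume m: "m \<in> keys W" "m \<noteq> ?m1"
      obtain r where r: "n = lookup m u + r" "r > 0" using m1[OF m] by (metis less_imp_add_positive)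
      have "b * l * r < a * r" using * r by simp
      then show "degree (t m) < degree (t ?m1)" unfolding degW[OF m(1)] deg1 using r by (simp add: algebra_simps)
    qed
  qed
  moreover have "\<not> a < b * l"
  proof
    assume *: "a < b * l"
    show False
    proof (rule single_top[OF ends(2)])
      show "degree (t ?m2) > 0" using deg2 ab pos by simp
      fix m assume m: "m \<in> keys W" "m \<noteq> ?m2"
      obtain r where r: "n = lookup m u + r" using le[OF m(1)] by (metis le_add_diff_inverse)
      have "a * lookup m u < b * l * lookup m u" using * m2[OF m] by simp
      then show "degree (t m) < degree (t ?m2)" unfolding degW[OF m(1)] deg2 using r by (simp add: algebra_simps)
    qed
  qed
  ultimately have abl: "a = b * l" by simp
  define A where "A = lead_coeff X"
  define B where "B = lead_coeff Y"
  have AB: "A \<noteq> 0" "B \<noteq> 0" using nz by (simp_all add: A_def B_def)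
  have "0 = coeff (E W) (a * n)" using const ab pos by (simp add: coeff_eq_0)
  also have "\<dots> = (\<Sum>m\<in>keys W. B ^ (l * n) * (lookup W m * (A / B ^ l) ^ lookup m u))"
    unfolding coeff
  proof (rule sum.cong[OF HOL.refl])
    fix m assume m: "m \<in> keys W"
    obtain r where r: "n = lookup m u + r" using le[OF m] by (metis le_add_diff_inverse)
    have "degree (t m) = a * n" unfolding degW[OF m] using r by (simp add: abl algebra_simps)
    then have "coeff (t m) (a * n) = A ^ lookup m u * B ^ lookup m v"
      using lead[of m] by (simp add: A_def B_def)
    also have "B ^ lookup m v = (B ^ l) ^ r" using mv[OF m] r by (simp add: power_mult)
    also have "A ^ lookup m u * (B ^ l) ^ r = B ^ (l * n) * (A / B ^ l) ^ lookup m u"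
      using AB by (simp add: r power_mult power_add power_divide distrib_left)
    finally show "lookup W m * coeff (t m) (a * n) =
        B ^ (l * n) * (lookup W m * (A / B ^ l) ^ lookup m u)" by simp
  qed
  also have "\<dots> = B ^ (l * n) * (\<Sum>m\<in>keys W. lookup W m * (A / B ^ l) ^ lookup m u)"
    by (simp only: sum_distrib_left)
  finally show ?thesis using AB by auto
qed

text \<open>Write the degrees as \<open>i * G\<close> and \<open>j * G\<close> with
  \<open>i\<close>, \<open>j\<close> coprime. On the edge \<open>i\<close> divides the exponents of
  \<open>u\<close> and \<open>j\<close> those of \<open>v\<close>, so an integral curve satisfies
  \<open>(j - 1) * degree Y < degree X\<close> and \<open>(i - 1) * degree X < degree Y\<close>.
  Hence \<open>i\<close> and \<open>j\<close> cannot both exceed \<open>1\<close>, and one degree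
  divides the other.\<close>

lemma ham_edge:
  fixes u v :: "('k::field_char_0, 'x) lie_basis"
  assumes uv: "u \<noteq> v" and vars: "fp_vars g \<subseteq> {u, v}" and nil: "\<And>p. ham.nilp u v g p"
    and pos: "deg_in u g > 0" "deg_in v g > 0"
  shows "(\<exists>l c. l > 0 \<and> deg_in v g = l * deg_in u g \<and>
      (\<Sum>m | m \<in> keys g \<and> l * lookup m u + lookup m v = l * deg_in u g.
        lookup g m * c ^ lookup m u) = 0) \<or>
    (\<exists>l c. l > 0 \<and> deg_in u g = l * deg_in v g \<and>
      (\<Sum>m | m \<in> keys g \<and> l * lookup m v + lookup m u = l * deg_in v g.
        lookup g m * c ^ lookup m v) = 0)"
proof -
  define dx where "dx = deg_in u g"
  define dy where "dy = deg_in v g"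
  define G where "G = gcd dx dy"
  have "G > 0" using pos by (simp add: G_def dx_def)
  obtain i j where ij: "dx = i * G" "dy = j * G" "coprime i j"
    using gcd_coprime_exists[of dx dy] \<open>G > 0\<close> unfolding G_def by auto
  have ijpos: "i > 0" "j > 0" using pos ij by (auto simp: dx_def[symmetric] dy_def[symmetric] intro: gr0I)
  \<comment> \<open>With these weights \<open>W\<close> collects the monomials on the edge joining
    the two corners.\<close>
  define \<omega> where "\<omega> e = (if e = u then int dy else int dx)" for e
  define W where "W = homog_part \<omega> (int (dx * dy)) g"
  have wd: "wdeg \<omega> m = int (dy * lookup m u + dx * lookup m v)" if "m \<in> keys g" for m
    using wdeg_two_vars[OF keys_two_vars[OF vars that] uv] uv by (auto simp: \<omega>_def algebra_simps)
  have le: "wdeg \<omega> m \<le> int (dx * dy)" if "m \<in> keys g" for m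
    using ham_newton_triangle[OF uv vars nil pos that] unfolding wd[OF that] dx_def dy_def by (simp only: of_nat_le_iff)
  have nilW: "ham.nilp u v W p" for p unfolding W_def by (rule ham_homog_part_nilp[OF nil le])
  have keysW: "keys W = {m \<in> keys g. dy * lookup m u + dx * lookup m v = dx * dy}"
    unfolding W_def keys_homog_part using wd by (auto simp del: of_nat_add of_nat_mult)
  have lookupW: "lookup W m = lookup g m" if "m \<in> keys W" for m
    using that by (simp add: W_def lookup_homog_part keys_homog_part)
  have varsW: "fp_vars W \<subseteq> {u, v}" using vars keysW by (auto simp: fp_vars_def)
  have corner_u: "single u dx \<in> keys W"
    unfolding keysW using ham_corner[OF uv vars nil pos(1)] uv by (simp add: dx_def lookup_single when_def mult.commute)
  \<comment> \<open>Exchanging the two variables only changes the sign of the derivation.\<close>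
  have nil': "ham.nilp v u g p" for p
  proof -
    have "(ham v u g ^^ n) p = (-1) ^ n * (ham u v g ^^ n) p" for n
    proof (induction n)
      case (Suc n)
      have "ham u v g ((-1) ^ n * q) = (-1) ^ n * ham u v g q" for q
        using ham.scalar_mult[of u v g "(-1) ^ n" q] by (cases "even n") (simp_all add: single_uminus)
      then show ?case using Suc by (simp add: ham_swap[of v u])
    qed simp
    then show ?thesis using nil[of p] unfolding ham.nilp_def by (metis mult_zero_right)
  qed
  have corner_v: "single v dy \<in> keys W"
    unfolding keysW using ham_corner[OF uv[symmetric] _ nil' pos(2)] vars uv by (simp add: dy_def lookup_single when_def insert_commute)
  have "u \<in> fp_vars W" "v \<in> fp_vars W"
    using corner_u corner_v pos unfolding fp_vars_def by (force simp: dx_def, force simp: dy_def)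
  then have "fp_pderiv u W \<noteq> 0" "fp_pderiv v W \<noteq> 0" by (simp_all add: fp_pderiv_nonzero)
  \<comment> \<open>At such a starting point both components of the velocity are nonzero, so neither
    component of the curve is constant.\<close>
  then obtain \<rho> where \<rho>: "fp_eval \<rho> (fp_pderiv u W) \<noteq> 0" "fp_eval \<rho> (fp_pderiv v W) \<noteq> 0"
    using fp_eval_nonzero2 by blast
  obtain E where E: "fp_hom (\<lambda>c. [:c:]) E" "\<And>p. pderiv (E p) = E (ham u v W p)" "\<And>p. poly (E p) 0 = fp_eval \<rho> p"
    using integral_curve[OF ham.algebra_der_axioms nilW, of \<rho>] by metis
  interpret E: fp_hom "\<lambda>c. [:c:]" E by fact
  let ?X = "E (fp_basis_var u)" and ?Y = "E (fp_basis_var v)"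
  have X: "pderiv ?X = - E (fp_pderiv v W)" and Y: "pderiv ?Y = E (fp_pderiv u W)"
    using uv by (simp_all add: E(2) ham_def fp_pderiv_var E.uminus)
  have nz: "E (fp_pderiv u W) \<noteq> 0" "E (fp_pderiv v W) \<noteq> 0"
    using E(3) \<rho> by (metis poly_0)+
  have dvd: "i dvd lookup m u" "j dvd lookup m v" if "m \<in> keys W" for m
  proof -
    have "G * (j * lookup m u + i * lookup m v) = G * (i * (G * j))"
      using that unfolding keysW ij by (simp add: algebra_simps)
    then have eq: "j * lookup m u + i * lookup m v = i * (G * j)" using \<open>G > 0\<close> by simp
    have "i dvd j * lookup m u" using eq by (metis dvd_add_left_iff dvd_triv_left)
    then show "i dvd lookup m u" using ij(3) by (simp add: coprime_dvd_mult_right_iff)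
    have "j dvd i * lookup m v" using eq by (metis dvd_add_right_iff dvd_triv_left dvd_triv_right mult.assoc)
    then show "j dvd lookup m v" using ij(3) by (simp add: coprime_dvd_mult_right_iff coprime_commute)
  qed
  have 1: "(j - 1) * degree ?Y < degree ?X"
    using curve_degree_bound[OF E(1) varsW uv dvd(2)] X nz by blast
  have varsW': "fp_vars W \<subseteq> {v, u}" using varsW by blast
  have 2: "(i - 1) * degree ?X < degree ?Y"
    using curve_degree_bound[OF E(1) varsW' uv[symmetric] dvd(1)] Y nz by blast
  have "pderiv (E W) = 0" by (simp add: E(2) ham_self E.zero)
  then have const: "degree (E W) = 0" by (simp add: pderiv_eq_0_iff)
  have "i = 1 \<or> j = 1"
  proof (rule ccontr)
    assume "\<not> ?thesis"
    then have "1 \<le> i - 1" "1 \<le> j - 1" using ijpos by auto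
    then have "1 * degree ?X \<le> (i - 1) * degree ?X" "1 * degree ?Y \<le> (j - 1) * degree ?Y"
      by (intro mult_le_mono1; simp)+
    then show False using 1 2 by linarith
  qed
  then show ?thesis
  proof
    assume "i = 1"
    then have dxy: "dy = j * dx" using ij by simp
    have edge: "dy * lookup m u + dx * lookup m v = dx * dy \<longleftrightarrow>
        j * lookup m u + lookup m v = j * dx" for m
    proof -
      have "dy * lookup m u + dx * lookup m v = dx * (j * lookup m u + lookup m v)"
        by (simp add: dxy algebra_simps)
      moreover have "dx * dy = dx * (j * dx)" by (simp add: dxy)
      ultimately show ?thesis using pos(1) by (simp add: dx_def)
    qed
    obtain c where "(\<Sum>m\<in>keys W. lookup W m * c ^ lookup m u) = 0"
      using edge_root[OF E(1) varsW uv, of j dx] keysW edge corner_u corner_v dxy ijpos pos(1) 1 2 const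
      by (auto simp: dx_def[symmetric])
    moreover have "(\<Sum>m\<in>keys W. lookup W m * c ^ lookup m u) =
        (\<Sum>m | m \<in> keys g \<and> j * lookup m u + lookup m v = j * dx.
        lookup g m * c ^ lookup m u)"
      by (intro sum.cong) (auto simp: keysW edge lookupW)
    ultimately have "(\<Sum>m | m \<in> keys g \<and> j * lookup m u + lookup m v = j * dx.
        lookup g m * c ^ lookup m u) = 0" by simp
    with dxy ijpos show ?thesis
      unfolding dx_def[symmetric] dy_def[symmetric] by (intro disjI1 exI[of _ j] exI[of _ c] conjI) auto
  next
    assume "j = 1"
    then have dxy: "dx = i * dy" using ij by simp
    have edge: "dy * lookup m u + dx * lookup m v = dx * dy \<longleftrightarrow>
        i * lookup m v + lookup m u = i * dy" for m
    proof -
      have "dy * lookup m u + dx * lookup m v = dy * (i * lookup m v + lookup m u)"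
        by (simp add: dxy algebra_simps)
      moreover have "dx * dy = dy * (i * dy)" by (simp add: dxy)
      ultimately show ?thesis using pos(2) by (simp add: dy_def)
    qed
    obtain c where "(\<Sum>m\<in>keys W. lookup W m * c ^ lookup m v) = 0"
      using edge_root[OF E(1) varsW' uv[symmetric], of i dy] keysW edge corner_u corner_v dxy ijpos pos(2) 1 2 const
      by (auto simp: dy_def[symmetric])
    moreover have "(\<Sum>m\<in>keys W. lookup W m * c ^ lookup m v) =
        (\<Sum>m | m \<in> keys g \<and> i * lookup m v + lookup m u = i * dy.
        lookup g m * c ^ lookup m v)"
      by (intro sum.cong) (auto simp: keysW edge lookupW)
    ultimately have "(\<Sum>m | m \<in> keys g \<and> i * lookup m v + lookup m u = i * dy.
        lookup g m * c ^ lookup m v) = 0" by simp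
    with dxy ijpos show ?thesis
      unfolding dx_def[symmetric] dy_def[symmetric] by (intro disjI2 exI[of _ i] exI[of _ c] conjI) auto
  qed
qed

text \<open>The substitution preserves the weighted bound \<open>l * n\<close>, so the degree in
  \<open>u\<close> does not exceed \<open>n\<close>, and the exponent \<open>l * n\<close> of
  \<open>v\<close> could only occur in a pure power. The coefficient of that power is the edge
  polynomial at \<open>c\<close>, which is zero; hence the degree in \<open>v\<close> drops.\<close>

lemma edge_substitution:
  fixes g :: "('k::field_char_0, 'x) free_poisson"
  assumes uv: "u \<noteq> v" and vars: "fp_vars g \<subseteq> {u, v}" and dy: "deg_in v g = l * deg_in u g" and pos: "l > 0" "deg_in u g > 0"
    and le: "\<And>m. m \<in> keys g \<Longrightarrow> l * lookup m u + lookup m v \<le> l * deg_in u g"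
    and root: "(\<Sum>m | m \<in> keys g \<and> l * lookup m u + lookup m v = l * deg_in u g.
        lookup g m * c ^ lookup m u) = 0"
    and \<sigma>: "fp_hom (single 0) \<sigma>" "\<sigma> (fp_basis_var u) = fp_basis_var u + fp_scale c (fp_basis_var v ^ l)"
      "\<sigma> (fp_basis_var v) = fp_basis_var v"
  shows "fp_vars (\<sigma> g) \<subseteq> {u, v}" "deg_in u (\<sigma> g) + deg_in v (\<sigma> g) < deg_in u g + deg_in v g"
proof -
  interpret \<sigma>: fp_hom "single 0" \<sigma> by fact
  define n where "n = deg_in u g"
  let ?x = "fp_basis_var u :: ('k, 'x) free_poisson" and ?y = "fp_basis_var v :: ('k, 'x) free_poisson"
  have \<sigma>g: "\<sigma> g = (\<Sum>m\<in>keys g. single 0 (lookup g m) *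
    ((?x + fp_scale c (?y ^ l)) ^ lookup m u * ?y ^ lookup m v))"
    using fp_hom_two_vars[OF \<sigma>(1) vars uv] by (simp add: \<sigma>(2,3))
  have varsx: "fp_vars (?x + fp_scale c (?y ^ l)) \<subseteq> {u, v}"
    using fp_vars_add[of ?x "fp_scale c (?y ^ l)"] fp_vars_scale[of c "?y ^ l"] fp_vars_power[of ?y l]
    by (auto simp: fp_vars_basis_var)
  have "fp_vars (single 0 (lookup g m) *
    ((?x + fp_scale c (?y ^ l)) ^ lookup m u * ?y ^ lookup m v)) \<subseteq> {u, v}" for m
    using fp_vars_mult[of "single 0 (lookup g m)"
        "(?x + fp_scale c (?y ^ l)) ^ lookup m u * ?y ^ lookup m v"]
      fp_vars_mult[of "(?x + fp_scale c (?y ^ l)) ^ lookup m u" "?y ^ lookup m v"]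
      fp_vars_power[of "?x + fp_scale c (?y ^ l)" "lookup m u"]
      fp_vars_power[of ?y "lookup m v"] varsx
    unfolding fp_vars_const fp_vars_basis_var by blast
  then show vars': "fp_vars (\<sigma> g) \<subseteq> {u, v}"
    unfolding \<sigma>g by (intro order_trans[OF fp_vars_sum] UN_least)
  let ?\<omega> = "\<lambda>e. if e = u then int l else 1"
  have x: "degs ?\<omega> (\<lambda>i. i = int l) (?x + fp_scale c (?y ^ l))"
  proof (rule degs_add)
    show "degs ?\<omega> (\<lambda>i. i = int l) ?x" by (rule degs_var) simp
    have "degs ?\<omega> (\<lambda>i. i = 1) ?y" using uv by (intro degs_var) simp
    from degs_power[OF this, of l] have yl: "degs ?\<omega> (\<lambda>i. i = int l) (?y ^ l)" by simp
    show "degs ?\<omega> (\<lambda>i. i = int l) (fp_scale c (?y ^ l))"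
      unfolding fp_scale_conv_mult by (rule degs_mult[OF degs_const[of "\<lambda>i. i = 0"] yl]) auto
  qed
  have y: "degs ?\<omega> (\<lambda>i. i = 1) ?y" using uv by (intro degs_var) simp
  have "degs ?\<omega> (\<lambda>i. i \<le> int (l * n)) (\<sigma> g)"
    unfolding \<sigma>g
  proof (rule degs_sum)
    fix m assume m: "m \<in> keys g"
    have mon: "degs ?\<omega> (\<lambda>i. i = int (l * lookup m u + lookup m v))
        ((?x + fp_scale c (?y ^ l)) ^ lookup m u * ?y ^ lookup m v)"
      by (rule degs_mult[OF degs_power[OF x] degs_power[OF y]]) (simp add: mult.commute)
    show "degs ?\<omega> (\<lambda>i. i \<le> int (l * n)) (single 0 (lookup g m) *
        ((?x + fp_scale c (?y ^ l)) ^ lookup m u * ?y ^ lookup m v))"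
      by (rule degs_mult[OF degs_const[of "\<lambda>i. i = 0"] mon]) (use le[OF m] in \<open>auto simp: n_def simp del: of_nat_add of_nat_mult\<close>)
  qed
  then have le': "l * lookup m u + lookup m v \<le> l * n" if "m \<in> keys (\<sigma> g)" for m
  proof -
    have "int (l * lookup m u + lookup m v) \<le> int (l * n)"
      using that \<open>degs ?\<omega> (\<lambda>i. i \<le> int (l * n)) (\<sigma> g)\<close> wdeg_two_vars[OF keys_two_vars[OF vars' that] uv, of ?\<omega>] uv
      by (auto simp: degs_def mult.commute)
    then show ?thesis by (simp only: of_nat_le_iff)
  qed
  have u_le: "deg_in u (\<sigma> g) \<le> n"
  proof (rule deg_in_le)
    fix m assume "m \<in> keys (\<sigma> g)"
    then have "l * lookup m u \<le> l * n" using le' by (meson add_leD1)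
    then show "lookup m u \<le> n" using pos by simp
  qed
  \<comment> \<open>Setting \<open>u\<close> to \<open>0\<close> and \<open>v\<close> to
    \<open>t\<close> reads off the coefficients of the pure powers of \<open>v\<close>; preceded by
    \<open>\<sigma>\<close> it becomes evaluation on the curve
    \<open>(c * t ^ l, t)\<close>.\<close>
  let ?w = "\<lambda>e. if e = v then [:0, 1:] else 0"
  have coeff: "coeff (fp_curve ?w p) k = lookup p (single v k)" if "fp_vars p \<subseteq> {u, v}" for p :: "('k, 'x) free_poisson" and k
  proof -
    have "coeff (fp_curve ?w p) k = (\<Sum>m\<in>keys p. if m = single v k then lookup p m else 0)"
      unfolding fp_hom_two_vars[OF fp_curve.fp_hom_axioms that uv] coeff_sum
    proof (rule sum.cong[OF HOL.refl])
      fix m assume m: "m \<in> keys p"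
      have "m = single v k \<longleftrightarrow> lookup m u = 0 \<and> lookup m v = k"
        using uv two_vars_eqI[OF keys_two_vars[OF that m], of "single v k"] by (auto simp: lookup_single when_def)
      then show "coeff ([:lookup p m:] * (fp_curve ?w (fp_basis_var u) ^ lookup m u *
          fp_curve ?w (fp_basis_var v) ^ lookup m v)) k = (if m = single v k then lookup p m else 0)"
        using uv by (auto simp: power_0_left monom_altdef[of 1, simplified, symmetric])
    qed
    then show ?thesis by (simp add: in_keys_iff)
  qed
  have notin: "single v (l * n) \<notin> keys (\<sigma> g)"
  proof -
    have hom: "fp_hom (\<lambda>c. [:c:]) (\<lambda>p. fp_curve ?w (\<sigma> p))"
      by unfold_locales (simp_all add: \<sigma>.add \<sigma>.mult \<sigma>.const fp_curve.add fp_curve.mult fp_curve.const one_pCons)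
    have x0: "fp_curve ?w (\<sigma> ?x) = monom c l" and y0: "fp_curve ?w (\<sigma> ?y) = monom 1 1"
      using uv by (simp_all add: \<sigma>(2,3) fp_curve.add fp_curve.scale fp_curve.power monom_altdef)
    have "lookup (\<sigma> g) (single v (l * n)) = coeff (fp_curve ?w (\<sigma> g)) (l * n)"
      by (rule coeff[OF vars', symmetric])
    also have "\<dots> = (\<Sum>m\<in>keys g. if l * lookup m u + lookup m v = l * n
        then lookup g m * c ^ lookup m u else 0)"
      unfolding fp_hom_two_vars[OF hom vars uv] coeff_sum x0 y0
      by (intro sum.cong) (auto simp: monom_power mult_monom mult.commute)
    also have "\<dots> = 0" using root by (simp add: n_def sum.inter_filter)
    finally show ?thesis by (simp add: in_keys_iff)
  qed
  have single_sub: "keys (single v (l * n)) \<subseteq> {u, v}" by simp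
  have "lookup m v < l * n" if m: "m \<in> keys (\<sigma> g)" for m
  proof -
    have "m \<noteq> single v (l * n)" using notin m by auto
    then have "lookup m u \<noteq> 0 \<or> lookup m v \<noteq> l * n"
      using two_vars_eqI[OF keys_two_vars[OF vars' m] single_sub] uv
      by (auto simp: lookup_single when_def)
    then show ?thesis using le'[OF m] pos by (cases "lookup m u = 0") (auto intro: le_neq_implies_less dest: add_leD1 simp: less_le_trans)
  qed
  then have "deg_in v (\<sigma> g) \<le> l * n - 1" by (intro deg_in_le) fastforce
  moreover have "l * n > 0" using pos by (simp add: n_def)
  ultimately have "deg_in v (\<sigma> g) < l * n" by linarith
  then show "deg_in u (\<sigma> g) + deg_in v (\<sigma> g) < deg_in u g + deg_in v g"
    using u_le dy by (simp add: n_def)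
qed

section \<open>Reduction modulo the commutator ideal\<close>

definition proj :: "('k::field_char_0, 'x) free_poisson \<Rightarrow> ('k, 'x) free_poisson" where
  "proj = fp_subst (\<lambda>e. if e \<in> range gen_var then fp_basis_var e else 0)"

global_interpretation proj: fp_hom "single 0" "proj :: ('k::field_char_0, 'x) free_poisson \<Rightarrow> _"
  unfolding proj_def by (rule fp_subst.fp_hom_axioms)

lemma proj_var: "proj (fp_basis_var e) = (if e \<in> range gen_var then fp_basis_var e else 0)"
  by (simp add: proj_def)

lemma proj_eq: "fp_vars p \<subseteq> range gen_var \<Longrightarrow> proj p = p"
  by (rule fp_hom_eqI[OF proj.fp_hom_axioms fp_hom_id]) (auto simp: proj_var)

lemma fp_hom_vars:
  assumes h: "fp_hom (single 0) h" and "\<And>e. e \<in> fp_vars p \<Longrightarrow> fp_vars (h (fp_basis_var e)) \<subseteq> S"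
  shows "fp_vars (h p) \<subseteq> S"
proof -
  have prod: "fp_vars (\<Prod>e\<in>A. h (fp_basis_var e) ^ n e) \<subseteq> S" if "A \<subseteq> fp_vars p" for A n
    using that
  proof (induction A rule: infinite_finite_induct)
    case (insert e A)
    have "fp_vars (h (fp_basis_var e) ^ n e) \<subseteq> S"
      using order_trans[OF fp_vars_power assms(2)] insert.prems by simp
    then show ?case
      using insert by (simp add: order_trans[OF fp_vars_mult Un_least])
  qed simp_all
  have "fp_vars (single 0 (lookup p m) *
      (\<Prod>e\<in>keys m. h (fp_basis_var e) ^ lookup m e)) \<subseteq> S" if "m \<in> keys p" for m
    using prod[of "keys m" "lookup m"] that
    by (intro order_trans[OF fp_vars_mult Un_least]) (auto simp: fp_vars_def)
  then show ?thesis
    by (subst fp_hom.expand[OF h]) (intro order_trans[OF fp_vars_sum] UN_least)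
qed

lemma fp_vars_proj: "fp_vars (proj p) \<subseteq> range gen_var"
  by (rule fp_hom_vars[OF proj.fp_hom_axioms]) (simp add: proj_var fp_vars_basis_var)

lemma proj_proj [simp]: "proj (proj p) = proj p"
  by (rule proj_eq[OF fp_vars_proj])

lemma keys_fp_of_lie: "m \<in> keys (fp_of_lie u) \<Longrightarrow> \<exists>e. m = single e 1"
proof (induction u rule: lie_induct_basis)
  case (step c e u)
  have "fp_of_lie (lie_scale c (Rep_lie_basis e) + u) = single (single e 1) c + fp_of_lie u"
    by (simp add: fp_of_lie_add fp_of_lie_scale fp_of_lie_basis fp_scale_conv_mult fp_basis_var_def mult_single)
  then show ?case
    using step keys_add[of "single (single e 1) c" "fp_of_lie u"] by (auto split: if_splits)
qed simp

lemma keys_fp_of_lie_content: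
  fixes u :: "('k::field_char_0, 'x) free_lie"
  assumes "lie_content u M" "m \<in> keys (fp_of_lie u)"
  obtains e where "m = single e 1" "basis_content e = M"
proof -
  obtain e where e: "m = single e 1" using keys_fp_of_lie[OF assms(2)] by blast
  then have "e \<in> fp_vars (fp_of_lie u)" using assms(2) by (force simp: fp_vars_def)
  then show thesis using that e content_unique[OF assms(1)] by blast
qed

text \<open>All variables of a bracket of basis elements have the content of that bracket, which has
  at least two letters, so none of them is a generator.\<close>

lemma proj_br: "proj (fp_br p q) = 0"
proof -
  have "proj (fp_of_lie (lie_br (Rep_lie_basis d) (Rep_lie_basis e))) = 0" for d e :: "('a, 'b) lie_basis"
  proof -
    let ?u = "lie_br (Rep_lie_basis d) (Rep_lie_basis e)"
    have basis_content: "lie_content ?u (basis_content d + basis_content e)"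
      by (intro lie_content.br lie_content_content)
    have "proj (fp_of_lie ?u) = (\<Sum>m\<in>keys (fp_of_lie ?u). 0)"
    proof (subst proj.expand, rule sum.cong[OF HOL.refl])
      fix m assume "m \<in> keys (fp_of_lie ?u)"
      then obtain e' where e': "m = single e' 1" "basis_content e' = basis_content d + basis_content e"
        using keys_fp_of_lie_content[OF basis_content] by blast
      have "e' \<notin> range gen_var"
      proof
        assume "e' \<in> range gen_var"
        then obtain x where "e' = gen_var x" by blast
        then have "{#x#} = basis_content d + basis_content e" using e'(2) by simp
        then have "basis_content d = {#} \<or> basis_content e = {#}" unfolding single_is_union by blast
        then show False using lie_content_nonempty[OF lie_content_content] by auto
      qed
      then show "single 0 (lookup (fp_of_lie ?u) m) *
          (\<Prod>e\<in>keys m. proj (fp_basis_var e) ^ lookup m e) = 0"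
        by (simp add: e'(1) proj_var)
    qed
    then show ?thesis by simp
  qed
  then show ?thesis by (simp add: fp_br_def proj.sum proj.mult)
qed

lemma not_gen_var_br:
  fixes e :: "('k::field_char_0, 'x) lie_basis"
  assumes "e \<notin> range gen_var"
  obtains p q where "fp_basis_var e = fp_br p q"
proof -
  obtain u v where "Rep_lie_basis e = lie_br u v" using not_gen_var[OF assms] by metis
  then have "fp_basis_var e = fp_br (fp_of_lie u) (fp_of_lie v)"
    by (metis fp_of_lie_basis fp_br_of_lie)
  then show thesis by (rule that)
qed

text \<open>Every basis variable that is not a generator is itself a bracket, so a homomorphism
  killing brackets factors through \<open>proj\<close>.\<close>

lemma fp_hom_eq_proj:
  assumes h: "fp_hom (single 0) h" and br: "\<And>p q. h (fp_br p q) = 0"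
  shows "h p = h (proj p)"
proof -
  interpret h: fp_hom "single 0" h by fact
  have "fp_hom (single 0) (\<lambda>p. h (proj p))"
    by unfold_locales (simp_all add: proj.add proj.mult proj.const h.add h.mult h.const)
  then show ?thesis
  proof (rule fp_hom_eqI[OF h])
    fix e
    show "h (fp_basis_var e) = h (proj (fp_basis_var e))"
    proof (cases "e \<in> range gen_var")
      case True
      then show ?thesis by (simp add: proj_var)
    next
      case False
      then obtain p q where "fp_basis_var e = fp_br p q" using not_gen_var_br by blast
      then have "h (fp_basis_var e) = 0" by (simp add: br)
      then show ?thesis using False by (simp add: proj_var h.zero)
    qed
  qed
qed

lemma proj_endo:
  assumes "poisson_endo h"
  shows "proj (h p) = proj (h (proj p))"
proof -
  interpret h: poisson_endo h by fact
  have "fp_hom (single 0) (\<lambda>p. proj (h p))"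
    by unfold_locales (simp_all add: proj.add proj.mult proj.const h.add h.mult h.const)
  then show ?thesis by (rule fp_hom_eq_proj) (simp add: h.br proj_br)
qed

lemma proj_der:
  assumes "poisson_der d"
  shows "proj (d p) = proj (d (proj p))"
proof -
  interpret d: poisson_der d by fact
  show ?thesis
  proof (induction p rule: fp_induct)
    case (var e)
    show ?case
    proof (cases "e \<in> range gen_var")
      case False
      then obtain p q where "fp_basis_var e = fp_br p q" using not_gen_var_br by blast
      then have "proj (d (fp_basis_var e)) = 0" by (simp add: d.br proj.add proj_br)
      then show ?thesis using False by (simp add: proj_var d.zero proj.zero)
    qed (simp add: proj_var)
  qed (simp_all add: proj.const d.add proj.add d.mult proj.mult)
qed

lemma range_gen_var_2:
  assumes "a \<noteq> (b :: 2)"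
  shows "range gen_var = {gen_var a, gen_var b}"
proof -
  have "(UNIV :: 2 set) = {a, b}" using two_cases[OF assms] by auto
  then show ?thesis by (metis image_empty image_insert)
qed

section \<open>Automorphisms that are trivial modulo the commutator ideal\<close>

lemma degs_fp_of_lie:
  fixes u :: "('k::field_char_0, 'x) free_lie"
  assumes "lie_content u M"
  shows "degs (\<lambda>e. int (count (basis_content e) x)) (\<lambda>i. i = int (count M x)) (fp_of_lie u)"
  unfolding degs_def
proof
  fix m assume "m \<in> keys (fp_of_lie u)"
  then obtain e where "m = single e 1" "basis_content e = M"
    using keys_fp_of_lie_content[OF assms] by blast
  then show "wdeg (\<lambda>e. int (count (basis_content e) x)) m = int (count M x)" by simp
qed

lemma degs_br:
  fixes p q :: "('k::field_char_0, 'x) free_poisson"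
  assumes "degs (\<lambda>e. int (count (basis_content e) x)) (\<lambda>i. i \<le> a) p" "degs (\<lambda>e. int (count (basis_content e) x)) (\<lambda>i. i \<le> b) q"
  shows "degs (\<lambda>e. int (count (basis_content e) x)) (\<lambda>i. i \<le> a + b) (fp_br p q)"
  unfolding fp_br_def
proof (intro degs_sum)
  fix d e :: "('k, 'x) lie_basis"
  let ?\<omega> = "\<lambda>e :: ('k, 'x) lie_basis. int (count (basis_content e) x)"
  have 1: "degs ?\<omega> (\<lambda>i. i \<le> a + b - ?\<omega> d - ?\<omega> e) (fp_pderiv d p * fp_pderiv e q)"
    by (rule degs_mult[OF degs_pderiv[OF assms(1), of d] degs_pderiv[OF assms(2), of e]]) auto
  have "lie_content (lie_br (Rep_lie_basis d) (Rep_lie_basis e)) (basis_content d + basis_content e)"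
    by (intro lie_content.br lie_content_content)
  from degs_mult[OF 1 degs_fp_of_lie[OF this, of x]]
  show "degs ?\<omega> (\<lambda>i. i \<le> a + b) (fp_pderiv d p * fp_pderiv e q * fp_of_lie (lie_br (Rep_lie_basis d) (Rep_lie_basis e)))"
    by auto
qed

lemma degs_poisson_der:
  fixes d :: "('k::field_char_0, 'x) free_poisson \<Rightarrow> ('k, 'x) free_poisson"
  assumes "poisson_der d"
    and gen: "\<And>y. degs (\<lambda>e. int (count (basis_content e) x)) (\<lambda>i. i \<le> int (count {#y#} x)) (d (fp_gen y))"
    and p: "degs (\<lambda>e. int (count (basis_content e) x)) (\<lambda>i. i \<le> L) p"
  shows "degs (\<lambda>e. int (count (basis_content e) x)) (\<lambda>i. i \<le> L) (d p)"
proof -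
  interpret d: poisson_der d by fact
  let ?\<omega> = "\<lambda>e :: ('k, 'x) lie_basis. int (count (basis_content e) x)"
  have mon: "degs ?\<omega> (\<lambda>i. i \<le> int (count M x)) (d (fp_of_lie u))" if "lie_content u M" for u M
    using that
  proof (induction rule: lie_content.induct)
    case (gen y)
    show ?case using assms(2)[of y] by (simp add: fp_gen_def)
  next
    case (br u M v N)
    have "degs ?\<omega> (\<lambda>i. i \<le> int (count M x)) (fp_of_lie u)" "degs ?\<omega> (\<lambda>i. i \<le> int (count N x)) (fp_of_lie v)"
      using br.hyps by (auto intro: degs_mono[OF degs_fp_of_lie])
    then have "degs ?\<omega> (\<lambda>i. i \<le> int (count M x) + int (count N x)) (fp_br (d (fp_of_lie u)) (fp_of_lie v) + fp_br (fp_of_lie u) (d (fp_of_lie v)))"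
      using br.IH by (intro degs_add degs_br)
    then show ?case by (simp add: fp_br_of_lie[symmetric] d.br)
  qed
  show ?thesis
    unfolding d.chain_rule[OF finite_fp_vars order_refl, of p]
  proof (rule degs_sum)
    fix e
    have "degs ?\<omega> (\<lambda>i. i \<le> ?\<omega> e) (d (fp_basis_var e))"
      using mon[OF lie_content_content[of e]] by (simp add: fp_of_lie_basis)
    then show "degs ?\<omega> (\<lambda>i. i \<le> L) (fp_pderiv e p * d (fp_basis_var e))"
      by (rule degs_mult[OF degs_pderiv[OF p]]) auto
  qed
qed

text \<open>Substituting \<open>\<rho> e * t ^ \<omega> e\<close> for each variable turns weighted
  degree into degree in \<open>t\<close>. A homogeneous part of positive degree that survives at
  \<open>\<rho>\<close> yields a univariate polynomial of positive degree, whose powers have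
  unbounded degree.\<close>

lemma powers_unbounded_degree:
  fixes g :: "('k::field_char_0, 'x) free_poisson"
  assumes \<omega>: "\<And>e. 0 \<le> \<omega> e" and bound: "\<And>n. degs \<omega> (\<lambda>i. i \<le> L) (g ^ n)"
  shows "degs \<omega> (\<lambda>i. i = 0) g"
proof -
  have nonneg: "0 \<le> wdeg \<omega> m" for m unfolding wdeg_def using \<omega> by (intro sum_nonneg) simp
  have "wdeg \<omega> m = 0" if m: "m \<in> keys g" for m
  proof (rule ccontr)
    assume *: "wdeg \<omega> m \<noteq> 0"
    have wd: "int (\<Sum>e\<in>keys m. nat (\<omega> e) * lookup m e) = wdeg \<omega> m" for m
      using \<omega> by (simp add: wdeg_def mult.commute)
    have hp: "homog_part \<omega> (wdeg \<omega> m) g \<noteq> 0" using m by (metis (mono_tags, lifting) CollectI empty_iff keys_homog_part keys_zero)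
    obtain \<rho> where \<rho>: "fp_eval \<rho> (homog_part \<omega> (wdeg \<omega> m) g) \<noteq> 0"
      using fp_eval_nonzero2[OF hp hp] by blast
    define s where "s = fp_curve (\<lambda>e. monom (\<rho> e) (nat (\<omega> e)))"
    have s: "s p = (\<Sum>m\<in>keys p. monom (lookup p m * (\<Prod>e\<in>keys m. \<rho> e ^ lookup m e)) (nat (wdeg \<omega> m)))" for p
    proof -
      have "(\<Prod>e\<in>A. monom (f e) (k e)) = monom (\<Prod>e\<in>A. f e) (\<Sum>e\<in>A. k e)" if "finite A" for A f and k :: "('k, 'x) lie_basis \<Rightarrow> nat"
        using that by (induction A) (simp_all add: mult_monom one_pCons monom_0)
      note prod = this
      have "nat (wdeg \<omega> m) = (\<Sum>e\<in>keys m. nat (\<omega> e) * lookup m e)" for m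
        unfolding wd[symmetric] by (rule nat_int)
      then have "(\<Prod>e\<in>keys m. monom (\<rho> e) (nat (\<omega> e)) ^ lookup m e) =
          monom (\<Prod>e\<in>keys m. \<rho> e ^ lookup m e) (nat (wdeg \<omega> m))" for m
        unfolding monom_power by (simp add: prod)
      then show ?thesis by (simp add: s_def psubst_def smult_monom)
    qed
    have coeff: "coeff (s g) (nat (wdeg \<omega> m)) = fp_eval \<rho> (homog_part \<omega> (wdeg \<omega> m) g)"
    proof -
      have "fp_eval \<rho> (homog_part \<omega> (wdeg \<omega> m) g) = (\<Sum>n | n \<in> keys g \<and> wdeg \<omega> n = wdeg \<omega> m.
          lookup g n * (\<Prod>e\<in>keys n. \<rho> e ^ lookup n e))"
        unfolding psubst_def keys_homog_part by (intro sum.cong) (auto simp: lookup_homog_part)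
      also have "\<dots> = (\<Sum>n\<in>keys g. if wdeg \<omega> n = wdeg \<omega> m
          then lookup g n * (\<Prod>e\<in>keys n. \<rho> e ^ lookup n e) else 0)"
        by (rule sum.inter_filter) simp
      also have "\<dots> = coeff (s g) (nat (wdeg \<omega> m))"
        unfolding s coeff_sum by (intro sum.cong) (auto simp: nonneg eq_nat_nat_iff)
      finally show ?thesis by simp
    qed
    then have "nat (wdeg \<omega> m) \<le> degree (s g)" using \<rho> by (intro le_degree) simp
    then have "1 \<le> degree (s g)" using * nonneg[of m] by linarith
    have "degree (s (g ^ n)) = n * degree (s g)" for n
      using \<open>1 \<le> degree (s g)\<close> by (cases "s g = 0") (simp_all add: s_def fp_curve.power degree_power_eq)
    moreover have "degree (s (g ^ n)) \<le> nat L" for n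
      unfolding s using bound[of n]
      by (intro degree_sum_le) (auto simp: degs_def intro: order_trans[OF degree_monom_le] nat_mono)
    ultimately have "Suc (nat L) * degree (s g) \<le> nat L" by metis
    moreover have "Suc (nat L) * 1 \<le> Suc (nat L) * degree (s g)"
      using \<open>1 \<le> degree (s g)\<close> by (intro mult_le_mono2)
    ultimately show False by simp
  qed
  then show ?thesis by (simp add: degs_def)
qed

lemma automorphism_trivial_mod_commutators:
  fixes \<phi> :: "('k::field_char_0, 2) free_poisson \<Rightarrow> ('k, 2) free_poisson"
  assumes aut: "free_poisson.automorphism \<phi>" and triv: "\<And>c. proj (\<phi> (fp_gen c)) = fp_gen c"
  shows "\<phi> (fp_gen c) = fp_gen c"
proof -
  obtain \<psi> where \<psi>: "free_poisson.automorphism \<psi>" "\<And>p. \<phi> (\<psi> p) = p" "\<And>p. \<psi> (\<phi> p) = p"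
    using automorphism_inverse[OF aut] by metis
  interpret \<phi>: poisson_endo \<phi> by (rule automorphism_poisson_endo[OF aut])
  interpret \<psi>: poisson_endo \<psi> by (rule automorphism_poisson_endo[OF \<psi>(1)])
  have gen: "proj (fp_gen b) = (fp_gen b :: ('k, 2) free_poisson)" for b by (simp add: fp_gen_conv_var proj_var)
  have proj\<phi>: "proj (\<phi> p) = proj p" for p
  proof -
    have hom: "fp_hom (single 0) (\<lambda>p. proj (\<phi> p))"
      by unfold_locales (simp_all add: proj.add proj.mult proj.const \<phi>.add \<phi>.mult \<phi>.const)
    have "proj (\<phi> (proj p)) = proj (proj p)"
    proof (rule fp_hom_eqI[OF hom proj.fp_hom_axioms])
      fix e assume "e \<in> fp_vars (proj p)"
      then obtain b where "e = gen_var b" using fp_vars_proj by blast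
      then show "proj (\<phi> (fp_basis_var e)) = proj (fp_basis_var e)"
        using triv[of b] gen[of b] by (simp add: fp_gen_conv_var)
    qed
    then show ?thesis using proj_endo[OF \<phi>.poisson_endo_axioms, of p] by simp
  qed
  have proj\<psi>: "proj (\<psi> p) = proj p" for p using proj\<phi>[of "\<psi> p"] by (simp add: \<psi>)
  obtain i where i: "i \<noteq> c" by (metis zero_neq_one)
  let ?\<omega> = "\<lambda>e :: ('k, 2) lie_basis. int (count (basis_content e) i)"
  \<comment> \<open>\<open>L\<close> is fixed before \<open>n\<close>, so that one bound holds for
    all powers.\<close>
  obtain L where L: "degs ?\<omega> (\<lambda>j. j \<le> L) (\<phi> (fp_gen i))"
    unfolding degs_def by (metis (mono_tags, lifting) Max_ge finite_imageI finite_keys imageI)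
  have bound: "degs ?\<omega> (\<lambda>j. j \<le> L) (\<phi> (fp_gen c) ^ n)" for n
  proof -
    \<comment> \<open>The generator \<open>c\<close> to the power \<open>n\<close> times the
      derivative by the generator \<open>i\<close>; its square kills both generators.\<close>
    define D where "D = poisson_der_of (\<lambda>b. if b = i then fp_gen c ^ n else 0 :: ('k, 2) free_poisson)"
    interpret D: poisson_der D unfolding D_def by (rule poisson_der_poisson_der_of)
    have Dc: "D (fp_gen c) = 0" and Di: "D (fp_gen i) = fp_gen c ^ n" using i by (simp_all add: D_def)
    have Dpow: "D (fp_gen c ^ k) = 0" for k
      by (induction k) (use D.const[of 1] in \<open>simp_all add: D.mult Dc\<close>)
    have gens: "D.nilp (fp_gen b)" for b
    proof -
      have "(D ^^ 2) (fp_gen b) = 0"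
        using two_cases[OF i, of b] by (auto simp: numeral_2_eq_2 Dc Di Dpow D.zero)
      then show ?thesis unfolding D.nilp_def by blast
    qed
    define D' where "D' p = \<phi> (D (\<psi> p))" for p
    interpret D': poisson_der D'
      by unfold_locales
        (simp_all add: D'_def \<psi>.add \<psi>.mult \<psi>.const \<psi>.br D.add D.mult D.const D.br \<phi>.add \<phi>.mult \<phi>.br \<phi>.zero \<psi>(2))
    have iter: "(D' ^^ k) p = \<phi> ((D ^^ k) (\<psi> p))" for k p
      by (induction k) (simp_all add: D'_def \<psi>(2,3))
    have nil: "D'.nilp (fp_gen b)" for b
      using D.nilp_generators[OF gens, of "\<psi> (fp_gen b)"] unfolding D.nilp_def D'.nilp_def iter
      by (metis \<phi>.zero)
    \<comment> \<open>The values of \<open>D'\<close> on the generators already lie in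
      \<open>k[x, y]\<close>, so they can be compared with those of \<open>D\<close> modulo
      brackets, where \<open>\<phi>\<close> and \<open>\<psi>\<close> are trivial.\<close>
    have "D' (fp_gen b) = D (fp_gen b)" for b
    proof -
      have "D' (fp_gen b) = proj (D' (fp_gen b))"
        by (rule proj_eq[symmetric], rule locally_nilpotent_poisson_der[OF D'.poisson_der_axioms nil])
      also have "\<dots> = proj (D (fp_gen b))"
        using proj_der[OF D.poisson_der_axioms, of "\<psi> (fp_gen b)"] by (simp add: D'_def proj\<phi> proj\<psi> gen)
      also have "\<dots> = D (fp_gen b)"
        using i two_cases[OF i, of b] by (auto simp: Dc Di proj.zero proj.power gen)
      finally show ?thesis .
    qed
    then have "D (\<phi> (fp_gen i)) = D' (\<phi> (fp_gen i))"
      using poisson_der_eqI[OF D'.poisson_der_axioms D.poisson_der_axioms] by metis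
    also have "\<dots> = \<phi> (fp_gen c) ^ n" by (simp add: D'_def \<psi>(3) Di \<phi>.power)
    finally have "D (\<phi> (fp_gen i)) = \<phi> (fp_gen c) ^ n" .
    \<comment> \<open>\<open>D\<close> trades a generator \<open>i\<close> for powers of the other
      one, so it never raises the degree in \<open>i\<close>.\<close>
    moreover have "degs ?\<omega> (\<lambda>j. j \<le> L) (D (\<phi> (fp_gen i)))"
    proof (rule degs_poisson_der[OF D.poisson_der_axioms _ L])
      fix b
      have "degs ?\<omega> (\<lambda>j. j = 0) (fp_gen c)" using i by (simp add: fp_gen_conv_var degs_var)
      from degs_power[OF this, of n] have "degs ?\<omega> (\<lambda>j. j = 0) (fp_gen c ^ n)" by simp
      then show "degs ?\<omega> (\<lambda>j. j \<le> int (count {#b#} i)) (D (fp_gen b))"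
        using two_cases[OF i, of b] by (auto simp: Dc Di elim: degs_mono)
    qed
    ultimately show ?thesis by simp
  qed
  have "degs ?\<omega> (\<lambda>j. j = 0) (\<phi> (fp_gen c))"
    by (rule powers_unbounded_degree[OF _ bound]) simp
  \<comment> \<open>Every bracket in the basis contains the letter \<open>i\<close>, so an element
    of degree zero in \<open>i\<close> involves no brackets.\<close>
  have "fp_vars (\<phi> (fp_gen c)) \<subseteq> range gen_var"
  proof
    fix e assume "e \<in> fp_vars (\<phi> (fp_gen c))"
    then obtain m where m: "m \<in> keys (\<phi> (fp_gen c))" "e \<in> keys m" by (auto simp: fp_vars_def)
    have "wdeg ?\<omega> m = 0" using \<open>degs ?\<omega> (\<lambda>j. j = 0) (\<phi> (fp_gen c))\<close> m(1) by (simp add: degs_def)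
    then have "int (lookup m e) * ?\<omega> e = 0"
      using m(2) unfolding wdeg_def by (subst (asm) sum_nonneg_eq_0_iff) auto
    then have "count (basis_content e) i = 0" using m(2) by (simp add: in_keys_iff)
    show "e \<in> range gen_var"
    proof (rule ccontr)
      assume "e \<notin> range gen_var"
      then obtain x y where "x \<noteq> y" "x \<in># basis_content e" "y \<in># basis_content e" using not_gen_var by metis
      then show False using two_cases[of x y i] \<open>count (basis_content e) i = 0\<close> by (auto simp: count_eq_zero_iff)
    qed
  qed
  then show ?thesis using proj_eq triv by metis
qed

section \<open>Elementary automorphisms\<close>

definition elem :: "2 \<Rightarrow> 'k::field_char_0 \<Rightarrow> ('k, 2) free_poisson \<Rightarrow> ('k, 2) free_poisson \<Rightarrow> ('k, 2) free_poisson" where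
  "elem i \<alpha> h = poisson_hom (\<lambda>j. if j = i then fp_scale \<alpha> (fp_gen i) + h else fp_gen j)"

global_interpretation elem: poisson_endo "elem i \<alpha> h" for i \<alpha> h
  unfolding elem_def by (rule poisson_endo_poisson_hom)

lemma elem_gen:
  "elem i \<alpha> h (fp_gen i) = fp_scale \<alpha> (fp_gen i) + h"
  "j \<noteq> i \<Longrightarrow> elem i \<alpha> h (fp_gen j) = fp_gen j"
  by (simp_all add: elem_def)

lemma elem_fixes:
  assumes "fp_vars p \<subseteq> {gen_var j}" "j \<noteq> i"
  shows "elem i \<alpha> h p = p"
  by (rule fp_hom_eqI[OF elem.fp_hom_axioms fp_hom_id])
    (use assms elem_gen(2)[OF assms(2)] in \<open>auto simp: fp_gen_conv_var\<close>)

lemma subalgebra_generated_vars: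
  fixes p :: "('k::field_char_0, 'x) free_poisson"
  assumes "fp_vars p \<subseteq> gen_var ` J"
  shows "p \<in> free_poisson.subalgebra_generated (fp_gen ` J)"
proof -
  let ?S = "free_poisson.subalgebra_generated (fp_gen ` J) :: ('k, 'x) free_poisson set"
  have const: "single 0 c \<in> ?S" for c :: 'k
    using free_poisson.subalgebra_generated.scale[OF free_poisson.subalgebra_generated.one, of c]
    by (simp add: fp_scale_const)
  have pow: "q ^ n \<in> ?S" if "q \<in> ?S" for q n
    by (induction n) (simp_all add: that free_poisson.subalgebra_generated.one free_poisson.subalgebra_generated.mult)
  have sum: "sum f A \<in> ?S" if "\<And>a. a \<in> A \<Longrightarrow> f a \<in> ?S" for f and A :: "'c set"
    using that by (induction A rule: infinite_finite_induct)
      (use const[of 0] in \<open>simp_all add: free_poisson.subalgebra_generated.add\<close>)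
  have prod: "prod f A \<in> ?S" if "\<And>a. a \<in> A \<Longrightarrow> f a \<in> ?S" for f and A :: "('k, 'x) lie_basis set"
    using that by (induction A rule: infinite_finite_induct)
      (simp_all add: free_poisson.subalgebra_generated.one free_poisson.subalgebra_generated.mult)
  have var: "fp_basis_var e \<in> ?S" if e: "e \<in> fp_vars p" for e
  proof -
    obtain j where "j \<in> J" "e = gen_var j" using assms e by blast
    then show ?thesis by (auto simp: fp_gen_conv_var[symmetric] intro: free_poisson.subalgebra_generated.base)
  qed
  have "(\<Sum>m\<in>keys p. single 0 (lookup p m) *
     (\<Prod>e\<in>keys m. fp_basis_var e ^ lookup m e)) \<in> ?S"
    by (intro sum free_poisson.subalgebra_generated.mult const prod pow var) (auto simp: fp_vars_def)
  then show ?thesis using fp_hom.expand[OF fp_hom_id, of p] by simp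
qed

lemma elem_inverse:
  assumes "fp_vars h \<subseteq> {gen_var j}" "j \<noteq> i" "\<alpha> \<noteq> 0"
  shows "elem i (inverse \<alpha>) (fp_scale (- inverse \<alpha>) h) (elem i \<alpha> h p) = p"
proof (rule poisson_endo_eqI[OF poisson_endo_comp poisson_endo_id, OF elem.poisson_endo_axioms elem.poisson_endo_axioms])
  fix b
  show "elem i (inverse \<alpha>) (fp_scale (- inverse \<alpha>) h) (elem i \<alpha> h (fp_gen b)) = fp_gen b"
    using assms by (cases "b = i")
      (simp_all add: elem_gen elem.add elem.scale' elem_fixes free_poisson.scale_right_distrib
        free_poisson.scale_right_diff_distrib)
qed

lemma elementary_elem:
  assumes "fp_vars h \<subseteq> {gen_var j}" "j \<noteq> i" "\<alpha> \<noteq> 0"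
  shows "elementary (elem i \<alpha> h)"
proof -
  let ?h = "fp_scale (- inverse \<alpha>) h"
  have h: "fp_vars ?h \<subseteq> {gen_var j}" using assms(1) fp_vars_scale by blast
  have inv: "elem i \<alpha> h (elem i (inverse \<alpha>) ?h p) = p" for p
    using elem_inverse[OF h assms(2), of "inverse \<alpha>" p] assms(3) by simp
  have "free_poisson.automorphism (elem i \<alpha> h)"
    by (rule automorphismI[OF elem.poisson_endo_axioms elem.poisson_endo_axioms inv elem_inverse[OF assms]])
  moreover have "h \<in> free_poisson.subalgebra_generated (fp_gen ` {j. j \<noteq> i})"
    by (rule subalgebra_generated_vars) (use assms in blast)
  ultimately show ?thesis
    unfolding elementary_def using assms(3) elem_gen by blast
qed

text \<open>The elementary factor on the left is cancelled by its inverse, which is elementary too;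
  this undoes the reduction steps.\<close>

lemma tame_elem_comp:
  assumes "fp_vars h \<subseteq> {gen_var j}" "j \<noteq> i" "\<alpha> \<noteq> 0" "tame (elem i \<alpha> h \<circ> \<phi>)"
  shows "tame \<phi>"
proof -
  let ?h = "fp_scale (- inverse \<alpha>) h"
  have h: "fp_vars ?h \<subseteq> {gen_var j}" using assms(1) fp_vars_scale by blast
  have "elem i (inverse \<alpha>) ?h \<circ> (elem i \<alpha> h \<circ> \<phi>) = \<phi>"
    by (rule ext) (simp only: o_apply elem_inverse[OF assms(1-3)])
  moreover have "elementary (elem i (inverse \<alpha>) ?h)"
    by (rule elementary_elem[OF h assms(2)]) (use assms(3) in simp)
  ultimately show ?thesis using tame.comp assms(4) by metis
qed

text \<open>\<open>elem i \<alpha> h\<close> preserves \<open>k[x, y]\<close>, so composing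
  \<open>\<phi>\<close> with it substitutes into the images of the generators modulo
  brackets.\<close>

lemma proj_elem:
  assumes "fp_vars h \<subseteq> {gen_var j}" "j \<noteq> i"
  shows "proj (elem i \<alpha> h p) = elem i \<alpha> h (proj p)"
proof -
  have "fp_vars (elem i \<alpha> h (proj p)) \<subseteq> range gen_var"
  proof (rule fp_hom_vars[OF elem.fp_hom_axioms])
    fix e assume "e \<in> fp_vars (proj p)"
    then obtain b where b: "e = gen_var b" using fp_vars_proj by blast
    have "fp_vars (elem i \<alpha> h (fp_gen b)) \<subseteq> range gen_var"
    proof (cases "b = i")
      case True
      have "fp_vars (fp_scale \<alpha> (fp_gen i) + h) \<subseteq> fp_vars (fp_gen i) \<union> fp_vars h"
        using fp_vars_add fp_vars_scale by blast
      then show ?thesis unfolding True elem_gen using assms by (auto simp: fp_gen_conv_var fp_vars_basis_var)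
    next
      case False
      then show ?thesis unfolding elem_gen(2)[OF False] by (simp add: fp_gen_conv_var fp_vars_basis_var)
    qed
    then show "fp_vars (elem i \<alpha> h (fp_basis_var e)) \<subseteq> range gen_var" by (simp add: b fp_gen_conv_var)
  qed
  then show ?thesis using proj_endo[OF elem.poisson_endo_axioms, of i \<alpha> h p] proj_eq by metis
qed

lemma tame_trivial_mod_commutators:
  fixes \<phi> :: "('k::field_char_0, 2) free_poisson \<Rightarrow> ('k, 2) free_poisson"
  assumes aut: "free_poisson.automorphism \<phi>" and triv: "\<And>c. proj (\<phi> (fp_gen c)) = fp_gen c"
  shows "tame \<phi>"
proof -
  have "\<phi> (fp_gen c) = fp_gen c" for c by (rule automorphism_trivial_mod_commutators[OF assms])
  moreover have "(0 :: ('k, 2) free_poisson) \<in> free_poisson.subalgebra_generated (fp_gen ` {j. j \<noteq> 0})"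
    by (rule subalgebra_generated_vars) simp
  ultimately have "elementary \<phi>"
    unfolding elementary_def using aut by (intro conjI exI[of _ 0] exI[of _ 1]) auto
  then show ?thesis by (rule tame.elementary)
qed

section \<open>Tameness\<close>

text \<open>The chain rule for \<open>\<phi>\<close> composed with its inverse exhibits the Jacobian
  as a unit, hence a nonzero constant. The derivation \<open>{g, \<cdot>}\<close> therefore kills
  \<open>g\<close> and sends \<open>f\<close> to a constant; since \<open>\<phi>\<close> is onto,
  \<open>f\<close> and \<open>g\<close> generate \<open>k[x, y]\<close>, and local nilpotence
  spreads to all elements.\<close>

lemma jacobian_unit:
  fixes \<phi> :: "('k::field_char_0, 2) free_poisson \<Rightarrow> ('k, 2) free_poisson"
  assumes aut: "free_poisson.automorphism \<phi>"
  defines "f \<equiv> proj (\<phi> (fp_gen 0))" and "g \<equiv> proj (\<phi> (fp_gen 1))"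
  shows "\<exists>c. c \<noteq> 0 \<and> fp_pderiv (gen_var 0) f * fp_pderiv (gen_var 1) g -
      fp_pderiv (gen_var 1) f * fp_pderiv (gen_var 0) g = single 0 c"
    and "ham.nilp (gen_var 0) (gen_var 1) g p"
proof -
  define u where "u = (gen_var 0 :: ('k, 2) lie_basis)"
  define v where "v = (gen_var 1 :: ('k, 2) lie_basis)"
  have uv: "u \<noteq> v" by (simp add: u_def v_def)
  have rng: "range gen_var = {u, v}" unfolding u_def v_def by (rule range_gen_var_2) simp
  obtain \<psi> where \<psi>: "free_poisson.automorphism \<psi>" "\<And>p. \<phi> (\<psi> p) = p" "\<And>p. \<psi> (\<phi> p) = p"
    using automorphism_inverse[OF aut] by metis
  interpret \<phi>: poisson_endo \<phi> by (rule automorphism_poisson_endo[OF aut])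
  have hom: "fp_hom (single 0) (\<lambda>p. proj (\<phi> p))"
    by unfold_locales (simp_all add: proj.add proj.mult proj.const \<phi>.add \<phi>.mult \<phi>.const)
  interpret \<mu>: fp_hom "single 0" "\<lambda>p. proj (\<phi> p)" by (rule hom)
  have fg: "proj (\<phi> (fp_basis_var u)) = f" "proj (\<phi> (fp_basis_var v)) = g"
    by (simp_all add: f_def g_def u_def v_def fp_gen_conv_var)
  define A where "A = proj (\<psi> (fp_basis_var u))"
  define B where "B = proj (\<psi> (fp_basis_var v))"
  have onto: "proj (\<phi> (proj (\<psi> p))) = proj p" for p
    using proj_endo[OF \<phi>.poisson_endo_axioms, of "\<psi> p"] by (simp add: \<psi>)
  have AB: "proj (\<phi> A) = fp_basis_var u" "proj (\<phi> B) = fp_basis_var v"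
    by (simp_all add: A_def B_def onto proj_var rng)
  have chain: "fp_pderiv e (proj (\<phi> p)) = proj (\<phi> (fp_pderiv u p)) * fp_pderiv e f + proj (\<phi> (fp_pderiv v p)) * fp_pderiv e g"
    if "fp_vars p \<subseteq> {u, v}" for e p
    using fp_hom_chain_rule[OF hom, of "\<lambda>p. fp_pderiv e (proj (\<phi> p))" "{u, v}" p, OF _ _ _ _ that] uv fg
    by (simp add: \<mu>.add \<mu>.mult \<mu>.const fp_pderiv_add fp_pderiv_mult fp_pderiv_not_in_vars)
  have vars: "fp_vars A \<subseteq> {u, v}" "fp_vars B \<subseteq> {u, v}"
    using fp_vars_proj[of "\<psi> (fp_basis_var u)"] fp_vars_proj[of "\<psi> (fp_basis_var v)"]
    by (simp_all add: A_def B_def rng)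
  let ?m = "\<lambda>p. proj (\<phi> p)"
  have eqs: "1 = ?m (fp_pderiv u A) * fp_pderiv u f + ?m (fp_pderiv v A) * fp_pderiv u g"
    "0 = ?m (fp_pderiv u A) * fp_pderiv v f + ?m (fp_pderiv v A) * fp_pderiv v g"
    "0 = ?m (fp_pderiv u B) * fp_pderiv u f + ?m (fp_pderiv v B) * fp_pderiv u g"
    "1 = ?m (fp_pderiv u B) * fp_pderiv v f + ?m (fp_pderiv v B) * fp_pderiv v g"
    using chain[OF vars(1), of u] chain[OF vars(1), of v] chain[OF vars(2), of u] chain[OF vars(2), of v] uv
    by (simp_all add: AB fp_pderiv_var)
  \<comment> \<open>Multiplicativity of the determinant of two by two matrices.\<close>
  have det: "(a * x + b * z) * (c * y + d * w) - (a * y + b * w) * (c * x + d * z) = (x * w - y * z) * (a * d - b * c)"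
    for a b c d x y z w :: "('k, 2) free_poisson" by (simp add: algebra_simps)
  have "(fp_pderiv u f * fp_pderiv v g - fp_pderiv v f * fp_pderiv u g) *
      (?m (fp_pderiv u A) * ?m (fp_pderiv v B) - ?m (fp_pderiv v A) * ?m (fp_pderiv u B)) = 1"
    unfolding det[symmetric] eqs[symmetric] by simp
  then obtain c where c: "fp_pderiv u f * fp_pderiv v g - fp_pderiv v f * fp_pderiv u g = single 0 c" "c \<noteq> 0"
    using fp_unit_const by metis
  then show "\<exists>c. c \<noteq> 0 \<and> fp_pderiv (gen_var 0) f * fp_pderiv (gen_var 1) g -
      fp_pderiv (gen_var 1) f * fp_pderiv (gen_var 0) g = single 0 c"
    unfolding u_def v_def by blast
  have "ham u v g f = - (fp_pderiv u f * fp_pderiv v g - fp_pderiv v f * fp_pderiv u g)"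
    by (simp add: ham_def mult.commute)
  then have "ham u v g f = single 0 (- c)" by (simp add: c(1) single_uminus)
  then have "(ham u v g ^^ 2) f = 0" by (simp add: numeral_2_eq_2 ham.const)
  then have nf: "ham.nilp u v g f" unfolding ham.nilp_def by blast
  have "(ham u v g ^^ 1) g = 0" by (simp add: ham_self)
  then have ng: "ham.nilp u v g g" unfolding ham.nilp_def by blast
  have "ham.nilp u v g (proj (\<phi> q))" for q
  proof (induction q rule: fp_induct)
    case (var e)
    show ?case
    proof (cases "e \<in> range gen_var")
      case True
      then show ?thesis using nf ng fg unfolding rng by auto
    next
      case False
      then obtain p q where "fp_basis_var e = fp_br p q" using not_gen_var_br by blast
      then show ?thesis by (simp add: \<phi>.br proj_br ham.nilp_zero)
    qed
  qed (simp_all add: \<mu>.const \<mu>.add \<mu>.mult ham.nilp_const ham.nilp_add ham.nilp_mult)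
  from this[of A] this[of B] show "ham.nilp (gen_var 0) (gen_var 1) g p"
    unfolding AB u_def[symmetric] v_def[symmetric] by (rule ham_nilp_all)
qed

lemma const_if_pderiv_const:
  fixes p :: "('k::field_char_0, 'x) free_poisson"
  assumes "fp_pderiv e p = single 0 c"
  shows "fp_vars (p - fp_scale c (fp_basis_var e)) \<subseteq> fp_vars p - {e}"
proof
  fix d assume d: "d \<in> fp_vars (p - fp_scale c (fp_basis_var e))"
  have "fp_pderiv e (p - fp_scale c (fp_basis_var e)) = 0"
    by (simp add: fp_pderiv_diff fp_pderiv_scale fp_pderiv_var assms fp_scale_const)
  then have "d \<noteq> e" using d fp_pderiv_nonzero by blast
  moreover have "d \<in> fp_vars p \<union> {e}"
    using d fp_vars_diff fp_vars_scale fp_vars_basis_var by fast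
  ultimately show "d \<in> fp_vars p - {e}" by blast
qed

text \<open>Two elementary maps normalise the images of the generators modulo brackets to the
  generators themselves.\<close>

lemma tame_if_gen_triangular:
  fixes \<phi> :: "('k::field_char_0, 2) free_poisson \<Rightarrow> ('k, 2) free_poisson"
  assumes aut: "free_poisson.automorphism \<phi>"
    and f: "proj (\<phi> (fp_gen 0)) = fp_scale \<gamma> (fp_gen 0) + h" "\<gamma> \<noteq> 0" "fp_vars h \<subseteq> {gen_var 1}"
    and g: "proj (\<phi> (fp_gen 1)) = fp_scale \<alpha> (fp_gen 1) + single 0 \<beta>" "\<alpha> \<noteq> 0"
  shows "tame \<phi>"
proof -
  let ?h = "fp_scale (- inverse \<gamma>) h" and ?b = "fp_scale (- inverse \<alpha>) (single 0 \<beta>)"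
  have h: "fp_vars ?h \<subseteq> {gen_var 1}" using f(3) fp_vars_scale by blast
  have b: "fp_vars ?b \<subseteq> {gen_var 0}" by (simp add: fp_scale_const)
  let ?\<sigma> = "elem 0 (inverse \<gamma>) ?h" and ?\<tau> = "elem 1 (inverse \<alpha>) ?b"
  have \<sigma>: "elementary ?\<sigma>" by (rule elementary_elem[OF h]) (use f in auto)
  have \<tau>: "elementary ?\<tau>" by (rule elementary_elem[OF b]) (use g in auto)
  have "free_poisson.automorphism (?\<tau> \<circ> (?\<sigma> \<circ> \<phi>))"
    using \<sigma> \<tau> aut by (intro automorphism_comp) (auto simp: elementary_def)
  moreover have "proj ((?\<tau> \<circ> (?\<sigma> \<circ> \<phi>)) (fp_gen c)) = fp_gen c" for c
  proof -
    have "?\<sigma> h = h" by (rule elem_fixes[OF f(3)]) simp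
    then have 0: "?\<sigma> (proj (\<phi> (fp_gen 0))) = fp_gen 0"
      using f(2) by (simp add: f(1) elem.add elem.scale' elem_gen free_poisson.scale_right_distrib
          free_poisson.scale_right_diff_distrib)
    have 1: "?\<sigma> (proj (\<phi> (fp_gen 1))) = fp_scale \<alpha> (fp_gen 1) + single 0 \<beta>"
      by (simp add: g(1) elem.add elem.scale' elem_gen elem.const)
    have 2: "?\<tau> (fp_gen 0) = fp_gen 0" by (simp add: elem_gen)
    have 3: "?\<tau> (fp_scale \<alpha> (fp_gen 1) + single 0 \<beta>) = fp_gen 1"
      using g(2) by (simp add: elem.add elem.scale' elem_gen elem.const
          free_poisson.scale_right_distrib free_poisson.scale_right_diff_distrib)
    have "proj ((?\<tau> \<circ> (?\<sigma> \<circ> \<phi>)) (fp_gen c)) = ?\<tau> (?\<sigma> (proj (\<phi> (fp_gen c))))"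
      using proj_elem[OF b, of 1] proj_elem[OF h, of 0] by simp
    also have "\<dots> = fp_gen c" using two_cases[of "0 :: 2" 1 c] 0 1 2 3 by auto
    finally show ?thesis .
  qed
  ultimately have 1: "tame (?\<tau> \<circ> (?\<sigma> \<circ> \<phi>))" by (rule tame_trivial_mod_commutators)
  have 2: "tame (?\<sigma> \<circ> \<phi>)" by (rule tame_elem_comp[OF b _ _ 1]) (use g(2) in auto)
  show ?thesis by (rule tame_elem_comp[OF h _ _ 2]) (use f(2) in auto)
qed

lemma product_unit_const:
  fixes p q :: "('k::field_char_0, 'x) free_poisson"
  assumes "p * q = single 0 c" "c \<noteq> 0"
  obtains a b where "p = single 0 a" "a \<noteq> 0" "q = single 0 b" "b \<noteq> 0"
proof -
  have "p * fp_scale (inverse c) q = 1" "q * fp_scale (inverse c) p = 1"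
    using assms by (simp_all add: fp_scale_mult_right fp_scale_const mult.commute[of q])
  then show thesis using that fp_unit_const by metis
qed

text \<open>With one partial derivative of \<open>g\<close> equal to zero, the Jacobian is a product
  of two factors. Both must be constant, which makes the images of the generators triangular modulo
  brackets.\<close>

lemma tame_if_univariate:
  fixes \<phi> :: "('k::field_char_0, 2) free_poisson \<Rightarrow> ('k, 2) free_poisson"
  assumes aut: "free_poisson.automorphism \<phi>" and "gen_var 0 \<notin> fp_vars (proj (\<phi> (fp_gen 1)))"
  shows "tame \<phi>"
proof -
  let ?f = "proj (\<phi> (fp_gen 0))" and ?g = "proj (\<phi> (fp_gen 1))"
  have rng: "range gen_var = {gen_var 0, gen_var 1 :: ('k, 2) lie_basis}" by (rule range_gen_var_2) simp
  obtain c where c: "c \<noteq> 0" "fp_pderiv (gen_var 0) ?f * fp_pderiv (gen_var 1) ?g = single 0 c"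
    using jacobian_unit(1)[OF aut] assms(2) by (auto simp: fp_pderiv_not_in_vars)
  obtain \<gamma> \<alpha> where \<gamma>: "fp_pderiv (gen_var 0) ?f = single 0 \<gamma>" "\<gamma> \<noteq> 0"
    and \<alpha>: "fp_pderiv (gen_var 1) ?g = single 0 \<alpha>" "\<alpha> \<noteq> 0"
    using product_unit_const[OF c(2,1)] by metis
  have "fp_vars (?f - fp_scale \<gamma> (fp_gen 0)) \<subseteq> {gen_var 1}"
    using const_if_pderiv_const[OF \<gamma>(1)] fp_vars_proj[of "\<phi> (fp_gen 0)"] unfolding rng by (auto simp: fp_gen_conv_var)
  moreover have "fp_vars (?g - fp_scale \<alpha> (fp_gen 1)) \<subseteq> {}"
    using const_if_pderiv_const[OF \<alpha>(1)] fp_vars_proj[of "\<phi> (fp_gen 1)"] assms(2) unfolding rng by (auto simp: fp_gen_conv_var)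
  then obtain \<beta> where "?g - fp_scale \<alpha> (fp_gen 1) = single 0 \<beta>" using fp_vars_empty_iff by blast
  ultimately show ?thesis
    using tame_if_gen_triangular[OF aut, of \<gamma> "?f - fp_scale \<gamma> (fp_gen 0)" \<alpha> \<beta>] \<gamma>(2) \<alpha>(2)
    by (simp add: algebra_simps)
qed

lemma tame_if_univariate':
  fixes \<phi> :: "('k::field_char_0, 2) free_poisson \<Rightarrow> ('k, 2) free_poisson"
  assumes aut: "free_poisson.automorphism \<phi>" and "gen_var 1 \<notin> fp_vars (proj (\<phi> (fp_gen 1)))"
  shows "tame \<phi>"
proof -
  let ?f = "proj (\<phi> (fp_gen 0))" and ?g = "proj (\<phi> (fp_gen 1))"
  have rng: "range gen_var = {gen_var 0, gen_var 1 :: ('k, 2) lie_basis}" by (rule range_gen_var_2) simp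
  obtain c where c: "c \<noteq> 0" "fp_pderiv (gen_var 1) ?f * fp_pderiv (gen_var 0) ?g = single 0 (- c)"
    using jacobian_unit(1)[OF aut] assms(2) by (auto simp: fp_pderiv_not_in_vars single_uminus minus_equation_iff[of "_ * _"])
  then obtain \<alpha> where \<alpha>: "fp_pderiv (gen_var 0) ?g = single 0 \<alpha>" "\<alpha> \<noteq> 0"
    using product_unit_const[OF c(2)] by (metis neg_equal_0_iff_equal)
  have "fp_vars (?g - fp_scale \<alpha> (fp_gen 0)) \<subseteq> {}"
    using const_if_pderiv_const[OF \<alpha>(1)] fp_vars_proj[of "\<phi> (fp_gen 1)"] assms(2) unfolding rng by (auto simp: fp_gen_conv_var)
  then obtain \<beta> where "?g - fp_scale \<alpha> (fp_gen 0) = single 0 \<beta>" using fp_vars_empty_iff by blast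
  then have g: "?g = fp_scale \<alpha> (fp_gen 0) + single 0 \<beta>" by (simp add: algebra_simps)
  have h1: "fp_vars (fp_gen 1 :: ('k, 2) free_poisson) \<subseteq> {gen_var 1}" by (simp add: fp_gen_conv_var fp_vars_basis_var)
  have h0: "fp_vars (- fp_gen 0 :: ('k, 2) free_poisson) \<subseteq> {gen_var 0}" by (simp add: fp_gen_conv_var fp_vars_basis_var)
  \<comment> \<open>\<open>?\<tau> \<circ> ?\<sigma>\<close> sends generator \<open>0\<close> to
    generator \<open>1\<close>, which reduces to the case where \<open>g\<close> depends on
    generator \<open>1\<close> only.\<close>
  let ?\<sigma> = "elem 0 1 (fp_gen 1) :: ('k, 2) free_poisson \<Rightarrow> _" and ?\<tau> = "elem 1 1 (- fp_gen 0) :: ('k, 2) free_poisson \<Rightarrow> _"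
  have \<sigma>: "elementary ?\<sigma>" by (rule elementary_elem[OF h1]) auto
  have \<tau>: "elementary ?\<tau>" by (rule elementary_elem[OF h0]) auto
  have "free_poisson.automorphism (?\<tau> \<circ> (?\<sigma> \<circ> \<phi>))"
    using \<sigma> \<tau> aut by (intro automorphism_comp) (auto simp: elementary_def)
  moreover have "proj ((?\<tau> \<circ> (?\<sigma> \<circ> \<phi>)) (fp_gen 1)) = fp_scale \<alpha> (fp_gen 1) + single 0 \<beta>"
  proof -
    have "proj ((?\<tau> \<circ> (?\<sigma> \<circ> \<phi>)) (fp_gen 1)) = ?\<tau> (?\<sigma> ?g)"
      using proj_elem[OF h0, of 1] proj_elem[OF h1, of 0] by simp
    also have "\<dots> = fp_scale \<alpha> (fp_gen 1) + single 0 \<beta>"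
      by (simp add: g elem.add elem.scale' elem.const elem_gen)
    finally show ?thesis .
  qed
  moreover have "fp_vars (fp_scale \<alpha> (fp_gen 1 :: ('k, 2) free_poisson) + single 0 \<beta>) \<subseteq> {gen_var 1}"
    by (intro order_trans[OF fp_vars_add] Un_least order_trans[OF fp_vars_scale h1]) simp
  then have "gen_var 0 \<notin> fp_vars (fp_scale \<alpha> (fp_gen 1 :: ('k, 2) free_poisson) + single 0 \<beta>)"
    by auto
  ultimately have 1: "tame (?\<tau> \<circ> (?\<sigma> \<circ> \<phi>))" by (intro tame_if_univariate) simp_all
  have 2: "tame (?\<sigma> \<circ> \<phi>)" by (rule tame_elem_comp[OF h0 _ _ 1]) auto
  show ?thesis by (rule tame_elem_comp[OF h1 _ _ 2]) auto
qed

theorem theorem2: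
  fixes \<phi> :: "('k::field_char_0, 2) free_poisson \<Rightarrow> ('k, 2) free_poisson"
  assumes "free_poisson.automorphism \<phi>"
  shows "tame \<phi>"
  using assms
\<comment> \<open>The measure involves the image of generator \<open>1\<close> alone: when one of
  its two degrees is zero, the Jacobian settles the other image.\<close>
proof (induction "deg_in (gen_var 0) (proj (\<phi> (fp_gen 1))) + deg_in (gen_var 1) (proj (\<phi> (fp_gen 1)))"
    arbitrary: \<phi> rule: less_induct)
  case less
  define g where "g = proj (\<phi> (fp_gen 1))"
  have rng: "range gen_var = {gen_var 0, gen_var 1 :: ('k, 2) lie_basis}" by (rule range_gen_var_2) simp
  have vars: "fp_vars g \<subseteq> {gen_var 0, gen_var 1}" unfolding g_def rng[symmetric] by (rule fp_vars_proj)
  have nil: "ham.nilp (gen_var 0) (gen_var 1) g p" for p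
    unfolding g_def by (rule jacobian_unit(2)[OF less.prems])
  show ?case
  proof (cases "deg_in (gen_var 0) g = 0 \<or> deg_in (gen_var 1) g = 0")
    case True
    then show ?thesis
      using tame_if_univariate[OF less.prems] tame_if_univariate'[OF less.prems] by (auto simp: deg_in_zero_iff g_def)
  next
    case False
    then have pos: "deg_in (gen_var 0) g > 0" "deg_in (gen_var 1) g > 0" by auto
    have step: "tame \<phi>"
      if ij: "i \<noteq> j" and l: "l > 0" "deg_in (gen_var j) g = l * deg_in (gen_var i) g"
        and root: "(\<Sum>m | m \<in> keys g \<and>
            l * lookup m (gen_var i) + lookup m (gen_var j) = l * deg_in (gen_var i) g.
            lookup g m * c ^ lookup m (gen_var i)) = 0" for i j :: 2 and l c
    proof -
      let ?h = "fp_scale c (fp_basis_var (gen_var j) ^ l) :: ('k, 2) free_poisson"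
      have h: "fp_vars ?h \<subseteq> {gen_var j}"
        by (rule order_trans[OF order_trans[OF fp_vars_scale fp_vars_power]]) (simp add: fp_vars_basis_var)
      let ?\<sigma> = "elem i 1 ?h"
      have cases: "i = 0 \<and> j = 1 \<or> i = 1 \<and> j = 0" using ij two_cases[of "0 :: 2" 1 i] two_cases[of "0 :: 2" 1 j] by auto
      have vars': "fp_vars g \<subseteq> {gen_var i, gen_var j}" using vars cases by auto
      have triangle: "l * lookup m (gen_var i) + lookup m (gen_var j) \<le> l * deg_in (gen_var i) g"
        if m: "m \<in> keys g" for m
      proof -
        have "deg_in (gen_var j) g * lookup m (gen_var i) + deg_in (gen_var i) g * lookup m (gen_var j)
            \<le> deg_in (gen_var i) g * deg_in (gen_var j) g"
          using ham_newton_triangle[OF _ vars nil pos m] cases by (auto simp: algebra_simps)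
        then have "deg_in (gen_var i) g * (l * lookup m (gen_var i) + lookup m (gen_var j))
            \<le> deg_in (gen_var i) g * (l * deg_in (gen_var i) g)"
          unfolding l(2) by (simp add: algebra_simps)
        then show ?thesis using pos cases by auto
      qed
      have posi: "deg_in (gen_var i) g > 0" using pos cases by auto
      have "proj ((?\<sigma> \<circ> \<phi>) (fp_gen 1)) = ?\<sigma> g"
        using proj_elem[OF h ij[symmetric]] by (simp add: g_def)
      moreover have "deg_in (gen_var i) (?\<sigma> g) + deg_in (gen_var j) (?\<sigma> g) < deg_in (gen_var i) g + deg_in (gen_var j) g"
        using elem_gen(1)[of i 1 ?h] elem_gen(2)[OF ij[symmetric], of 1 ?h]
        by (intro edge_substitution(2)[OF _ vars' l(2,1) posi triangle root elem.fp_hom_axioms])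
          (use ij in \<open>auto simp: fp_gen_conv_var\<close>)
      ultimately have smaller: "deg_in (gen_var 0) (proj ((?\<sigma> \<circ> \<phi>) (fp_gen 1))) + deg_in (gen_var 1) (proj ((?\<sigma> \<circ> \<phi>) (fp_gen 1)))
          < deg_in (gen_var 0) (proj (\<phi> (fp_gen 1))) + deg_in (gen_var 1) (proj (\<phi> (fp_gen 1)))"
        unfolding g_def[symmetric] using cases by auto
      have "elementary ?\<sigma>" by (rule elementary_elem[OF h ij[symmetric]]) simp
      then have "free_poisson.automorphism (?\<sigma> \<circ> \<phi>)"
        using less.prems by (intro automorphism_comp) (auto simp: elementary_def)
      from less.hyps[OF smaller this] have "tame (?\<sigma> \<circ> \<phi>)" .
      from tame_elem_comp[OF h ij[symmetric] _ this] show ?thesis by simp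
    qed
    have "gen_var 0 \<noteq> (gen_var 1 :: ('k, 2) lie_basis)" by simp
    from ham_edge[OF this vars nil pos] show ?thesis
      using step[of 0 1] step[of 1 0] by (auto simp: add.commute)
  qed
qed

end
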